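(* Let $\mu$ be a log-concave probability measure on $\mathbb{R}^n$ and let $\gamma$ be the standard Gaussian probability measure on $\mathbb{R}^n$. Then there exists a contraction $T:\mathbb{R}^n\to\mathbb{R}^n$ that pushes forward $\mu*\gamma$ to $\mu$.
   Context: A non-negative function $\rho$ on $\mathbb{R}^n$ is log-concave if $K=\{x\in\mathbb{R}^n : \rho(x)>0\}$ is convex and $\log\rho$ is concave in $K$. An absolutely continuous probability measure on $\mathbb{R}^n$ is log-concave if it has a log-concave density. An arbitrary probability measure on $\mathbb{R}^n$ is log-concave if it is the pushforward of some absolutely continuous log-concave probability measure on some $\mathbb{R}^k$ under an injective affine map. A map $T:\mathbb{R}^n\to\mathbb{R}^n$ is a contraction if $|T(x)-T(y)|\le|x-y|$ for all $x,y\in\mathbb{R}^n$, where $|\cdot|$ is the Euclidean norm. $\mu*\gamma$ denotes convolution. *)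

theory Defs
  imports "HOL-Probability.Probability"
begin

text \<open>
  The dimension \<open>k\<close> in the definition of a log-concave measure is existentially quantified, so
  \<open>\<real>\<^sup>k\<close> cannot be a type. It is modelled as the set of functions \<open>nat \<Rightarrow> real\<close> that are
  extensional on \<open>{..<k}\<close>, with Lebesgue measure being the product of \<open>k\<close> copies of
  \<^const>\<open>lborel\<close>. For \<open>k = 0\<close> this is a single point of mass one, so that Dirac measures are
  log-concave.
\<close>

abbreviation Rn :: "nat \<Rightarrow> (nat \<Rightarrow> real) set" where
  "Rn k \<equiv> {..<k} \<rightarrow>\<^sub>E UNIV"

abbreviation lborel_Rn :: "nat \<Rightarrow> (nat \<Rightarrow> real) measure" where
  "lborel_Rn k \<equiv> \<Pi>\<^sub>M i\<in>{..<k}. lborel"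

definition seg_pt :: "nat \<Rightarrow> real \<Rightarrow> (nat \<Rightarrow> real) \<Rightarrow> (nat \<Rightarrow> real) \<Rightarrow> nat \<Rightarrow> real" where
  "seg_pt k t x y = (\<lambda>i\<in>{..<k}. (1 - t) * x i + t * y i)"

definition convex_Rn :: "nat \<Rightarrow> (nat \<Rightarrow> real) set \<Rightarrow> bool" where
  "convex_Rn k K \<longleftrightarrow> K \<subseteq> Rn k \<and> (\<forall>x\<in>K. \<forall>y\<in>K. \<forall>t\<in>{0..1}. seg_pt k t x y \<in> K)"

definition concave_on_Rn :: "nat \<Rightarrow> (nat \<Rightarrow> real) set \<Rightarrow> ((nat \<Rightarrow> real) \<Rightarrow> real) \<Rightarrow> bool" where
  "concave_on_Rn k K f \<longleftrightarrow> convex_Rn k K \<and>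
     (\<forall>x\<in>K. \<forall>y\<in>K. \<forall>t\<in>{0..1}. f (seg_pt k t x y) \<ge> (1 - t) * f x + t * f y)"

definition log_concave_fun :: "nat \<Rightarrow> ((nat \<Rightarrow> real) \<Rightarrow> real) \<Rightarrow> bool" where
  "log_concave_fun k \<rho> \<longleftrightarrow> (\<forall>x\<in>Rn k. \<rho> x \<ge> 0) \<and>
     convex_Rn k {x \<in> Rn k. \<rho> x > 0} \<and>
     concave_on_Rn k {x \<in> Rn k. \<rho> x > 0} (\<lambda>x. ln (\<rho> x))"

text \<open>
  Asking for a Borel density loses nothing: a log-concave density is continuous on the interior
  of its support, and setting it to zero on the (null) boundary keeps it log-concave.
\<close>

definition ac_log_concave_measure :: "nat \<Rightarrow> (nat \<Rightarrow> real) measure \<Rightarrow> bool" where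
  "ac_log_concave_measure k \<nu> \<longleftrightarrow> prob_space \<nu> \<and>
     (\<exists>\<rho>. \<rho> \<in> borel_measurable (lborel_Rn k) \<and> log_concave_fun k \<rho> \<and>
          \<nu> = density (lborel_Rn k) (\<lambda>x. ennreal (\<rho> x)))"

text \<open>An affine map is given by its translation part \<open>b\<close> and the columns \<open>v i\<close> of its matrix.\<close>

definition affine_map_Rn :: "nat \<Rightarrow> ((nat \<Rightarrow> real) \<Rightarrow> 'a::real_vector) \<Rightarrow> bool" where
  "affine_map_Rn k A \<longleftrightarrow> (\<exists>b v. \<forall>x\<in>Rn k. A x = b + (\<Sum>i<k. x i *\<^sub>R v i))"

definition log_concave_measure :: "'a::euclidean_space measure \<Rightarrow> bool" where
  "log_concave_measure \<mu> \<longleftrightarrow>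
     (\<exists>k \<nu> A. ac_log_concave_measure k \<nu> \<and> affine_map_Rn k A \<and> inj_on A (Rn k) \<and>
              \<mu> = distr \<nu> borel A)"

definition std_gaussian :: "'a::euclidean_space measure" where
  "std_gaussian =
     density lborel (\<lambda>x. ennreal (exp (- (norm x)\<^sup>2 / 2) / sqrt (2 * pi) ^ DIM('a)))"

definition contraction :: "('a::real_normed_vector \<Rightarrow> 'a) \<Rightarrow> bool" where
  "contraction T \<longleftrightarrow> (\<forall>x y. norm (T x - T y) \<le> norm (x - y))"

end

theory Submission
  imports Defs
begin

text \<open>
  The contraction is the time reversal of the heat flow. Let \<open>p\<^sub>t\<close> be the density of \<open>\<mu> * \<gamma>\<^sub>t\<close>, where
  \<open>\<gamma>\<^sub>t\<close> is the centred Gaussian with covariance \<open>t\<close> times the identity. The heat equation for \<open>p\<^sub>t\<close>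
  is the continuity equation of the velocity field \<open>- \<nabla> log p\<^sub>t / 2\<close>, so the flow of this field
  carries \<open>\<mu> * \<gamma>\<^sub>s\<close> to \<open>\<mu> * \<gamma>\<^sub>t\<close> for \<open>s < t\<close>. By the Prekopa-Leindler inequality \<open>p\<^sub>t\<close> is log-concave;
  hence the field is monotone, its flow expands distances, and the reversed flow from time 1 to time
  \<open>s\<close> is a contraction taking \<open>\<mu> * \<gamma>\<close> to \<open>\<mu> * \<gamma>\<^sub>s\<close>. As \<open>s\<close> tends to 0, a subsequence of these
  contractions converges, and the limit takes \<open>\<mu> * \<gamma>\<close> to \<open>\<mu>\<close>.

  The differential equation is replaced by explicit Euler steps. One step from time \<open>t\<close> to time
  \<open>t (1 + \<delta>)\<close> is the map \<open>S x = x + (\<delta> / 2) D x\<close>, where \<open>D x = - t \<nabla> log p\<^sub>t x\<close>. If \<open>X\<close> has law \<open>\<mu>\<close>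
  and \<open>Y\<close> is the sum of \<open>X\<close> and an independent \<open>\<gamma>\<^sub>t\<close> noise, then \<open>D x\<close> is the mean of \<open>x - X\<close> under
  the conditional law of \<open>X\<close> given \<open>Y = x\<close>, and the derivative of \<open>D\<close> is the identity minus \<open>1 / t\<close>
  times the covariance of that law. By monotonicity of \<open>D\<close> the map \<open>S\<close> is an expanding bijection
  (\<open>spread_expands\<close>, \<open>bij_spread\<close>), and its inverse is a contraction.

  The step is accurate to second order. Jensen's inequality for the conditional law bounds
  \<open>p\<^bsub>t (1 + \<delta>)\<^esub> (S x)\<close> from below by \<open>p\<^sub>t x\<close> times an explicit factor (\<open>heat_flow_spread_ge\<close>), and
  the determinant of the derivative of \<open>S\<close> is bounded from below by its first order expansion
  (\<open>det_spread_ge\<close>). The first order terms of the two bounds cancel, which gives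
  \<open>p\<^bsub>t (1 + \<delta>)\<^esub> (S x) det (S' x) \<ge> p\<^sub>t x (1 - O(\<delta>\<^sup>2) (1 + \<bar>D x\<bar>\<^sup>2 / t))\<close>, with a constant depending only
  on the dimension. Both sides of the inequality without error term are probability densities, so
  such a lower bound controls the distance in total variation: the law \<open>\<mu> * \<gamma>\<^bsub>t (1 + \<delta>)\<^esub>\<close> is carried to
  \<open>\<mu> * \<gamma>\<^sub>t\<close> up to \<open>O(\<delta>\<^sup>2)\<close> (\<open>reverse_heat_step\<close>). Total variation does not grow under further maps,
  so errors only add up. Starting from time 1, \<open>m\<^sup>3\<close> steps with \<open>\<delta> = 1 / m\<^sup>2\<close> lead to a time of at most
  \<open>1 / m\<close> with total error \<open>O(1 / m)\<close>.
\<close>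

section \<open>The Prekopa-Leindler inequality\<close>

lemma countable_cofinal_real:
  fixes A :: "real set"
  assumes "A \<noteq> {}"
  shows "\<exists>a::nat \<Rightarrow> real. incseq a \<and> range a \<subseteq> A \<and> A \<subseteq> (\<Union>n. {..a n})"
proof (cases "\<exists>m\<in>A. \<forall>x\<in>A. x \<le> m")
  case True
  then obtain m where "m \<in> A" "\<forall>x\<in>A. x \<le> m" by blast
  then show ?thesis by (intro exI[of _ "\<lambda>_. m"]) (auto simp: incseq_def)
next
  case False
  obtain T where T: "countable T" "T \<subseteq> A" "A \<subseteq> closure T"
    using separable by blast
  have "T \<noteq> {}" using T assms by auto
  define b where "b = from_nat_into T"
  have rb: "range b = T"
    unfolding b_def using T(1) \<open>T \<noteq> {}\<close> by (simp add: range_from_nat_into)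
  define a where "a n = Max (b ` {..n})" for n
  have aT: "a n \<in> T" for n
  proof -
    have "a n \<in> b ` {..n}" unfolding a_def by (intro Max_in) auto
    then show ?thesis using rb by auto
  qed
  have inc: "incseq a"
    unfolding incseq_def a_def by (auto intro!: Max_mono)
  have "\<exists>n. x \<le> a n" if x: "x \<in> A" for x
  proof -
    obtain y where y: "y \<in> A" "y > x" using False x by force
    then have "y \<in> closure T" using T by auto
    then have "{x<..} \<inter> T \<noteq> {}"
      using y(2) by (metis greaterThan_iff open_greaterThan closure_iff_nhds_not_empty subset_refl
          inf_commute)
    then obtain t where "t \<in> T" "x < t" by auto
    then obtain n where "b n = t" using rb by auto
    then have "t \<le> a n" unfolding a_def by (auto intro!: Max_ge)
    then show ?thesis using \<open>x < t\<close> by (intro exI[of _ n]) auto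
  qed
  then show ?thesis using inc aT T by (intro exI[of _ a]) auto
qed

lemma emeasure_lborel_double:
  fixes X :: "real set"
  assumes "X \<in> sets borel"
  shows "emeasure lborel X = 2 * emeasure lborel {x. 2 * x - c \<in> X}"
proof -
  have [measurable]: "X \<in> sets borel" by fact
  have "emeasure lborel X = (\<integral>\<^sup>+x. indicator X x \<partial>lborel)" by simp
  also have "\<dots> = ennreal \<bar>2\<bar> * (\<integral>\<^sup>+x. indicator X (- c + 2 * x) \<partial>lborel)"
    by (rule nn_integral_real_affine) auto
  also have "(\<integral>\<^sup>+x. indicator X (- c + 2 * x) \<partial>lborel)
    = (\<integral>\<^sup>+x. indicator {x. 2 * x - c \<in> X} x \<partial>lborel)"
    by (intro nn_integral_cong) (auto simp: indicator_def)
  also have "\<dots> = emeasure lborel {x. 2 * x - c \<in> X}"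
    by (intro nn_integral_indicator) measurable
  finally show ?thesis by simp
qed

text \<open>
  The two sets on the left, shrunk by the factor 2 towards \<open>b0\<close> and \<open>a0\<close> respectively, lie in \<open>C\<close>
  and on different sides of the midpoint of \<open>a0\<close> and \<open>b0\<close>; they share at most that point.
\<close>

lemma brunn_minkowski_one_sided:
  fixes A B C :: "real set"
  assumes [measurable]: "A \<in> sets borel" "B \<in> sets borel" "C \<in> sets borel"
    and C: "\<And>a b. a \<in> A \<Longrightarrow> b \<in> B \<Longrightarrow> (a + b) / 2 \<in> C" and a0: "a0 \<in> A" and b0: "b0 \<in> B"
  shows "emeasure lborel (A \<inter> {..a0}) + emeasure lborel (B \<inter> {b0..}) \<le> 2 * emeasure lborel C"
proof -
  let ?c = "(a0 + b0) / 2"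
  let ?X = "{x. 2 * x - b0 \<in> A \<inter> {..a0}}" and ?Y = "{x. 2 * x - a0 \<in> B \<inter> {b0..}}"
  have X: "?X \<subseteq> C \<inter> {..?c}" using C[OF _ b0] by (force simp: field_simps)
  have Y: "?Y \<subseteq> C \<inter> {?c..}" using C[OF a0] by (force simp: field_simps)
  have [measurable]: "?X \<in> sets borel" "?Y \<in> sets borel" by measurable
  have "emeasure lborel ?X + emeasure lborel ?Y
     = (\<integral>\<^sup>+x. indicator ?X x + indicator ?Y x \<partial>lborel)"
    by (simp add: nn_integral_add)
  also have "\<dots> \<le> (\<integral>\<^sup>+x. indicator C x + indicator {?c} x \<partial>lborel)"
    using X Y by (intro nn_integral_mono) (auto simp: indicator_def split: if_splits)
  also have "\<dots> = emeasure lborel C" by (simp add: nn_integral_add)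
  finally have "2 * (emeasure lborel ?X + emeasure lborel ?Y) \<le> 2 * emeasure lborel C"
    by (intro mult_left_mono) auto
  then show ?thesis
    using emeasure_lborel_double[of "A \<inter> {..a0}" b0] emeasure_lborel_double[of "B \<inter> {b0..}" a0]
    by (simp add: distrib_left)
qed

text \<open>
  Exhausting \<open>A\<close> from the left by points \<open>a n\<close> of \<open>A\<close> and \<open>B\<close> from the right by points of \<open>B\<close>
  reduces the claim to the one-sided inequality, for arbitrary Borel sets and without passing to
  compact subsets.
\<close>

lemma brunn_minkowski_midpoint_real:
  fixes A B C :: "real set"
  assumes [measurable]: "A \<in> sets borel" "B \<in> sets borel" "C \<in> sets borel"
    and C: "\<And>a b. a \<in> A \<Longrightarrow> b \<in> B \<Longrightarrow> (a + b) / 2 \<in> C" and ne: "A \<noteq> {}" "B \<noteq> {}"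
  shows "emeasure lborel A + emeasure lborel B \<le> 2 * emeasure lborel C"
proof -
  obtain a where a: "incseq a" "range a \<subseteq> A" "A \<subseteq> (\<Union>n. {..a n})"
    using countable_cofinal_real[OF ne(1)] by blast
  have "uminus ` B \<noteq> {}" using ne by auto
  then obtain b where b: "incseq b" "range b \<subseteq> uminus ` B" "uminus ` B \<subseteq> (\<Union>n. {..b n})"
    using countable_cofinal_real[of "uminus ` B"] by blast
  have bB: "- b n \<in> B" for n
  proof -
    have "b n \<in> uminus ` B" using b(2) by blast
    then show ?thesis by auto
  qed
  have Bc: "(\<Union>n. B \<inter> {- b n..}) = B"
  proof -
    have "\<exists>n. - b n \<le> x" if "x \<in> B" for x
    proof -
      have "- x \<in> (\<Union>n. {..b n})" using b(3) that by blast
      then obtain n where "- x \<le> b n" by auto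
      then show ?thesis by (intro exI[of _ n]) auto
    qed
    then show ?thesis by auto
  qed
  have Ac: "(\<Union>n. A \<inter> {..a n}) = A" using a(3) by auto
  have 1: "(\<lambda>n. emeasure lborel (A \<inter> {..a n})) \<longlonglongrightarrow> emeasure lborel (\<Union>n. A \<inter> {..a n})"
    using a(1) by (intro Lim_emeasure_incseq) (auto simp: incseq_def intro: order_trans)
  have 2: "(\<lambda>n. emeasure lborel (B \<inter> {- b n..})) \<longlonglongrightarrow> emeasure lborel (\<Union>n. B \<inter> {- b n..})"
    using b(1) by (intro Lim_emeasure_incseq) (auto simp: incseq_def intro: order_trans[rotated])
  have "(\<lambda>n. emeasure lborel (A \<inter> {..a n}) + emeasure lborel (B \<inter> {- b n..}))
      \<longlonglongrightarrow> emeasure lborel A + emeasure lborel B"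
    using tendsto_add[OF 1 2] Ac Bc by simp
  moreover have "emeasure lborel (A \<inter> {..a n}) + emeasure lborel (B \<inter> {- b n..})
      \<le> 2 * emeasure lborel C" for n
    using a(2) bB by (intro brunn_minkowski_one_sided C) auto
  ultimately show ?thesis by (intro LIMSEQ_le_const2) auto
qed

lemma nn_integral_layer_cake_le_1:
  fixes f :: "real \<Rightarrow> ennreal"
  assumes [measurable]: "f \<in> borel_measurable borel" and le: "\<And>x. f x \<le> 1"
  shows "(\<integral>\<^sup>+x. f x \<partial>lborel)
       = (\<integral>\<^sup>+s. emeasure lborel {x. ennreal s < f x} * indicator {0<..<1::real} s \<partial>lborel)"
proof -
  have "(\<integral>\<^sup>+s. indicator {x. ennreal s < f x} x * indicator {0<..<1} s \<partial>lborel) = f x" for x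
  proof -
    obtain r where r: "f x = ennreal r" "0 \<le> r" "r \<le> 1"
      using le[of x] by (cases "f x") (auto simp: top_unique)
    have "(\<integral>\<^sup>+s. indicator {x. ennreal s < f x} x * indicator {0<..<1} s \<partial>lborel)
      = (\<integral>\<^sup>+s. indicator {0<..<r} s \<partial>lborel)"
      using r by (intro nn_integral_cong) (auto simp: indicator_def ennreal_less_iff)
    also have "\<dots> = r" using r by simp
    finally show ?thesis using r by simp
  qed
  then have "(\<integral>\<^sup>+x. f x \<partial>lborel)
     = (\<integral>\<^sup>+x. (\<integral>\<^sup>+s. indicator {x. ennreal s < f x} x * indicator {0<..<1::real} s \<partial>lborel) \<partial>lborel)"
    by simp
  also have "\<dots> = (\<integral>\<^sup>+s. (\<integral>\<^sup>+x. indicator {x. ennreal s < f x} x * indicator {0<..<1} s \<partial>lborel) \<partial>lborel)"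
    by (rule lborel_pair.Fubini') measurable
  also have "\<dots> = (\<integral>\<^sup>+s. emeasure lborel {x. ennreal s < f x} * indicator {0<..<1::real} s \<partial>lborel)"
    by (simp add: nn_integral_multc)
  finally show ?thesis .
qed

lemma ennreal_square_less_imp:
  fixes h :: ennreal
  assumes "ennreal s < u" "ennreal s < v" "u * v \<le> h ^ 2" "0 < s" "u \<le> 1" "v \<le> 1"
  shows "ennreal s < h"
proof (rule ccontr)
  assume "\<not> ennreal s < h"
  then have h: "h \<le> ennreal s" by simp
  then have "h * h \<le> ennreal s * ennreal s" by (intro mult_mono) auto
  then have *: "u * v \<le> ennreal s * ennreal s" using assms(3) by (simp add: power2_eq_square)
  obtain a where a: "u = ennreal a" "0 \<le> a" using assms(5) by (cases u) (auto simp: top_unique)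
  obtain b where b: "v = ennreal b" "0 \<le> b" using assms(6) by (cases v) (auto simp: top_unique)
  have "s < a" "s < b" using assms a b by (auto simp: ennreal_less_iff)
  then have "s * s < a * b" using assms(4) by (intro mult_strict_mono) auto
  moreover have "a * b \<le> s * s"
    using * a b assms(4) by (simp flip: ennreal_mult)
  ultimately show False by simp
qed

text \<open>
  If \<open>f\<close> and \<open>g\<close> have supremum 1, then for each level \<open>s < 1\<close> the superlevel sets of \<open>f\<close> and \<open>g\<close> are
  nonempty and their midpoints lie in the superlevel set of \<open>h\<close>. The Brunn-Minkowski inequality at
  each level, integrated over the levels, gives the arithmetic mean, which is stronger than the
  geometric mean.
\<close>

lemma prekopa_leindler_real_normalised:
  fixes f g h :: "real \<Rightarrow> ennreal"
  assumes [measurable]: "f \<in> borel_measurable borel" "g \<in> borel_measurable borel" "h \<in> borel_measurable borel"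
    and H: "\<And>x y. f x * g y \<le> (h ((x + y) / 2))\<^sup>2"
    and f1: "(SUP x. f x) = 1" and g1: "(SUP x. g x) = 1"
  shows "(\<integral>\<^sup>+x. f x \<partial>lborel) + (\<integral>\<^sup>+x. g x \<partial>lborel) \<le> 2 * (\<integral>\<^sup>+x. h x \<partial>lborel)"
proof -
  let ?h = "\<lambda>x. min (h x) 1"
  have fle: "f x \<le> 1" for x using f1 by (metis SUP_upper UNIV_I)
  have gle: "g x \<le> 1" for x using g1 by (metis SUP_upper UNIV_I)
  have [measurable]: "{x. ennreal s < f x} \<in> sets borel" "{x. ennreal s < g x} \<in> sets borel"
    "{x. ennreal s < ?h x} \<in> sets borel" for s by measurable
  have mf [measurable]: "(\<lambda>s. emeasure lborel {x. ennreal s < k x}) \<in> borel_measurable lborel"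
    if [measurable]: "k \<in> borel_measurable borel" for k :: "real \<Rightarrow> ennreal"
  proof -
    have "(\<lambda>s. \<integral>\<^sup>+x. indicator {x. ennreal s < k x} x \<partial>lborel) \<in> borel_measurable lborel"
      by measurable
    then show ?thesis by simp
  qed
  have *: "emeasure lborel {x. ennreal s < f x} + emeasure lborel {x. ennreal s < g x}
     \<le> 2 * emeasure lborel {x. ennreal s < ?h x}" if s: "0 < s" "s < 1" for s
  proof (rule brunn_minkowski_midpoint_real)
    have "ennreal s < (SUP x. f x)" "ennreal s < (SUP x. g x)"
      using s f1 g1 by (simp_all flip: ennreal_1 add: ennreal_less_iff)
    then show "{x. ennreal s < f x} \<noteq> {}" "{x. ennreal s < g x} \<noteq> {}"
      by (auto simp: less_SUP_iff)
    fix a b assume "a \<in> {x. ennreal s < f x}" "b \<in> {x. ennreal s < g x}"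
    then have "ennreal s < h ((a + b) / 2)"
      using s fle gle by (intro ennreal_square_less_imp[OF _ _ H[of a b]]) auto
    then show "(a + b) / 2 \<in> {x. ennreal s < ?h x}"
      using s by (simp flip: ennreal_1 add: ennreal_less_iff)
  qed measurable
  have "(\<integral>\<^sup>+x. f x \<partial>lborel) + (\<integral>\<^sup>+x. g x \<partial>lborel)
     = (\<integral>\<^sup>+s. emeasure lborel {x. ennreal s < f x} * indicator {0<..<1::real} s \<partial>lborel)
     + (\<integral>\<^sup>+s. emeasure lborel {x. ennreal s < g x} * indicator {0<..<1::real} s \<partial>lborel)"
    using nn_integral_layer_cake_le_1[of f] nn_integral_layer_cake_le_1[of g] fle gle by simp
  also have "\<dots> = (\<integral>\<^sup>+s. emeasure lborel {x. ennreal s < f x} * indicator {0<..<1::real} s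
      + emeasure lborel {x. ennreal s < g x} * indicator {0<..<1::real} s \<partial>lborel)"
    by (rule nn_integral_add[symmetric]) measurable
  also have "\<dots> \<le> (\<integral>\<^sup>+s. 2 * (emeasure lborel {x. ennreal s < ?h x} * indicator {0<..<1::real} s) \<partial>lborel)"
    using * by (intro nn_integral_mono) (auto simp: indicator_def)
  also have "\<dots> = 2 * (\<integral>\<^sup>+s. emeasure lborel {x. ennreal s < ?h x} * indicator {0<..<1::real} s \<partial>lborel)"
    by (rule nn_integral_cmult) measurable
  also have "\<dots> = 2 * (\<integral>\<^sup>+x. ?h x \<partial>lborel)"
    using nn_integral_layer_cake_le_1[of ?h] by simp
  also have "\<dots> \<le> 2 * (\<integral>\<^sup>+x. h x \<partial>lborel)"
    by (intro mult_left_mono nn_integral_mono) auto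
  finally show ?thesis .
qed

lemma ennreal_am_gm:
  fixes F G H :: ennreal
  assumes "F + G \<le> 2 * H"
  shows "F * G \<le> H\<^sup>2"
proof (cases "H = top")
  case True
  then show ?thesis by (simp add: power2_eq_square)
next
  case False
  then obtain c where c: "H = ennreal c" "0 \<le> c" by (cases H) auto
  then have fin: "F + G < top" using assms by (metis ennreal_mult_less_top ennreal_less_top order_le_less_trans ennreal_numeral)
  then obtain a b where ab: "F = ennreal a" "0 \<le> a" "G = ennreal b" "0 \<le> b"
    by (cases F; cases G) auto
  have "ennreal (a + b) \<le> ennreal (2 * c)" using assms ab c by (simp add: ennreal_mult)
  then have le: "a + b \<le> 2 * c" using c by simp
  have "4 * (a * b) \<le> (a + b)\<^sup>2" using zero_le_power2[of "a - b"] by (simp add: power2_eq_square algebra_simps)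
  also have "\<dots> \<le> (2 * c)\<^sup>2" using le ab by (intro power_mono) auto
  finally have "a * b \<le> c\<^sup>2" by (simp add: power2_eq_square)
  then show ?thesis using ab c by (simp add: ennreal_power flip: ennreal_mult)
qed

lemma prekopa_leindler_real_bounded:
  fixes f g h :: "real \<Rightarrow> ennreal"
  assumes [measurable]: "f \<in> borel_measurable borel" "g \<in> borel_measurable borel" "h \<in> borel_measurable borel"
    and H: "\<And>x y. f x * g y \<le> (h ((x + y) / 2))\<^sup>2"
    and bf: "(SUP x. f x) < top" and bg: "(SUP x. g x) < top"
  shows "(\<integral>\<^sup>+x. f x \<partial>lborel) * (\<integral>\<^sup>+x. g x \<partial>lborel) \<le> (\<integral>\<^sup>+x. h x \<partial>lborel)\<^sup>2"
proof (cases "(SUP x. f x) = 0 \<or> (SUP x. g x) = 0")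
  case True
  then have "(\<forall>x. f x = 0) \<or> (\<forall>x. g x = 0)" by (auto simp: bot_ennreal[symmetric])
  then show ?thesis by auto
next
  case False
  obtain \<alpha> where \<alpha>: "(SUP x. f x) = ennreal \<alpha>" "0 < \<alpha>"
    using bf False by (cases "SUP x. f x") (auto simp: less_le)
  obtain \<beta> where \<beta>: "(SUP x. g x) = ennreal \<beta>" "0 < \<beta>"
    using bg False by (cases "SUP x. g x") (auto simp: less_le)
  define \<gamma> where "\<gamma> = sqrt (\<alpha> * \<beta>)"
  have \<gamma>: "\<gamma> > 0" "\<gamma>\<^sup>2 = \<alpha> * \<beta>" using \<alpha> \<beta> by (auto simp: \<gamma>_def)
  let ?f = "\<lambda>x. ennreal (1/\<alpha>) * f x" and ?g = "\<lambda>x. ennreal (1/\<beta>) * g x" and ?h = "\<lambda>x. ennreal (1/\<gamma>) * h x"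
  have 1: "(\<integral>\<^sup>+x. ?f x \<partial>lborel) + (\<integral>\<^sup>+x. ?g x \<partial>lborel) \<le> 2 * (\<integral>\<^sup>+x. ?h x \<partial>lborel)"
  proof (rule prekopa_leindler_real_normalised)
    show "(SUP x. ?f x) = 1" using \<alpha> by (simp add: SUP_mult_left_ennreal[symmetric] flip: ennreal_mult)
    show "(SUP x. ?g x) = 1" using \<beta> by (simp add: SUP_mult_left_ennreal[symmetric] flip: ennreal_mult)
    fix x y
    have e: "ennreal (1/\<alpha>) * ennreal (1/\<beta>) = ennreal (1/\<gamma>) ^ 2"
      using \<alpha> \<beta> \<gamma> by (simp add: ennreal_power power_divide flip: ennreal_mult)
    have "?f x * ?g y = (ennreal (1/\<alpha>) * ennreal (1/\<beta>)) * (f x * g y)" by (simp add: ac_simps)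
    also have "\<dots> \<le> ennreal (1/\<gamma>) ^ 2 * (h ((x + y) / 2))\<^sup>2"
      unfolding e by (intro mult_left_mono H) auto
    finally show "?f x * ?g y \<le> (?h ((x + y) / 2))\<^sup>2" by (simp add: power_mult_distrib)
  qed measurable
  have "(\<integral>\<^sup>+x. ?f x \<partial>lborel) * (\<integral>\<^sup>+x. ?g x \<partial>lborel) \<le> (\<integral>\<^sup>+x. ?h x \<partial>lborel)\<^sup>2"
    by (rule ennreal_am_gm[OF 1])
  then have "ennreal (1/\<alpha>) * (\<integral>\<^sup>+x. f x \<partial>lborel) * (ennreal (1/\<beta>) * (\<integral>\<^sup>+x. g x \<partial>lborel))
     \<le> (ennreal (1/\<gamma>) * (\<integral>\<^sup>+x. h x \<partial>lborel))\<^sup>2"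
    by (simp only: nn_integral_cmult[OF assms(1)[unfolded measurable_lborel2[symmetric]]]
       nn_integral_cmult[OF assms(2)[unfolded measurable_lborel2[symmetric]]]
       nn_integral_cmult[OF assms(3)[unfolded measurable_lborel2[symmetric]]])
  then have "(ennreal (1/\<alpha>) * ennreal (1/\<beta>)) * ((\<integral>\<^sup>+x. f x \<partial>lborel) * (\<integral>\<^sup>+x. g x \<partial>lborel))
     \<le> ennreal (1/\<gamma>) ^ 2 * (\<integral>\<^sup>+x. h x \<partial>lborel)\<^sup>2"
    by (simp only: power_mult_distrib ac_simps)
  then have "ennreal (\<gamma>^2) * ((ennreal (1/\<alpha>) * ennreal (1/\<beta>)) * ((\<integral>\<^sup>+x. f x \<partial>lborel) * (\<integral>\<^sup>+x. g x \<partial>lborel)))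
     \<le> ennreal (\<gamma>^2) * (ennreal (1/\<gamma>) ^ 2 * (\<integral>\<^sup>+x. h x \<partial>lborel)\<^sup>2)"
    by (rule mult_left_mono) simp
  moreover have "ennreal (\<gamma>^2) * (ennreal (1/\<alpha>) * ennreal (1/\<beta>)) = 1"
    using \<alpha> \<beta> \<gamma> by (simp flip: ennreal_mult)
  moreover have "ennreal (\<gamma>^2) * ennreal (1/\<gamma>) ^ 2 = 1"
    using \<gamma> \<alpha>(2) \<beta>(2) by (simp add: ennreal_power power_divide flip: ennreal_mult)
  ultimately show ?thesis by (simp add: mult.assoc[symmetric])
qed

lemma nn_integral_truncate:
  assumes [measurable]: "f \<in> borel_measurable M"
  shows "(\<integral>\<^sup>+x. f x \<partial>M) = (SUP n::nat. \<integral>\<^sup>+x. min (f x) (of_nat n) \<partial>M)"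
proof -
  have "f x = (SUP n::nat. min (f x) (of_nat n))" for x
    using inf_SUP[of "f x" "\<lambda>n::nat. of_nat n" UNIV]
    by (simp add: ennreal_SUP_of_nat_eq_top flip: inf_min)
  then have "(\<integral>\<^sup>+x. f x \<partial>M) = (\<integral>\<^sup>+x. (SUP n::nat. min (f x) (of_nat n)) \<partial>M)" by simp
  also have "\<dots> = (SUP n::nat. \<integral>\<^sup>+x. min (f x) (of_nat n) \<partial>M)"
    by (rule nn_integral_monotone_convergence_SUP)
       (auto simp: incseq_def le_fun_def min.coboundedI2 intro: min.mono)
  finally show ?thesis .
qed

text \<open>
  Truncation at finite levels preserves the hypothesis because it only decreases the left hand side.
\<close>

lemma prekopa_leindler_real:
  fixes f g h :: "real \<Rightarrow> ennreal"
  assumes [measurable]: "f \<in> borel_measurable borel" "g \<in> borel_measurable borel" "h \<in> borel_measurable borel"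
    and H: "\<And>x y. f x * g y \<le> (h ((x + y) / 2))\<^sup>2"
  shows "(\<integral>\<^sup>+x. f x \<partial>lborel) * (\<integral>\<^sup>+x. g x \<partial>lborel) \<le> (\<integral>\<^sup>+x. h x \<partial>lborel)\<^sup>2"
proof -
  have *: "(\<integral>\<^sup>+x. min (f x) (of_nat m) \<partial>lborel) * (\<integral>\<^sup>+x. min (g x) (of_nat n) \<partial>lborel)
     \<le> (\<integral>\<^sup>+x. h x \<partial>lborel)\<^sup>2" for m n :: nat
  proof (rule prekopa_leindler_real_bounded)
    show "(SUP x. min (f x) (of_nat m)) < top" "(SUP x. min (g x) (of_nat n)) < top"
      by (meson SUP_least min.cobounded2 ennreal_of_nat_eq_real_of_nat of_nat_less_top order_le_less_trans)+
    show "min (f x) (of_nat m) * min (g y) (of_nat n) \<le> (h ((x + y) / 2))\<^sup>2" for x y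
      by (rule order_trans[OF mult_mono H]) auto
  qed measurable
  have "(\<integral>\<^sup>+x. f x \<partial>lborel) * (\<integral>\<^sup>+x. g x \<partial>lborel)
    = (SUP m::nat. SUP n::nat. (\<integral>\<^sup>+x. min (f x) (of_nat m) \<partial>lborel) * (\<integral>\<^sup>+x. min (g x) (of_nat n) \<partial>lborel))"
    by (simp add: nn_integral_truncate[of f] nn_integral_truncate[of g]
        SUP_mult_left_ennreal SUP_mult_right_ennreal) (rule SUP_commute)
  also have "\<dots> \<le> (\<integral>\<^sup>+x. h x \<partial>lborel)\<^sup>2"
    by (intro SUP_least *)
  finally show ?thesis .
qed

text \<open>
  The inequality tensorises: for fixed last coordinates the induction hypothesis bounds the marginals
  in the remaining coordinates, which are then functions on the line to which the one-dimensional
  inequality applies.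
\<close>

lemma prekopa_leindler_PiM:
  fixes f g h :: "('i \<Rightarrow> real) \<Rightarrow> ennreal"
  assumes "finite I"
    and "f \<in> borel_measurable (\<Pi>\<^sub>M i\<in>I. lborel)" "g \<in> borel_measurable (\<Pi>\<^sub>M i\<in>I. lborel)"
      "h \<in> borel_measurable (\<Pi>\<^sub>M i\<in>I. lborel)"
    and "\<And>x y. x \<in> I \<rightarrow>\<^sub>E UNIV \<Longrightarrow> y \<in> I \<rightarrow>\<^sub>E UNIV \<Longrightarrow> f x * g y \<le> (h (\<lambda>i\<in>I. (x i + y i) / 2))\<^sup>2"
  shows "(\<integral>\<^sup>+x. f x \<partial>(\<Pi>\<^sub>M i\<in>I. lborel)) * (\<integral>\<^sup>+x. g x \<partial>(\<Pi>\<^sub>M i\<in>I. lborel))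
     \<le> (\<integral>\<^sup>+x. h x \<partial>(\<Pi>\<^sub>M i\<in>I. lborel))\<^sup>2"
  using assms
proof (induction I arbitrary: f g h rule: finite_induct)
  case empty
  interpret product_sigma_finite "\<lambda>_::'i. lborel :: real measure" ..
  show ?case
    using empty.prems(4)[of "\<lambda>_. undefined" "\<lambda>_. undefined"]
    by (simp add: nn_integral_empty restrict_def)
next
  case (insert i I)
  interpret product_sigma_finite "\<lambda>_::'i. lborel :: real measure" ..
  interpret finite_product_sigma_finite "\<lambda>_::'i. lborel :: real measure" I
    by standard (fact insert.hyps)
  note [measurable] = insert.prems(1-3)
  have sec: "(\<lambda>x. k (x(i := a))) \<in> borel_measurable (\<Pi>\<^sub>M i\<in>I. lborel)"
    if [measurable]: "k \<in> borel_measurable (\<Pi>\<^sub>M i\<in>insert i I. lborel)" for k :: "('i \<Rightarrow> real) \<Rightarrow> ennreal" and a :: real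
    by measurable
  have marg: "(\<lambda>a. \<integral>\<^sup>+x. k (x(i := a)) \<partial>(\<Pi>\<^sub>M i\<in>I. lborel)) \<in> borel_measurable borel"
    if [measurable]: "k \<in> borel_measurable (\<Pi>\<^sub>M i\<in>insert i I. lborel)" for k :: "('i \<Rightarrow> real) \<Rightarrow> ennreal"
  proof -
    have "(\<lambda>a. \<integral>\<^sup>+x. k (x(i := a)) \<partial>(\<Pi>\<^sub>M i\<in>I. lborel)) \<in> borel_measurable lborel"
      by measurable
    then show ?thesis by simp
  qed
  note eq = product_nn_integral_insert_rev[OF insert.hyps]
  have "(\<integral>\<^sup>+a. (\<integral>\<^sup>+x. f (x(i := a)) \<partial>(\<Pi>\<^sub>M i\<in>I. lborel)) \<partial>lborel)
      * (\<integral>\<^sup>+a. (\<integral>\<^sup>+x. g (x(i := a)) \<partial>(\<Pi>\<^sub>M i\<in>I. lborel)) \<partial>lborel)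
      \<le> (\<integral>\<^sup>+a. (\<integral>\<^sup>+x. h (x(i := a)) \<partial>(\<Pi>\<^sub>M i\<in>I. lborel)) \<partial>lborel)\<^sup>2"
  proof (rule prekopa_leindler_real)
    fix a b :: real
    show "(\<integral>\<^sup>+x. f (x(i := a)) \<partial>(\<Pi>\<^sub>M i\<in>I. lborel)) * (\<integral>\<^sup>+x. g (x(i := b)) \<partial>(\<Pi>\<^sub>M i\<in>I. lborel))
      \<le> (\<integral>\<^sup>+x. h (x(i := (a + b) / 2)) \<partial>(\<Pi>\<^sub>M i\<in>I. lborel))\<^sup>2"
    proof (rule insert.IH)
      fix x y :: "'i \<Rightarrow> real" assume xy: "x \<in> I \<rightarrow>\<^sub>E UNIV" "y \<in> I \<rightarrow>\<^sub>E UNIV"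
      have "(\<lambda>j\<in>insert i I. ((x(i := a)) j + (y(i := b)) j) / 2) = (\<lambda>j\<in>I. (x j + y j) / 2)(i := (a + b) / 2)"
        using insert.hyps(2) by (auto simp: fun_eq_iff)
      moreover have "x(i := a) \<in> insert i I \<rightarrow>\<^sub>E UNIV" "y(i := b) \<in> insert i I \<rightarrow>\<^sub>E UNIV"
        using xy by (auto simp: PiE_def extensional_def)
      ultimately show "f (x(i := a)) * g (y(i := b)) \<le> (h ((\<lambda>i\<in>I. (x i + y i) / 2)(i := (a + b) / 2)))\<^sup>2"
        using insert.prems(4)[of "x(i := a)" "y(i := b)"] by (simp only:)
    qed (intro sec insert.prems(1-3))+
  qed (intro marg insert.prems(1-3))+
  then show ?case by (simp only: eq[OF insert.prems(1)] eq[OF insert.prems(2)] eq[OF insert.prems(3)])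
qed

section \<open>Log-concavity along the heat flow\<close>

definition heat_kernel :: "real \<Rightarrow> 'a::euclidean_space \<Rightarrow> real" where
  "heat_kernel t u = exp (- (norm u)\<^sup>2 / (2 * t)) / sqrt (2 * pi * t) ^ DIM('a)"

definition heat_flow :: "'a::euclidean_space measure \<Rightarrow> real \<Rightarrow> 'a \<Rightarrow> real" where
  "heat_flow \<mu> t x = (\<integral>z. heat_kernel t (x - z) \<partial>\<mu>)"

lemma heat_kernel_pos: "t > 0 \<Longrightarrow> 0 < heat_kernel t u"
  by (simp add: heat_kernel_def)

lemma heat_kernel_le: "t > 0 \<Longrightarrow> heat_kernel t (u::'a::euclidean_space) \<le> 1 / sqrt (2 * pi * t) ^ DIM('a)"
  unfolding heat_kernel_def by (intro divide_right_mono) auto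

lemma continuous_heat_kernel [continuous_intros]:
  "continuous_on A f \<Longrightarrow> continuous_on A (\<lambda>x. heat_kernel t (f x))"
  unfolding heat_kernel_def divide_inverse by (intro continuous_intros)

lemma borel_measurable_heat_kernel [measurable]:
  "heat_kernel t \<in> borel_measurable borel"
  by (intro borel_measurable_continuous_onI continuous_intros)

lemma norm_midpoint_sq_le:
  fixes u v :: "'a::real_inner"
  shows "2 * (norm ((1/2) *\<^sub>R (u + v)))\<^sup>2 \<le> (norm u)\<^sup>2 + (norm v)\<^sup>2"
proof -
  have "0 \<le> (norm (u - v))\<^sup>2" by simp
  then show ?thesis unfolding power2_norm_eq_inner
    by (simp add: algebra_simps inner_commute)
qed

lemma heat_kernel_midpoint:
  fixes u v :: "'a::euclidean_space"
  assumes "t > 0"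
  shows "heat_kernel t u * heat_kernel t v \<le> (heat_kernel t ((1/2) *\<^sub>R (u + v)))\<^sup>2"
proof -
  have "- (norm u)\<^sup>2 / (2 * t) + - (norm v)\<^sup>2 / (2 * t)
      \<le> 2 * (- (norm ((1/2) *\<^sub>R (u + v)))\<^sup>2 / (2 * t))"
    using divide_right_mono[OF norm_midpoint_sq_le[of u v], of "2 * t"] assms
    by (simp only: add_divide_distrib) simp
  then have "exp (- (norm u)\<^sup>2 / (2 * t)) * exp (- (norm v)\<^sup>2 / (2 * t))
    \<le> (exp (- (norm ((1/2) *\<^sub>R (u + v)))\<^sup>2 / (2 * t)))\<^sup>2"
    by (simp add: exp_double[symmetric] flip: exp_add)
  then show ?thesis
    unfolding heat_kernel_def using assms by (simp add: power_divide field_simps power2_eq_square)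
qed

lemma log_concave_fun_midpoint:
  assumes lc: "log_concave_fun k \<rho>" and x: "x \<in> Rn k" and y: "y \<in> Rn k"
  shows "\<rho> x * \<rho> y \<le> (\<rho> (\<lambda>i\<in>{..<k}. (x i + y i) / 2))\<^sup>2"
proof (cases "\<rho> x > 0 \<and> \<rho> y > 0")
  case False
  moreover have "\<rho> x \<ge> 0" "\<rho> y \<ge> 0" using lc x y unfolding log_concave_fun_def by auto
  ultimately have "\<rho> x * \<rho> y = 0" by auto
  then show ?thesis by (metis zero_le_power2)
next
  case True
  let ?m = "\<lambda>i\<in>{..<k}. (x i + y i) / 2"
  have m: "seg_pt k (1/2) x y = ?m" unfolding seg_pt_def by (auto simp: fun_eq_iff field_simps)
  have cc: "convex_Rn k {x \<in> Rn k. \<rho> x > 0}" "concave_on_Rn k {x \<in> Rn k. \<rho> x > 0} (\<lambda>x. ln (\<rho> x))"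
    using lc unfolding log_concave_fun_def by auto
  have "?m \<in> {x \<in> Rn k. \<rho> x > 0}"
    using cc(1) True x y unfolding convex_Rn_def m[symmetric] by auto
  then have pos: "\<rho> ?m > 0" by simp
  have "ln (\<rho> (seg_pt k (1/2) x y)) \<ge> (1 - 1/2) * ln (\<rho> x) + (1/2) * ln (\<rho> y)"
  proof -
    have "\<forall>t\<in>{0..1}. ln (\<rho> (seg_pt k t x y)) \<ge> (1 - t) * ln (\<rho> x) + t * ln (\<rho> y)"
      using cc(2) True x y unfolding concave_on_Rn_def by blast
    then show ?thesis by (rule bspec) simp
  qed
  then have "ln (\<rho> x * \<rho> y) \<le> ln ((\<rho> ?m)\<^sup>2)"
    using True pos by (simp add: m ln_mult ln_realpow)
  then show ?thesis using True pos by (simp add: ln_le_cancel_iff)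
qed

lemma affine_map_Rn_midpoint:
  assumes "affine_map_Rn k A" "x \<in> Rn k" "y \<in> Rn k"
  shows "A (\<lambda>i\<in>{..<k}. (x i + y i) / 2) = (1/2) *\<^sub>R (A x + A y)"
proof -
  obtain b v where A: "\<And>x. x \<in> Rn k \<Longrightarrow> A x = b + (\<Sum>i<k. x i *\<^sub>R v i)"
    using assms(1) unfolding affine_map_Rn_def by auto
  have "(\<lambda>i\<in>{..<k}. (x i + y i) / 2) \<in> Rn k" by auto
  then have "A (\<lambda>i\<in>{..<k}. (x i + y i) / 2) = b + (\<Sum>i<k. ((x i + y i) / 2) *\<^sub>R v i)"
    using A by simp
  also have "\<dots> = (1/2) *\<^sub>R (A x + A y)"
    using A[OF assms(2)] A[OF assms(3)]
    by (simp add: scaleR_add_right scaleR_sum_right scaleR_add_left add_divide_distrib sum.distrib)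
      (simp flip: scaleR_add_left add: add.assoc[symmetric])
  finally show ?thesis .
qed

lemma affine_map_Rn_measurable:
  fixes A :: "(nat \<Rightarrow> real) \<Rightarrow> 'a::euclidean_space"
  assumes "affine_map_Rn k A"
  shows "A \<in> borel_measurable (lborel_Rn k)"
proof -
  obtain b v where A: "\<And>x. x \<in> Rn k \<Longrightarrow> A x = b + (\<Sum>i<k. x i *\<^sub>R v i)"
    using assms(1) unfolding affine_map_Rn_def by auto
  have "(\<lambda>x. b + (\<Sum>i<k. x i *\<^sub>R v i)) \<in> borel_measurable (lborel_Rn k)"
    by measurable
  then show ?thesis
    by (rule measurable_cong[THEN iffD1, rotated]) (simp add: space_PiM A)
qed

lemma integrable_heat_kernel:
  fixes \<mu> :: "'a::euclidean_space measure"
  assumes "prob_space \<mu>" "sets \<mu> = sets borel" "t > 0"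
  shows "integrable \<mu> (\<lambda>z. heat_kernel t (x - z))"
proof -
  interpret prob_space \<mu> by fact
  have [measurable_cong]: "sets \<mu> = sets borel" by fact
  show ?thesis
    using heat_kernel_le[OF assms(3), where 'a='a] heat_kernel_pos[OF assms(3), where 'a='a]
    by (intro integrable_const_bound[where B="1 / sqrt (2 * pi * t) ^ DIM('a)"])
       (auto intro!: AE_I2 simp: abs_of_pos)
qed

lemma heat_flow_pos:
  fixes \<mu> :: "'a::euclidean_space measure"
  assumes "prob_space \<mu>" "sets \<mu> = sets borel" "t > 0"
  shows "heat_flow \<mu> t x > 0"
proof -
  interpret prob_space \<mu> by fact
  show ?thesis
    unfolding heat_flow_def
    using expectation_greater[OF integrable_heat_kernel[OF assms], of 0]
    by (simp add: heat_kernel_pos assms(3))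
qed

text \<open>
  Only the midpoint form of log-concavity is derived; together with differentiability of \<open>p\<^sub>t\<close> it
  suffices for all that follows. In the coordinates of the affine parametrisation of \<open>\<mu>\<close> the density
  \<open>p\<^sub>t\<close> is an integral of a function that is jointly log-concave in the parameter and the position,
  so that the Prekopa-Leindler inequality applies.
\<close>

lemma heat_flow_midpoint:
  fixes \<mu> :: "'a::euclidean_space measure"
  assumes \<mu>: "prob_space \<mu>" "sets \<mu> = sets borel" and lc: "log_concave_measure \<mu>" and t: "t > 0"
  shows "heat_flow \<mu> t x * heat_flow \<mu> t y \<le> (heat_flow \<mu> t ((1/2) *\<^sub>R (x + y)))\<^sup>2"
proof -
  obtain k \<nu> A where ac: "ac_log_concave_measure k \<nu>" and A: "affine_map_Rn k A"
    and \<mu>_eq: "\<mu> = distr \<nu> borel A"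
    using lc unfolding log_concave_measure_def by auto
  obtain \<rho> where \<rho> [measurable]: "\<rho> \<in> borel_measurable (lborel_Rn k)" and lcf: "log_concave_fun k \<rho>"
    and \<nu>: "\<nu> = density (lborel_Rn k) (\<lambda>x. ennreal (\<rho> x))"
    using ac unfolding ac_log_concave_measure_def by auto
  note mA [measurable] = affine_map_Rn_measurable[OF A]
  have eq: "ennreal (heat_flow \<mu> t x) = (\<integral>\<^sup>+a. ennreal (\<rho> a * heat_kernel t (x - A a)) \<partial>lborel_Rn k)" for x
  proof -
    have "ennreal (heat_flow \<mu> t x) = (\<integral>\<^sup>+z. ennreal (heat_kernel t (x - z)) \<partial>\<mu>)"
      unfolding heat_flow_def
      by (rule nn_integral_eq_integral[symmetric, OF integrable_heat_kernel[OF \<mu> t]])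
         (simp add: heat_kernel_pos t less_imp_le)
    also have "\<dots> = (\<integral>\<^sup>+a. ennreal (\<rho> a) * ennreal (heat_kernel t (x - A a)) \<partial>lborel_Rn k)"
      unfolding \<mu>_eq \<nu> by (simp add: nn_integral_distr nn_integral_density)
    also have "\<dots> = (\<integral>\<^sup>+a. ennreal (\<rho> a * heat_kernel t (x - A a)) \<partial>lborel_Rn k)"
      by (intro nn_integral_cong) (simp add: ennreal_mult'' heat_kernel_pos t less_imp_le)
    finally show ?thesis .
  qed
  have \<rho>0: "\<rho> a \<ge> 0" if "a \<in> Rn k" for a using lcf that unfolding log_concave_fun_def by auto
  have "ennreal (heat_flow \<mu> t x) * ennreal (heat_flow \<mu> t y) \<le> (ennreal (heat_flow \<mu> t ((1/2) *\<^sub>R (x + y))))\<^sup>2"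
    unfolding eq
  proof (rule prekopa_leindler_PiM)
    fix a b assume ab: "a \<in> Rn k" "b \<in> Rn k"
    let ?c = "\<lambda>i\<in>{..<k}. (a i + b i) / 2"
    have c: "?c \<in> Rn k" by auto
    have "(\<rho> a * heat_kernel t (x - A a)) * (\<rho> b * heat_kernel t (y - A b))
      = (\<rho> a * \<rho> b) * (heat_kernel t (x - A a) * heat_kernel t (y - A b))" by simp
    also have "\<dots> \<le> (\<rho> ?c)\<^sup>2 * (heat_kernel t ((1/2) *\<^sub>R ((x - A a) + (y - A b))))\<^sup>2"
      using log_concave_fun_midpoint[OF lcf ab] heat_kernel_midpoint[OF t]
      by (intro mult_mono) (auto simp: less_imp_le[OF heat_kernel_pos[OF t]] \<rho>0 ab)
    also have "(1/2) *\<^sub>R ((x - A a) + (y - A b)) = (1/2) *\<^sub>R (x + y) - A ?c"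
      using affine_map_Rn_midpoint[OF A ab] by (simp add: algebra_simps)
    finally have *: "(\<rho> a * heat_kernel t (x - A a)) * (\<rho> b * heat_kernel t (y - A b))
      \<le> (\<rho> ?c * heat_kernel t ((1/2) *\<^sub>R (x + y) - A ?c))\<^sup>2" by (simp only: power_mult_distrib)
    show "ennreal (\<rho> a * heat_kernel t (x - A a)) * ennreal (\<rho> b * heat_kernel t (y - A b))
      \<le> (ennreal (\<rho> ?c * heat_kernel t ((1/2) *\<^sub>R (x + y) - A ?c)))\<^sup>2"
    proof -
      have nn: "0 \<le> \<rho> a * heat_kernel t (x - A a)" "0 \<le> \<rho> b * heat_kernel t (y - A b)"
        "0 \<le> \<rho> ?c * heat_kernel t ((1/2) *\<^sub>R (x + y) - A ?c)"
        by (intro mult_nonneg_nonneg \<rho>0 ab c less_imp_le[OF heat_kernel_pos[OF t]])+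
      show ?thesis
        using * by (simp only: ennreal_power[OF nn(3)] ennreal_mult[OF nn(1,2), symmetric] ennreal_leI)
    qed
  qed auto
  then show ?thesis
    using less_imp_le[OF heat_flow_pos[OF \<mu> t]]
    by (simp add: ennreal_power flip: ennreal_mult)
qed

section \<open>The conditional law and the derivative of its mean\<close>

text \<open>
  The difference quotients are bounded by the Lipschitz constant of \<open>k\<close>, so dominated convergence
  along sequences yields the total derivative.
\<close>

lemma has_derivative_integral_translate:
  fixes k :: "'a::euclidean_space \<Rightarrow> 'b::euclidean_space" and \<mu> :: "'a measure"
  assumes \<mu>: "prob_space \<mu>" "sets \<mu> = sets borel"
    and der: "\<And>u. (k has_derivative k' u) (at u)"
    and bnd': "\<And>u v. norm (k' u v) \<le> C * norm v"
    and bnd: "\<And>u. norm (k u) \<le> B"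
    and [measurable]: "\<And>v. (\<lambda>u. k' u v) \<in> borel_measurable borel"
  shows "((\<lambda>x. \<integral>z. k (x - z) \<partial>\<mu>) has_derivative (\<lambda>v. \<integral>z. k' (x - z) v \<partial>\<mu>)) (at x)"
proof -
  interpret prob_space \<mu> by fact
  have [measurable_cong]: "sets \<mu> = sets borel" by fact
  have "continuous_on UNIV k"
    by (meson continuous_at_imp_continuous_on der has_derivative_continuous)
  then have [measurable]: "k \<in> borel_measurable borel" by (rule borel_measurable_continuous_onI)
  have int: "integrable \<mu> (\<lambda>z. k (y - z))" for y
    by (rule integrable_const_bound[where B=B]) (auto intro!: AE_I2 bnd)
  have int': "integrable \<mu> (\<lambda>z. k' (y - z) v)" for y v
    by (rule integrable_const_bound[where B="C * norm v"]) (auto intro!: AE_I2 bnd')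
  have lin: "linear (k' u)" for u using der[of u] has_derivative_linear by blast
  have "C \<ge> 0"
  proof -
    obtain b :: 'a where "b \<in> Basis" using nonempty_Basis by blast
    then have "0 \<le> C * 1" using bnd'[of 0 b] norm_ge_zero[of "k' 0 b"] by (simp del: norm_ge_zero)
    then show ?thesis by simp
  qed
  have lip: "norm (k u - k v) \<le> C * norm (u - v)" for u v
  proof (rule differentiable_bound[of UNIV])
    show "onorm (k' w) \<le> C" for w
      using bnd' by (intro onorm_le) auto
  qed (auto intro: der)
  have bl: "bounded_linear (\<lambda>v. \<integral>z. k' (x - z) v \<partial>\<mu>)"
  proof (rule linear_conv_bounded_linear[THEN iffD1], rule linearI)
    show "(\<integral>z. k' (x - z) (v + w) \<partial>\<mu>) = (\<integral>z. k' (x - z) v \<partial>\<mu>) + (\<integral>z. k' (x - z) w \<partial>\<mu>)" for v w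
      by (subst Bochner_Integration.integral_add[symmetric, OF int' int']) (simp add: linear_add[OF lin])
    show "(\<integral>z. k' (x - z) (c *\<^sub>R v) \<partial>\<mu>) = c *\<^sub>R (\<integral>z. k' (x - z) v \<partial>\<mu>)" for c v
      by (simp add: linear_scale[OF lin])
  qed
  have "((\<lambda>y. norm ((\<integral>z. k (y - z) \<partial>\<mu>) - (\<integral>z. k (x - z) \<partial>\<mu>) - (\<integral>z. k' (x - z) (y - x) \<partial>\<mu>)) / norm (y - x))
     \<longlongrightarrow> 0) (at x)"
    unfolding tendsto_at_iff_sequentially
  proof (intro allI impI)
    fix X assume X: "\<forall>i. X i \<in> UNIV - {x}" "X \<longlonglongrightarrow> x"
    define r where "r n z = inverse (norm (X n - x)) *\<^sub>R (k (X n - z) - k (x - z) - k' (x - z) (X n - x))" for n z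
    have rlim: "(\<lambda>n. r n z) \<longlonglongrightarrow> 0" for z
    proof -
      have "((\<lambda>y. inverse (norm (y - (x - z))) *\<^sub>R (k y - k (x - z) - k' (x - z) (y - (x - z)))) \<longlongrightarrow> 0) (at (x - z))"
        using der[of "x - z"] unfolding has_derivative_at_within by blast
      moreover have "(\<forall>i. X i - z \<in> UNIV - {x - z}) \<and> (\<lambda>n. X n - z) \<longlonglongrightarrow> x - z"
        using X by (auto intro!: tendsto_intros)
      ultimately have "((\<lambda>y. inverse (norm (y - (x - z))) *\<^sub>R (k y - k (x - z) - k' (x - z) (y - (x - z)))) \<circ> (\<lambda>n. X n - z)) \<longlonglongrightarrow> 0"
        unfolding tendsto_at_iff_sequentially by (elim allE[where x="\<lambda>n. X n - z"]) simp
      then show ?thesis by (simp add: r_def o_def)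
    qed
    have rb: "norm (r n z) \<le> 2 * C" for n z
    proof -
      have pos: "norm (X n - x) > 0" using X by simp
      have "norm (k (X n - z) - k (x - z) - k' (x - z) (X n - x)) \<le> 2 * C * norm (X n - x)"
        using norm_triangle_ineq4[of "k (X n - z) - k (x - z)" "k' (x - z) (X n - x)"]
          lip[of "X n - z" "x - z"] bnd'[of "x - z" "X n - x"] by simp
      then show ?thesis using pos by (simp add: r_def divide_simps)
    qed
    have [measurable]: "r n \<in> borel_measurable \<mu>" for n unfolding r_def by measurable
    have "(\<lambda>n. \<integral>z. r n z \<partial>\<mu>) \<longlonglongrightarrow> (\<integral>z. 0 \<partial>\<mu>)"
      by (rule integral_dominated_convergence[where w="\<lambda>_. 2 * C"]) (auto simp: rlim rb)
    then have "(\<lambda>n. norm (\<integral>z. r n z \<partial>\<mu>)) \<longlonglongrightarrow> 0" by (simp add: tendsto_norm_zero)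
    moreover have "norm (\<integral>z. r n z \<partial>\<mu>) = norm ((\<integral>z. k (X n - z) \<partial>\<mu>) - (\<integral>z. k (x - z) \<partial>\<mu>)
        - (\<integral>z. k' (x - z) (X n - x) \<partial>\<mu>)) / norm (X n - x)" for n
      unfolding r_def by (simp add: int int' divide_inverse_commute)
    ultimately show "((\<lambda>y. norm ((\<integral>z. k (y - z) \<partial>\<mu>) - (\<integral>z. k (x - z) \<partial>\<mu>) - (\<integral>z. k' (x - z) (y - x) \<partial>\<mu>)) / norm (y - x)) \<circ> X) \<longlonglongrightarrow> 0"
      by (simp add: o_def)
  qed
  then show ?thesis using bl unfolding has_derivative_iff_norm by simp
qed

lemma heat_kernel_has_derivative:
  fixes u :: "'a::euclidean_space"
  assumes "t > 0"
  shows "(heat_kernel t has_derivative (\<lambda>v. - (u \<bullet> v) / t * heat_kernel t u)) (at u)"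
  unfolding heat_kernel_def power2_norm_eq_inner
  using assms by (auto intro!: derivative_eq_intros simp: inner_commute field_simps)

lemma norm_sq_heat_kernel_le:
  fixes u :: "'a::euclidean_space"
  assumes "t > 0"
  shows "(norm u)\<^sup>2 * heat_kernel t u \<le> 2 * t / sqrt (2 * pi * t) ^ DIM('a)"
proof -
  have "(norm u)\<^sup>2 / (2 * t) \<le> exp ((norm u)\<^sup>2 / (2 * t))"
    using exp_ge_add_one_self[of "(norm u)\<^sup>2 / (2 * t)"] by linarith
  then have "(norm u)\<^sup>2 \<le> 2 * t * exp ((norm u)\<^sup>2 / (2 * t))" using assms by (simp add: field_simps)
  then have "(norm u)\<^sup>2 * exp (- (norm u)\<^sup>2 / (2 * t)) \<le> 2 * t"
    by (simp add: exp_minus field_simps)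
  then show ?thesis unfolding heat_kernel_def times_divide_eq_right
    using assms by (intro divide_right_mono) auto
qed

locale gaussian_smoothing = prob_space \<mu> for \<mu> :: "'a::euclidean_space measure" +
  fixes t :: real
  assumes sets_\<mu> [measurable_cong]: "sets \<mu> = sets borel" and t_pos: "t > 0"
begin

abbreviation "p \<equiv> heat_flow \<mu> t"

lemma prob_space_\<mu>: "prob_space \<mu>" by unfold_locales

lemma p_pos: "p x > 0"
  using heat_flow_pos[OF prob_space_\<mu> sets_\<mu> t_pos] .

text \<open>
  The conditional law of \<open>X\<close> given \<open>Y = x\<close>, where \<open>X\<close> has law \<open>\<mu>\<close> and \<open>Y\<close> is \<open>X\<close> plus an independent
  centred Gaussian of covariance \<open>t\<close>.
\<close>

definition posterior :: "'a \<Rightarrow> 'a measure" where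
  "posterior x = density \<mu> (\<lambda>z. ennreal (heat_kernel t (x - z) / p x))"

lemma sets_posterior [measurable_cong]: "sets (posterior x) = sets borel"
  by (simp add: posterior_def sets_\<mu>)

lemma prob_space_posterior: "prob_space (posterior x)"
proof
  have "emeasure (posterior x) (space (posterior x)) = (\<integral>\<^sup>+z. ennreal (heat_kernel t (x - z) / p x) \<partial>\<mu>)"
    unfolding posterior_def by (simp add: emeasure_density cong: nn_integral_cong)
  also have "\<dots> = ennreal (\<integral>z. heat_kernel t (x - z) / p x \<partial>\<mu>)"
    by (rule nn_integral_eq_integral)
      (auto intro!: AE_I2 integrable_heat_kernel[OF prob_space_\<mu> sets_\<mu> t_pos] divide_nonneg_pos p_pos
        less_imp_le[OF heat_kernel_pos[OF t_pos]])
  also have "(\<integral>z. heat_kernel t (x - z) / p x \<partial>\<mu>) = 1"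
    using p_pos[of x] by (simp add: heat_flow_def)
  finally show "emeasure (posterior x) (space (posterior x)) = 1" by simp
qed

lemma integral_posterior:
  fixes f :: "'a \<Rightarrow> 'b::euclidean_space"
  assumes [measurable]: "f \<in> borel_measurable borel"
  shows "integral\<^sup>L (posterior x) f = (1 / p x) *\<^sub>R (\<integral>z. heat_kernel t (x - z) *\<^sub>R f z \<partial>\<mu>)"
proof -
  have "integral\<^sup>L (posterior x) f = (\<integral>z. (heat_kernel t (x - z) / p x) *\<^sub>R f z \<partial>\<mu>)"
    unfolding posterior_def
    by (rule integral_density) (auto intro!: AE_I2 divide_nonneg_pos p_pos
        less_imp_le[OF heat_kernel_pos[OF t_pos]])
  also have "\<dots> = (\<integral>z. (1 / p x) *\<^sub>R (heat_kernel t (x - z) *\<^sub>R f z) \<partial>\<mu>)" by simp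
  finally show ?thesis by (simp only: integral_scaleR_right)
qed

lemma integrable_posterior_iff:
  fixes f :: "'a \<Rightarrow> 'b::euclidean_space"
  assumes [measurable]: "f \<in> borel_measurable borel"
  shows "integrable (posterior x) f \<longleftrightarrow> integrable \<mu> (\<lambda>z. heat_kernel t (x - z) *\<^sub>R f z)"
proof -
  have "integrable (posterior x) f \<longleftrightarrow> integrable \<mu> (\<lambda>z. (heat_kernel t (x - z) / p x) *\<^sub>R f z)"
    unfolding posterior_def
    by (rule integrable_density) (auto intro!: AE_I2 divide_nonneg_pos p_pos
        less_imp_le[OF heat_kernel_pos[OF t_pos]])
  also have "\<dots> \<longleftrightarrow> integrable \<mu> (\<lambda>z. (1 / p x) *\<^sub>R (heat_kernel t (x - z) *\<^sub>R f z))" by simp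
  also have "\<dots> \<longleftrightarrow> integrable \<mu> (\<lambda>z. heat_kernel t (x - z) *\<^sub>R f z)" (is "?L \<longleftrightarrow> ?R")
  proof
    assume ?L
    then have "integrable \<mu> (\<lambda>z. p x *\<^sub>R ((1 / p x) *\<^sub>R (heat_kernel t (x - z) *\<^sub>R f z)))"
      by (rule integrable_scaleR_right)
    then show ?R using p_pos[of x] by simp
  qed (rule integrable_scaleR_right)
  finally show ?thesis .
qed

text \<open>
  The Gaussian factor in the density of the conditional law absorbs quadratic growth, whatever the
  tails of \<open>\<mu>\<close> are.
\<close>

lemma integrable_posterior:
  fixes f :: "'a \<Rightarrow> 'b::euclidean_space"
  assumes [measurable]: "f \<in> borel_measurable borel" and f: "\<And>z. norm (f z) \<le> a + b * (norm (x - z))\<^sup>2"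
  shows "integrable (posterior x) f"
proof -
  define c where "c = 1 / sqrt (2 * pi * t) ^ DIM('a)"
  have hk: "0 \<le> heat_kernel t u" "heat_kernel t u \<le> c" "(norm u)\<^sup>2 * heat_kernel t u \<le> 2 * t * c" for u :: 'a
    using heat_kernel_pos[OF t_pos, of u] heat_kernel_le[OF t_pos, of u] norm_sq_heat_kernel_le[OF t_pos, of u]
    by (auto simp: c_def)
  have "integrable \<mu> (\<lambda>z. heat_kernel t (x - z) *\<^sub>R f z)"
  proof (rule integrable_const_bound[where B="\<bar>a\<bar> * c + \<bar>b\<bar> * (2 * t * c)"], rule AE_I2)
    fix z
    have "norm (f z) \<le> \<bar>a\<bar> + \<bar>b\<bar> * (norm (x - z))\<^sup>2"
      by (rule order_trans[OF f]) (intro add_mono mult_right_mono, auto)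
    then have "heat_kernel t (x - z) * norm (f z) \<le> heat_kernel t (x - z) * (\<bar>a\<bar> + \<bar>b\<bar> * (norm (x - z))\<^sup>2)"
      using hk by (intro mult_left_mono)
    also have "\<dots> = \<bar>a\<bar> * heat_kernel t (x - z) + \<bar>b\<bar> * ((norm (x - z))\<^sup>2 * heat_kernel t (x - z))"
      by (simp add: algebra_simps)
    also have "\<dots> \<le> \<bar>a\<bar> * c + \<bar>b\<bar> * (2 * t * c)"
      by (intro add_mono mult_left_mono hk) auto
    finally show "norm (heat_kernel t (x - z) *\<^sub>R f z) \<le> \<bar>a\<bar> * c + \<bar>b\<bar> * (2 * t * c)"
      using hk by simp
  qed measurable
  then show ?thesis by (simp add: integrable_posterior_iff)
qed

text \<open>
  By \<open>p_has_derivative\<close> this is \<open>- t \<nabla> log p\<close>.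
\<close>

definition drift :: "'a \<Rightarrow> 'a" where
  "drift x = (\<integral>z. x - z \<partial>posterior x)"

definition cov :: "'a \<Rightarrow> 'a \<Rightarrow> 'a \<Rightarrow> real" where
  "cov x u v = (\<integral>z. ((x - z) \<bullet> u) * ((x - z) \<bullet> v) \<partial>posterior x) - (drift x \<bullet> u) * (drift x \<bullet> v)"

lemma norm_le_1_plus_sq: "norm (w::'b::real_normed_vector) \<le> 1 + (norm w)\<^sup>2"
  using zero_le_power2[of "norm w - 1/2"] by (simp add: power2_eq_square algebra_simps)

lemma integrable_posterior_xi: "integrable (posterior x) (\<lambda>z. x - z)"
  by (rule integrable_posterior[where a=1 and b=1]) (auto simp: norm_le_1_plus_sq)

lemma integrable_posterior_quad: "integrable (posterior x) (\<lambda>z. ((x - z) \<bullet> u) * ((x - z) \<bullet> v))"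
proof (rule integrable_posterior[where a=0 and b="norm u * norm v"])
  fix z
  have "\<bar>(x - z) \<bullet> u\<bar> * \<bar>(x - z) \<bullet> v\<bar> \<le> (norm (x - z) * norm u) * (norm (x - z) * norm v)"
    by (intro mult_mono Cauchy_Schwarz_ineq2) auto
  then show "norm (((x - z) \<bullet> u) * ((x - z) \<bullet> v)) \<le> 0 + norm u * norm v * (norm (x - z))\<^sup>2"
    by (simp add: abs_mult power2_eq_square ac_simps)
qed measurable

lemma integrable_posterior_norm_sq: "integrable (posterior x) (\<lambda>z. (norm (x - z))\<^sup>2)"
  by (rule integrable_posterior[where a=0 and b=1]) auto

lemma integral_posterior_inner: "(\<integral>z. (x - z) \<bullet> u \<partial>posterior x) = drift x \<bullet> u"
  unfolding drift_def by (rule integral_inner_left) (simp add: integrable_posterior_xi)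

lemma cov_eq: "cov x u v = (\<integral>z. ((x - z - drift x) \<bullet> u) * ((x - z - drift x) \<bullet> v) \<partial>posterior x)"
proof -
  interpret P: prob_space "posterior x" by (rule prob_space_posterior)
  note [simp] = integrable_posterior_quad
  have [simp]: "integrable (posterior x) (\<lambda>z. (x - z) \<bullet> u)" for u
    by (rule integrable_inner_left) (simp add: integrable_posterior_xi)
  have "(\<integral>z. ((x - z - drift x) \<bullet> u) * ((x - z - drift x) \<bullet> v) \<partial>posterior x)
    = (\<integral>z. ((x - z) \<bullet> u) * ((x - z) \<bullet> v) - (drift x \<bullet> u) * ((x - z) \<bullet> v)
        - (drift x \<bullet> v) * ((x - z) \<bullet> u) + (drift x \<bullet> u) * (drift x \<bullet> v) \<partial>posterior x)"
    by (rule Bochner_Integration.integral_cong) (auto simp: inner_diff_left algebra_simps)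
  also have "\<dots> = cov x u v"
    by (simp add: integral_posterior_inner cov_def P.prob_space)
  finally show ?thesis by simp
qed

lemma cov_nonneg: "cov x u u \<ge> 0"
  unfolding cov_eq by (rule integral_nonneg_AE) auto

lemma abs_cov_le: "\<bar>cov x u v\<bar> \<le> (cov x u u + cov x v v) / 2"
proof -
  have "cov x (u + c *\<^sub>R v) (u + c *\<^sub>R v) = cov x u u + 2 * c * cov x u v + c\<^sup>2 * cov x v v" for c
  proof -
    have "(\<integral>z. ((x - z) \<bullet> (u + c *\<^sub>R v)) * ((x - z) \<bullet> (u + c *\<^sub>R v)) \<partial>posterior x)
      = (\<integral>z. ((x - z) \<bullet> u) * ((x - z) \<bullet> u) + (2 * c) * (((x - z) \<bullet> u) * ((x - z) \<bullet> v))
          + c\<^sup>2 * (((x - z) \<bullet> v) * ((x - z) \<bullet> v)) \<partial>posterior x)"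
      by (rule Bochner_Integration.integral_cong[OF refl], simp only: inner_add_right inner_scaleR_right) algebra
    also have "\<dots> = (\<integral>z. ((x - z) \<bullet> u) * ((x - z) \<bullet> u) \<partial>posterior x)
         + 2 * c * (\<integral>z. ((x - z) \<bullet> u) * ((x - z) \<bullet> v) \<partial>posterior x)
         + c\<^sup>2 * (\<integral>z. ((x - z) \<bullet> v) * ((x - z) \<bullet> v) \<partial>posterior x)"
      by (simp add: integrable_posterior_quad)
    finally have eq: "(\<integral>z. ((x - z) \<bullet> (u + c *\<^sub>R v)) * ((x - z) \<bullet> (u + c *\<^sub>R v)) \<partial>posterior x) = \<dots>" .
    show ?thesis
      unfolding cov_def eq unfolding inner_add_right inner_scaleR_right by algebra
  qed
  from this[of 1] this[of "-1"] show ?thesis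
    using cov_nonneg[of x "u + 1 *\<^sub>R v"] cov_nonneg[of x "u + (-1) *\<^sub>R v"] by auto
qed

lemma p_has_derivative: "(p has_derivative (\<lambda>v. - (drift x \<bullet> v) / t * p x)) (at x)"
proof -
  define c where "c = 1 / sqrt (2 * pi * t) ^ DIM('a)"
  have hk: "0 \<le> heat_kernel t u" "heat_kernel t u \<le> c" "(norm u)\<^sup>2 * heat_kernel t u \<le> 2 * t * c" for u :: 'a
    using heat_kernel_pos[OF t_pos, of u] heat_kernel_le[OF t_pos, of u] norm_sq_heat_kernel_le[OF t_pos, of u]
    by (auto simp: c_def)
  have "((\<lambda>x. \<integral>z. heat_kernel t (x - z) \<partial>\<mu>) has_derivative
      (\<lambda>v. \<integral>z. - ((x - z) \<bullet> v) / t * heat_kernel t (x - z) \<partial>\<mu>)) (at x)"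
  proof (rule has_derivative_integral_translate[where C="(c + 2 * t * c) / t" and B=c])
    fix u v :: 'a
    have "norm u * heat_kernel t u \<le> (1 + (norm u)\<^sup>2) * heat_kernel t u"
      by (intro mult_right_mono norm_le_1_plus_sq hk)
    also have "\<dots> \<le> c + 2 * t * c" using hk[of u] by (simp add: distrib_right)
    finally have *: "norm u * heat_kernel t u \<le> c + 2 * t * c" .
    have "\<bar>u \<bullet> v\<bar> / t * heat_kernel t u \<le> (norm u * norm v) / t * heat_kernel t u"
      using t_pos by (intro mult_right_mono divide_right_mono Cauchy_Schwarz_ineq2 hk) auto
    also have "\<dots> = (norm u * heat_kernel t u) * (norm v / t)" by simp
    also have "\<dots> \<le> (c + 2 * t * c) * (norm v / t)" using t_pos by (intro mult_right_mono *) auto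
    finally show "norm (- (u \<bullet> v) / t * heat_kernel t u) \<le> (c + 2 * t * c) / t * norm v"
      using t_pos hk(1)[of u] by (simp add: abs_mult)
  qed (use hk heat_kernel_has_derivative[OF t_pos] in \<open>auto simp: prob_space_\<mu> sets_\<mu>\<close>)
  moreover have "(\<integral>z. - ((x - z) \<bullet> v) / t * heat_kernel t (x - z) \<partial>\<mu>) = - (drift x \<bullet> v) / t * p x" for v
  proof -
    have "drift x \<bullet> v = (1 / p x) * (\<integral>z. heat_kernel t (x - z) * ((x - z) \<bullet> v) \<partial>\<mu>)"
      using integral_posterior[of "\<lambda>z. (x - z) \<bullet> v" x] by (simp add: integral_posterior_inner)
    then have "(drift x \<bullet> v) * p x = (\<integral>z. heat_kernel t (x - z) * ((x - z) \<bullet> v) \<partial>\<mu>)"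
      using p_pos[of x] by simp
    moreover have "(\<integral>z. - ((x - z) \<bullet> v) / t * heat_kernel t (x - z) \<partial>\<mu>)
       = (\<integral>z. (- 1 / t) * (heat_kernel t (x - z) * ((x - z) \<bullet> v)) \<partial>\<mu>)"
      by (rule Bochner_Integration.integral_cong) auto
    ultimately show ?thesis by (simp only: integral_mult_right_zero) (simp add: field_simps)
  qed
  ultimately have "((\<lambda>x. \<integral>z. heat_kernel t (x - z) \<partial>\<mu>) has_derivative (\<lambda>v. - (drift x \<bullet> v) / t * p x)) (at x)"
    by (simp only:)
  then show ?thesis by (simp only: heat_flow_def[symmetric])
qed

definition drift_derivative :: "'a \<Rightarrow> 'a \<Rightarrow> 'a" where
  "drift_derivative x v = v - (1 / t) *\<^sub>R
     ((\<integral>z. ((x - z) \<bullet> v) *\<^sub>R (x - z) \<partial>posterior x) - (drift x \<bullet> v) *\<^sub>R drift x)"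

lemma integrable_posterior_rank_one:
  "integrable (posterior x) (\<lambda>z. ((x - z) \<bullet> v) *\<^sub>R (x - z))"
proof (rule integrable_posterior[where a=0 and b="norm v"])
  fix z
  show "norm (((x - z) \<bullet> v) *\<^sub>R (x - z)) \<le> 0 + norm v * (norm (x - z))\<^sup>2"
    using mult_right_mono[OF Cauchy_Schwarz_ineq2[of "x - z" v], of "norm (x - z)"]
    by (simp add: power2_eq_square ac_simps)
qed measurable

text \<open>
  The drift is a quotient of two integrals over \<open>\<mu>\<close> of translates of \<open>heat_kernel t u *\<^sub>R u\<close> and
  of the heat kernel; both have bounded derivatives. In the quotient rule the second moments recombine
  to the covariance.
\<close>

lemma drift_has_derivative: "(drift has_derivative drift_derivative x) (at x)"
proof -
  define c where "c = 1 / sqrt (2 * pi * t) ^ DIM('a)"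
  have hk: "0 \<le> heat_kernel t u" "heat_kernel t u \<le> c" "(norm u)\<^sup>2 * heat_kernel t u \<le> 2 * t * c" for u :: 'a
    using heat_kernel_pos[OF t_pos, of u] heat_kernel_le[OF t_pos, of u] norm_sq_heat_kernel_le[OF t_pos, of u]
    by (auto simp: c_def)
  define N where "N x = (\<integral>z. heat_kernel t (x - z) *\<^sub>R (x - z) \<partial>\<mu>)" for x
  have N: "N x = p x *\<^sub>R drift x" for x
    unfolding drift_def N_def using p_pos[of x] integral_posterior[of "\<lambda>z. x - z" x] by simp
  have "((\<lambda>x. \<integral>z. heat_kernel t (x - z) *\<^sub>R (x - z) \<partial>\<mu>) has_derivative
      (\<lambda>v. \<integral>z. heat_kernel t (x - z) *\<^sub>R v + (- ((x - z) \<bullet> v) / t * heat_kernel t (x - z)) *\<^sub>R (x - z) \<partial>\<mu>)) (at x)"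
  proof (rule has_derivative_integral_translate[where C="3 * c" and B="c + 2 * t * c"])
    fix u v :: 'a
    show "((\<lambda>u. heat_kernel t u *\<^sub>R u) has_derivative
       (\<lambda>v. heat_kernel t u *\<^sub>R v + (- (u \<bullet> v) / t * heat_kernel t u) *\<^sub>R u)) (at u)"
      by (rule has_derivative_scaleR[OF heat_kernel_has_derivative[OF t_pos] has_derivative_ident])
    have "norm u * heat_kernel t u \<le> (1 + (norm u)\<^sup>2) * heat_kernel t u"
      by (intro mult_right_mono norm_le_1_plus_sq hk)
    also have "\<dots> \<le> c + 2 * t * c" using hk[of u] by (simp add: distrib_right)
    finally show "norm (heat_kernel t u *\<^sub>R u) \<le> c + 2 * t * c" using hk(1)[of u] by (simp add: mult.commute)
    have "norm ((- (u \<bullet> v) / t * heat_kernel t u) *\<^sub>R u) = \<bar>u \<bullet> v\<bar> * (heat_kernel t u / t * norm u)"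
      using hk(1)[of u] t_pos by (simp add: abs_mult)
    also have "\<dots> \<le> (norm u * norm v) * (heat_kernel t u / t * norm u)"
      using t_pos hk(1)[of u] by (intro mult_right_mono Cauchy_Schwarz_ineq2) auto
    also have "\<dots> = ((norm u)\<^sup>2 * heat_kernel t u) * (norm v / t)" by (simp add: power2_eq_square)
    also have "\<dots> \<le> (2 * t * c) * (norm v / t)" using t_pos by (intro mult_right_mono hk) auto
    finally have "norm ((- (u \<bullet> v) / t * heat_kernel t u) *\<^sub>R u) \<le> 2 * c * norm v" using t_pos by simp
    moreover have "norm (heat_kernel t u *\<^sub>R v) \<le> c * norm v"
      using hk(1,2)[of u] by (simp add: mult_right_mono)
    ultimately show "norm (heat_kernel t u *\<^sub>R v + (- (u \<bullet> v) / t * heat_kernel t u) *\<^sub>R u) \<le> 3 * c * norm v"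
      using norm_triangle_ineq[of "heat_kernel t u *\<^sub>R v" "(- (u \<bullet> v) / t * heat_kernel t u) *\<^sub>R u"] by simp
  qed (auto simp: prob_space_\<mu> sets_\<mu>)
  also have "(\<lambda>v. \<integral>z. heat_kernel t (x - z) *\<^sub>R v + (- ((x - z) \<bullet> v) / t * heat_kernel t (x - z)) *\<^sub>R (x - z) \<partial>\<mu>)
    = (\<lambda>v. p x *\<^sub>R v - (p x / t) *\<^sub>R (\<integral>z. ((x - z) \<bullet> v) *\<^sub>R (x - z) \<partial>posterior x))"
  proof
    fix v
    have i1: "integrable \<mu> (\<lambda>z. heat_kernel t (x - z) *\<^sub>R (((x - z) \<bullet> v) *\<^sub>R (x - z)))"
      using integrable_posterior_rank_one[of x v] by (subst (asm) integrable_posterior_iff) auto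
    have i2: "integrable \<mu> (\<lambda>z. heat_kernel t (x - z))"
      by (rule integrable_heat_kernel[OF prob_space_\<mu> sets_\<mu> t_pos])
    have "(\<integral>z. heat_kernel t (x - z) *\<^sub>R v + (- ((x - z) \<bullet> v) / t * heat_kernel t (x - z)) *\<^sub>R (x - z) \<partial>\<mu>)
      = (\<integral>z. heat_kernel t (x - z) *\<^sub>R v - (1 / t) *\<^sub>R (heat_kernel t (x - z) *\<^sub>R (((x - z) \<bullet> v) *\<^sub>R (x - z))) \<partial>\<mu>)"
      by (rule Bochner_Integration.integral_cong) (auto simp: ac_simps)
    also have "\<dots> = (\<integral>z. heat_kernel t (x - z) *\<^sub>R v \<partial>\<mu>)
        - (1 / t) *\<^sub>R (\<integral>z. heat_kernel t (x - z) *\<^sub>R (((x - z) \<bullet> v) *\<^sub>R (x - z)) \<partial>\<mu>)"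
      by (subst Bochner_Integration.integral_diff)
        (use i1 i2 in \<open>simp_all only: integral_scaleR_right integrable_scaleR_right integrable_scaleR_left\<close>)
    also have "(\<integral>z. heat_kernel t (x - z) *\<^sub>R v \<partial>\<mu>) = p x *\<^sub>R v"
      using i2 by (simp add: heat_flow_def)
    also have "(\<integral>z. heat_kernel t (x - z) *\<^sub>R (((x - z) \<bullet> v) *\<^sub>R (x - z)) \<partial>\<mu>)
       = p x *\<^sub>R (\<integral>z. ((x - z) \<bullet> v) *\<^sub>R (x - z) \<partial>posterior x)"
      using p_pos[of x] by (subst integral_posterior) auto
    finally show "(\<integral>z. heat_kernel t (x - z) *\<^sub>R v + (- ((x - z) \<bullet> v) / t * heat_kernel t (x - z)) *\<^sub>R (x - z) \<partial>\<mu>)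
      = p x *\<^sub>R v - (p x / t) *\<^sub>R (\<integral>z. ((x - z) \<bullet> v) *\<^sub>R (x - z) \<partial>posterior x)"
      by simp
  qed
  finally have dN: "(N has_derivative (\<lambda>v. p x *\<^sub>R v - (p x / t) *\<^sub>R (\<integral>z. ((x - z) \<bullet> v) *\<^sub>R (x - z) \<partial>posterior x))) (at x)"
    unfolding N_def[abs_def] .
  have "drift = (\<lambda>x. inverse (p x) *\<^sub>R N x)"
  proof
    show "drift x = inverse (p x) *\<^sub>R N x" for x using p_pos[of x] by (simp add: N)
  qed
  moreover have "((\<lambda>x. inverse (p x) *\<^sub>R N x) has_derivative
     (\<lambda>v. inverse (p x) *\<^sub>R (p x *\<^sub>R v - (p x / t) *\<^sub>R (\<integral>z. ((x - z) \<bullet> v) *\<^sub>R (x - z) \<partial>posterior x))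
        + (- (inverse (p x) * (- (drift x \<bullet> v) / t * p x) * inverse (p x))) *\<^sub>R N x)) (at x)"
    using p_pos[of x] by (intro has_derivative_scaleR[OF Deriv.has_derivative_inverse[OF _ p_has_derivative] dN]) simp
  moreover have "inverse (p x) *\<^sub>R (p x *\<^sub>R v - (p x / t) *\<^sub>R (\<integral>z. ((x - z) \<bullet> v) *\<^sub>R (x - z) \<partial>posterior x))
        + (- (inverse (p x) * (- (drift x \<bullet> v) / t * p x) * inverse (p x))) *\<^sub>R N x
    = drift_derivative x v" for v
    using p_pos[of x] by (simp add: N scaleR_diff_right drift_derivative_def)
  ultimately show ?thesis by simp
qed

lemma drift_derivative_inner: "drift_derivative x v \<bullet> u = v \<bullet> u - cov x v u / t"
proof -
  have "(\<integral>z. ((x - z) \<bullet> v) *\<^sub>R (x - z) \<partial>posterior x) \<bullet> u = (\<integral>z. (((x - z) \<bullet> v) *\<^sub>R (x - z)) \<bullet> u \<partial>posterior x)"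
    by (rule integral_inner_left[symmetric]) (simp add: integrable_posterior_rank_one)
  then show ?thesis by (simp add: drift_derivative_def inner_diff_left cov_def diff_divide_distrib)
qed

end

section \<open>The expanding map of one time step\<close>

text \<open>
  Log-concavity of \<open>\<mu>\<close> enters the analysis of a time step only through this property of \<open>p\<close>.
\<close>

locale log_concave_smoothing = gaussian_smoothing +
  assumes midpoint: "p x * p y \<le> (p ((1/2) *\<^sub>R (x + y)))\<^sup>2"
begin

text \<open>
  A concave function lies below its tangents. From midpoint concavity alone, bisection shows that the
  difference quotients along \<open>1, 1/2, 1/4, \<dots>\<close> increase, and their limit is the derivative.
\<close>

lemma ln_p_tangent: "ln (p y) - ln (p x) \<le> - (drift x \<bullet> (y - x)) / t"
proof -
  define u where "u s = ln (p (x + s *\<^sub>R (y - x)))" for s :: real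
  have line: "((\<lambda>s. x + s *\<^sub>R (y - x)) has_derivative (\<lambda>h. h *\<^sub>R (y - x))) (at 0)"
    by (auto intro!: derivative_eq_intros)
  have "(p has_derivative (\<lambda>v. - (drift x \<bullet> v) / t * p x)) (at (x + 0 *\<^sub>R (y - x)))"
    using p_has_derivative[of x] by simp
  from has_derivative_compose[OF line this]
  have "((\<lambda>s. p (x + s *\<^sub>R (y - x))) has_derivative (\<lambda>h. - (drift x \<bullet> (h *\<^sub>R (y - x))) / t * p x)) (at 0)" .
  then have "((\<lambda>s. p (x + s *\<^sub>R (y - x))) has_real_derivative (- (drift x \<bullet> (y - x)) / t * p x)) (at 0)"
    by (rule has_derivative_imp_has_field_derivative) (simp add: mult.commute mult.left_commute)
  then have "(u has_real_derivative (1 / p x) * (- (drift x \<bullet> (y - x)) / t * p x)) (at 0)"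
    unfolding u_def using p_pos[of x]
    by (auto intro!: derivative_eq_intros simp: field_simps)
  then have der: "(u has_real_derivative (- (drift x \<bullet> (y - x)) / t)) (at 0)"
    using p_pos[of x] by simp
  have half: "u s \<le> 2 * u (s / 2) - u 0" for s
  proof -
    have "p (x + s *\<^sub>R (y - x)) * p x \<le> (p ((1/2) *\<^sub>R ((x + s *\<^sub>R (y - x)) + x)))\<^sup>2" by (rule midpoint)
    also have "(1/2) *\<^sub>R ((x + s *\<^sub>R (y - x)) + x) = x + (s / 2) *\<^sub>R (y - x)"
      by (simp add: scaleR_add_right flip: add.assoc) (simp add: algebra_simps flip: scaleR_add_left)
    finally have "ln (p (x + s *\<^sub>R (y - x)) * p x) \<le> ln ((p (x + (s / 2) *\<^sub>R (y - x)))\<^sup>2)"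
      using p_pos[of x] p_pos[of "x + s *\<^sub>R (y - x)"] p_pos[of "x + (s / 2) *\<^sub>R (y - x)"]
      by (subst ln_le_cancel_iff) simp_all
    then show ?thesis
      using p_pos[of x] p_pos[of "x + s *\<^sub>R (y - x)"] p_pos[of "x + (s / 2) *\<^sub>R (y - x)"]
      by (simp add: u_def ln_mult ln_realpow)
  qed
  have dy: "u 1 - u 0 \<le> (u ((1/2)^k) - u 0) / (1/2)^k" for k
  proof (induction k)
    case (Suc k)
    have "(u ((1/2)^k) - u 0) / (1/2)^k \<le> (2 * (u ((1/2)^k / 2) - u 0)) / (1/2)^k"
      using half[of "(1/2)^k"] by (intro divide_right_mono) auto
    also have "\<dots> = (u ((1/2)^Suc k) - u 0) / (1/2)^Suc k" by (simp add: field_simps)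
    finally show ?case using Suc by linarith
  qed simp
  have lim: "(\<lambda>k. (u ((1/2)^k) - u 0) / (1/2)^k) \<longlonglongrightarrow> - (drift x \<bullet> (y - x)) / t"
  proof -
    have "((\<lambda>h. (u (0 + h) - u 0) / h) \<longlongrightarrow> - (drift x \<bullet> (y - x)) / t) (at 0)"
      using der by (simp add: DERIV_def)
    moreover have "filterlim (\<lambda>k. (1/2::real)^k) (at 0) sequentially"
      by (auto simp: filterlim_at intro!: LIMSEQ_realpow_zero)
    ultimately show ?thesis
      using filterlim_compose[of "\<lambda>h. (u (0 + h) - u 0) / h" _ "at 0" "\<lambda>k. (1/2::real)^k"] by simp
  qed
  have "u 1 - u 0 \<le> - (drift x \<bullet> (y - x)) / t"
    by (rule LIMSEQ_le_const[OF lim]) (use dy in auto)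
  then show ?thesis by (simp add: u_def)
qed

lemma drift_monotone: "0 \<le> (drift x - drift y) \<bullet> (x - y)"
proof -
  have "0 \<le> - (drift x \<bullet> (y - x)) / t + - (drift y \<bullet> (x - y)) / t"
    using ln_p_tangent[of y x] ln_p_tangent[of x y] by linarith
  also have "\<dots> = ((drift x - drift y) \<bullet> (x - y)) / t"
    by (simp add: inner_diff_left inner_diff_right diff_divide_distrib add_divide_distrib)
  finally show ?thesis using t_pos by (simp add: zero_le_divide_iff)
qed

text \<open>
  Monotonicity of the drift makes its derivative positive semidefinite, and this derivative is the
  identity minus the covariance divided by \<open>t\<close>.
\<close>

lemma cov_le: "cov x v v \<le> t * (v \<bullet> v)"
proof -
  let ?D = "drift_derivative x"
  have lin: "linear ?D" using drift_has_derivative has_derivative_linear by blast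
  have line: "((\<lambda>s. x + s *\<^sub>R v) has_derivative (\<lambda>h. h *\<^sub>R v)) (at 0)"
    by (auto intro!: derivative_eq_intros)
  have "(drift has_derivative ?D) (at (x + 0 *\<^sub>R v))"
    using drift_has_derivative[of x] by simp
  from has_derivative_compose[OF line this]
  have "((\<lambda>s. drift (x + s *\<^sub>R v)) has_derivative (\<lambda>h. ?D (h *\<^sub>R v))) (at 0)" .
  then have "((\<lambda>s. drift (x + s *\<^sub>R v) \<bullet> v) has_derivative (\<lambda>h. ?D (h *\<^sub>R v) \<bullet> v)) (at 0)"
    by (rule has_derivative_inner_left)
  then have "((\<lambda>s. drift (x + s *\<^sub>R v) \<bullet> v) has_real_derivative (?D v \<bullet> v)) (at 0)"
    by (rule has_derivative_imp_has_field_derivative)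
      (simp only: linear_scale[OF lin] inner_scaleR_left mult.commute)
  then have "((\<lambda>h. (drift (x + h *\<^sub>R v) \<bullet> v - drift x \<bullet> v) / h) \<longlongrightarrow> ?D v \<bullet> v) (at 0)"
    by (simp add: DERIV_def)
  moreover have "0 \<le> (drift (x + h *\<^sub>R v) \<bullet> v - drift x \<bullet> v) / h" for h
  proof (cases "h = 0")
    case False
    have "0 \<le> h * (drift (x + h *\<^sub>R v) \<bullet> v - drift x \<bullet> v)"
      using drift_monotone[of "x + h *\<^sub>R v" x] by (simp add: inner_diff_left)
    then show ?thesis using False by (auto simp add: zero_le_divide_iff zero_le_mult_iff)
  qed simp
  ultimately have "0 \<le> ?D v \<bullet> v"
    by (intro tendsto_lowerbound) auto
  then have "cov x v v / t \<le> v \<bullet> v" by (simp only: drift_derivative_inner)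
  then show ?thesis using t_pos by (simp add: field_simps)
qed

text \<open>
  The Euler step of relative size \<open>\<delta>\<close>: the velocity \<open>drift x / (2 * t)\<close> acts during the time \<open>\<delta> * t\<close>.
\<close>

definition spread :: "real \<Rightarrow> 'a \<Rightarrow> 'a" where
  "spread \<delta> x = x + (\<delta> / 2) *\<^sub>R drift x"

lemma spread_expands:
  assumes "\<delta> \<ge> 0"
  shows "norm (x - y) \<le> norm (spread \<delta> x - spread \<delta> y)"
proof (cases "x = y")
  case False
  have "norm (x - y) * norm (x - y) = (x - y) \<bullet> (x - y)" by (simp add: dot_square_norm power2_eq_square)
  also have "\<dots> \<le> (x - y) \<bullet> (x - y) + (\<delta> / 2) * ((drift x - drift y) \<bullet> (x - y))"
    using drift_monotone[of x y] assms by simp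
  also have "\<dots> = (spread \<delta> x - spread \<delta> y) \<bullet> (x - y)"
    by (simp add: spread_def inner_diff_left inner_add_left algebra_simps)
  also have "\<dots> \<le> norm (spread \<delta> x - spread \<delta> y) * norm (x - y)" by (rule norm_cauchy_schwarz)
  finally show ?thesis using False by simp
qed simp

definition spread_derivative :: "real \<Rightarrow> 'a \<Rightarrow> 'a \<Rightarrow> 'a" where
  "spread_derivative \<delta> x v = v + (\<delta> / 2) *\<^sub>R drift_derivative x v"

lemma spread_has_derivative: "(spread \<delta> has_derivative spread_derivative \<delta> x) (at x)"
  unfolding spread_def[abs_def] spread_derivative_def[abs_def]
  by (intro has_derivative_add has_derivative_ident has_derivative_scaleR_right drift_has_derivative)

lemma continuous_spread: "continuous_on UNIV (spread \<delta>)"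
  by (meson continuous_at_imp_continuous_on spread_has_derivative has_derivative_continuous)

text \<open>
  The image is closed because the map expands distances and is continuous, and open by invariance of
  domain.
\<close>

lemma bij_spread:
  assumes "\<delta> \<ge> 0"
  shows "bij (spread \<delta>)"
proof -
  let ?S = "spread \<delta>"
  have inj: "inj ?S"
  proof (rule injI)
    fix a b assume "?S a = ?S b"
    then have "norm (a - b) \<le> 0" using spread_expands[OF assms, of a b] by simp
    then show "a = b" by simp
  qed
  have "open (range ?S)"
    by (rule invariance_of_domain[OF continuous_spread open_UNIV inj])
  moreover have "closed (range ?S)"
    unfolding closed_sequential_limits
  proof (intro allI impI, elim conjE)
    fix w l assume w: "\<forall>n. w n \<in> range ?S" "w \<longlonglongrightarrow> l"
    have "\<forall>n. \<exists>a. w n = ?S a" using w(1) by blast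
    then obtain v where v: "\<And>n. w n = ?S (v n)" using choice by metis
    have "Cauchy w" using w(2) LIMSEQ_imp_Cauchy by blast
    have "Cauchy v"
    proof (rule CauchyI)
      fix e :: real assume "e > 0"
      then obtain M where M: "\<And>m n. m \<ge> M \<Longrightarrow> n \<ge> M \<Longrightarrow> norm (w m - w n) < e"
        using CauchyD[OF \<open>Cauchy w\<close>] by blast
      have "norm (v m - v n) < e" if "m \<ge> M" "n \<ge> M" for m n
        using M[OF that] spread_expands[OF assms, of "v m" "v n"] unfolding v by linarith
      then show "\<exists>M. \<forall>m\<ge>M. \<forall>n\<ge>M. norm (v m - v n) < e" by blast
    qed
    then obtain x where "v \<longlonglongrightarrow> x" using Cauchy_convergent convergent_def by blast
    then have "(\<lambda>n. ?S (v n)) \<longlonglongrightarrow> ?S x"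
      using continuous_spread by (auto simp: continuous_on_eq_continuous_within intro: isCont_tendsto_compose)
    moreover have "w = (\<lambda>n. ?S (v n))" using v by auto
    ultimately have "w \<longlonglongrightarrow> ?S x" by simp
    then have "l = ?S x" by (rule LIMSEQ_unique[OF w(2)])
    then show "l \<in> range ?S" by simp
  qed
  ultimately have "range ?S = UNIV" using clopen[of "range ?S"] by simp
  then show ?thesis using inj by (simp add: bij_def)
qed

definition normalised_trace :: "'a \<Rightarrow> real" where
  "normalised_trace x = (\<Sum>b\<in>Basis. cov x b b) / t"

lemma normalised_trace_bounds: "0 \<le> normalised_trace x" "normalised_trace x \<le> DIM('a)"
proof -
  show "0 \<le> normalised_trace x"
    unfolding normalised_trace_def using t_pos by (intro divide_nonneg_pos sum_nonneg cov_nonneg) auto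
  have "(\<Sum>b\<in>Basis. cov x b b) \<le> (\<Sum>b\<in>(Basis::'a set). t)"
    using cov_le[of x] by (intro sum_mono) (metis inner_same_Basis mult.right_neutral)
  then show "normalised_trace x \<le> DIM('a)"
    unfolding normalised_trace_def using t_pos by (simp add: field_simps)
qed

lemma sum_cov_Basis: "(\<Sum>b\<in>Basis. cov x b b) = (\<integral>z. (norm (x - z))\<^sup>2 \<partial>posterior x) - (norm (drift x))\<^sup>2"
proof -
  have "(\<Sum>b\<in>Basis. cov x b b) = (\<integral>z. (\<Sum>b\<in>Basis. ((x - z) \<bullet> b) * ((x - z) \<bullet> b)) \<partial>posterior x)
     - (\<Sum>b\<in>Basis. (drift x \<bullet> b) * (drift x \<bullet> b))"
    unfolding cov_def sum_subtractf
    by (subst Bochner_Integration.integral_sum) (auto simp: integrable_posterior_quad)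
  then show ?thesis by (simp only: euclidean_inner[symmetric] power2_norm_eq_inner)
qed

text \<open>
  Write \<open>\<xi> = x - z\<close> and \<open>d = drift x\<close>. The ratio of the kernel at time \<open>t (1 + \<delta>)\<close> and position
  \<open>spread \<delta> x - z\<close> to the kernel at time \<open>t\<close> and position \<open>\<xi>\<close> is \<open>(1 + \<delta>) powr (- DIM / 2)\<close> times
  \<open>exp (U z)\<close>, where \<open>U\<close> is a quadratic function of \<open>\<xi>\<close>. By Jensen's inequality the mean of \<open>exp U\<close>
  under the conditional law is at least the exponential of the mean of \<open>U\<close>, which depends only on
  \<open>d\<close> and on the trace of the covariance.
\<close>

lemma heat_flow_spread_ge:
  assumes \<delta>: "\<delta> > 0"
  shows "p x * exp (- (\<delta> / 2) * (DIM('a) - normalised_trace x)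
        - \<delta>\<^sup>2 * (normalised_trace x / 2 + (norm (drift x))\<^sup>2 / (8 * t)))
     \<le> heat_flow \<mu> (t * (1 + \<delta>)) (spread \<delta> x)"
proof -
  interpret P: prob_space "posterior x" by (rule prob_space_posterior)
  define d where "d = drift x"
  define m where "m = (\<integral>z. (norm (x - z))\<^sup>2 \<partial>posterior x)"
  define c where "c = normalised_trace x"
  have c: "c * t = m - (norm d)\<^sup>2" and c0: "0 \<le> c"
    using sum_cov_Basis[of x] t_pos normalised_trace_bounds(1)[of x] by (auto simp: normalised_trace_def m_def d_def c_def)
  define U where "U z = (norm (x - z))\<^sup>2 / (2 * t) - (norm (x - z + (\<delta> / 2) *\<^sub>R d))\<^sup>2 / (2 * (t * (1 + \<delta>)))" for z
  have [measurable]: "U \<in> borel_measurable borel" unfolding U_def by measurable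
  define \<kappa> where "\<kappa> = 1 / sqrt (1 + \<delta>) ^ DIM('a)"
  have hk: "heat_kernel (t * (1 + \<delta>)) (spread \<delta> x - z) = \<kappa> * (heat_kernel t (x - z) * exp (U z))" for z
  proof -
    have 1: "spread \<delta> x - z = x - z + (\<delta> / 2) *\<^sub>R d" by (simp add: spread_def d_def)
    have 2: "sqrt (2 * pi * (t * (1 + \<delta>))) = sqrt (2 * pi * t) * sqrt (1 + \<delta>)"
      by (simp add: real_sqrt_mult)
    have 3: "exp (- (norm (x - z + (\<delta> / 2) *\<^sub>R d))\<^sup>2 / (2 * (t * (1 + \<delta>))))
        = exp (- (norm (x - z))\<^sup>2 / (2 * t)) * exp (U z)"
      unfolding U_def by (simp flip: exp_add)
    show ?thesis unfolding heat_kernel_def \<kappa>_def 1 2 3 by (simp add: power_mult_distrib)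
  qed
  have sq: "(norm (x - z + (\<delta> / 2) *\<^sub>R d))\<^sup>2 = (norm (x - z))\<^sup>2 + \<delta> * ((x - z) \<bullet> d) + (\<delta> / 2)\<^sup>2 * (norm d)\<^sup>2" for z
    unfolding power2_norm_eq_inner by (simp add: inner_add_left inner_add_right inner_commute power2_eq_square)
  have t': "t * (1 + \<delta>) > 0" using t_pos \<delta> by simp
  have "integrable \<mu> (\<lambda>z. heat_kernel (t * (1 + \<delta>)) (spread \<delta> x - z))"
    by (rule integrable_heat_kernel[OF prob_space_\<mu> sets_\<mu> t'])
  then have "integrable \<mu> (\<lambda>z. (1 / \<kappa>) * (\<kappa> * (heat_kernel t (x - z) * exp (U z))))"
    unfolding hk by (rule integrable_mult_right)
  moreover have "\<kappa> \<noteq> 0" using \<delta> by (simp add: \<kappa>_def)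
  ultimately have "integrable \<mu> (\<lambda>z. heat_kernel t (x - z) * exp (U z))" by simp
  then have iexp: "integrable (posterior x) (\<lambda>z. exp (U z))"
    by (subst integrable_posterior_iff) auto
  have [simp]: "integrable (posterior x) (\<lambda>z. (norm (x - z))\<^sup>2)" by (rule integrable_posterior_norm_sq)
  have [simp]: "integrable (posterior x) (\<lambda>z. (x - z) \<bullet> d)"
    by (rule integrable_inner_left) (simp add: integrable_posterior_xi)
  have Ed: "(\<integral>z. (x - z) \<bullet> d \<partial>posterior x) = d \<bullet> d" unfolding d_def by (rule integral_posterior_inner)
  have iU: "integrable (posterior x) U" unfolding U_def sq by (auto intro!: Bochner_Integration.integrable_add Bochner_Integration.integrable_diff integrable_divide)
  have EU: "integral\<^sup>L (posterior x) U = m / (2 * t) - (m + \<delta> * (d \<bullet> d) + (\<delta> / 2)\<^sup>2 * (norm d)\<^sup>2) / (2 * (t * (1 + \<delta>)))"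
    unfolding U_def sq by (simp add: P.prob_space m_def Ed)
  also have "\<dots> = (\<delta> * c / 2 - \<delta>\<^sup>2 * ((norm d)\<^sup>2 / (8 * t))) / (1 + \<delta>)"
  proof -
    have m: "m = c * t + d \<bullet> d" using c by (simp add: power2_norm_eq_inner)
    show ?thesis unfolding m power2_norm_eq_inner using t_pos \<delta>
      by (simp add: divide_simps) (simp add: algebra_simps power2_eq_square)
  qed
  also have "\<dots> \<ge> (\<delta> / 2) * c - \<delta>\<^sup>2 * (c / 2 + (norm d)\<^sup>2 / (8 * t))"
  proof -
    define e where "e = (norm d)\<^sup>2 / (8 * t)"
    have "0 \<le> \<delta> ^ 3 * (c / 2) + \<delta> ^ 3 * e" using \<delta> c0 t_pos by (simp add: e_def)
    moreover have "((\<delta> / 2) * c - \<delta>\<^sup>2 * (c / 2 + e)) * (1 + \<delta>)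
        = \<delta> * c / 2 - \<delta>\<^sup>2 * e - (\<delta> ^ 3 * (c / 2) + \<delta> ^ 3 * e)"
      by (simp add: field_simps power2_eq_square power3_eq_cube)
    ultimately have "((\<delta> / 2) * c - \<delta>\<^sup>2 * (c / 2 + e)) * (1 + \<delta>) \<le> \<delta> * c / 2 - \<delta>\<^sup>2 * e"
      by linarith
    then show ?thesis using \<delta> unfolding e_def[symmetric] by (simp add: pos_le_divide_eq)
  qed
  finally have EU_ge: "(\<delta> / 2) * c - \<delta>\<^sup>2 * (c / 2 + (norm d)\<^sup>2 / (8 * t)) \<le> integral\<^sup>L (posterior x) U" .
  have "exp (integral\<^sup>L (posterior x) U) \<le> (\<integral>z. exp (U z) \<partial>posterior x)"
    by (rule P.jensens_inequality[OF iU, of UNIV]) (auto simp: iexp exp_convex)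
  moreover have "exp (- (\<delta> / 2) * DIM('a)) \<le> \<kappa>"
  proof -
    have "1 + \<delta> \<le> exp (\<delta> / 2) ^ 2" using exp_ge_add_one_self[of \<delta>] by (simp flip: exp_double)
    then have "sqrt (1 + \<delta>) \<le> exp (\<delta> / 2)" by (intro real_le_lsqrt) auto
    then have "sqrt (1 + \<delta>) ^ DIM('a) \<le> exp (\<delta> / 2) ^ DIM('a)" using \<delta> by (intro power_mono) auto
    then have "1 / exp (\<delta> / 2) ^ DIM('a) \<le> \<kappa>" unfolding \<kappa>_def using \<delta> by (intro divide_left_mono) auto
    moreover have "exp (- (\<delta> / 2) * DIM('a)) = 1 / exp (\<delta> / 2) ^ DIM('a)"
    proof -
      have "exp (- (\<delta> / 2) * DIM('a)) = exp (- (\<delta> / 2)) ^ DIM('a)"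
        by (subst exp_of_nat_mult[symmetric]) (simp only: mult.commute)
      then show ?thesis by (simp only: exp_minus inverse_eq_divide power_one_over)
    qed
    ultimately show ?thesis by simp
  qed
  ultimately have "exp (- (\<delta> / 2) * DIM('a)) * exp ((\<delta> / 2) * c - \<delta>\<^sup>2 * (c / 2 + (norm d)\<^sup>2 / (8 * t)))
     \<le> \<kappa> * (\<integral>z. exp (U z) \<partial>posterior x)"
    using EU_ge by (intro mult_mono) (auto intro: order_trans[rotated])
  also have "exp (- (\<delta> / 2) * DIM('a)) * exp ((\<delta> / 2) * c - \<delta>\<^sup>2 * (c / 2 + (norm d)\<^sup>2 / (8 * t)))
     = exp (- (\<delta> / 2) * (DIM('a) - c) - \<delta>\<^sup>2 * (c / 2 + (norm d)\<^sup>2 / (8 * t)))"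
    by (simp add: field_simps flip: exp_add)
  finally have "p x * exp (- (\<delta> / 2) * (DIM('a) - c) - \<delta>\<^sup>2 * (c / 2 + (norm d)\<^sup>2 / (8 * t)))
     \<le> p x * (\<kappa> * (\<integral>z. exp (U z) \<partial>posterior x))"
    by (rule mult_left_mono) (simp add: p_pos less_imp_le)
  also have "\<dots> = \<kappa> * (\<integral>z. heat_kernel t (x - z) * exp (U z) \<partial>\<mu>)"
    using p_pos[of x] by (subst integral_posterior) auto
  also have "\<dots> = heat_flow \<mu> (t * (1 + \<delta>)) (spread \<delta> x)"
    unfolding heat_flow_def hk by simp
  finally show ?thesis by (simp add: c_def d_def)
qed

end

section \<open>Determinants near the identity and change of variables\<close>

lemma prod_one_plus_ge:
  fixes b :: "'i \<Rightarrow> real"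
  assumes "finite I" "\<And>i. i \<in> I \<Longrightarrow> 0 \<le> b i"
  shows "1 + (\<Sum>i\<in>I. b i) \<le> (\<Prod>i\<in>I. 1 + b i)"
  using assms
proof (induction I rule: finite_induct)
  case (insert i I)
  have IH: "1 + (\<Sum>i\<in>I. b i) \<le> (\<Prod>i\<in>I. 1 + b i)" and s: "0 \<le> (\<Sum>i\<in>I. b i)"
    using insert by (auto intro: sum_nonneg)
  have "1 + (\<Sum>i\<in>insert i I. b i) \<le> (1 + b i) * (1 + (\<Sum>i\<in>I. b i))"
    using insert s by (simp add: algebra_simps)
  also have "\<dots> \<le> (1 + b i) * (\<Prod>i\<in>I. 1 + b i)"
    using IH insert.prems[of i] by (intro mult_left_mono) auto
  finally show ?case using insert by simp
qed simp

text \<open>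
  A permutation other than the identity moves at least two points, so its term in the Leibniz formula
  contains two small factors.
\<close>

lemma prod_perturbed_offdiag:
  fixes A :: "'m::finite \<Rightarrow> 'm \<Rightarrow> real"
  assumes perm: "p permutes (UNIV::'m set)" and ne: "p \<noteq> id"
    and two: "\<And>i j. \<bar>A i j\<bar> \<le> 2" and off: "\<And>i j. i \<noteq> j \<Longrightarrow> \<bar>A i j\<bar> \<le> a"
  shows "\<bar>\<Prod>i\<in>UNIV. A i (p i)\<bar> \<le> a\<^sup>2 * 2 ^ CARD('m)"
proof -
  obtain i where i: "p i \<noteq> i" using ne by (auto simp: fun_eq_iff)
  define j where "j = p i"
  have "inj p" using perm by (rule permutes_inj)
  then have j: "p j \<noteq> j" using i unfolding j_def by (metis injD)
  have ij: "i \<noteq> j" using i j_def by simp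
  have a0: "0 \<le> a" using off[OF ij] by linarith
  have "(\<Prod>k\<in>UNIV. \<bar>A k (p k)\<bar>) = \<bar>A i (p i)\<bar> * (\<bar>A j (p j)\<bar> * (\<Prod>k\<in>UNIV - {i} - {j}. \<bar>A k (p k)\<bar>))"
    using ij by (subst prod.remove[of UNIV i], simp, simp) (subst prod.remove[of "UNIV - {i}" j], auto)
  also have "\<dots> \<le> a * (a * (\<Prod>k\<in>UNIV - {i} - {j}. 2))"
    using i j a0 by (intro mult_mono prod_mono mult_nonneg_nonneg prod_nonneg conjI off two) (auto intro: off)
  also have "(\<Prod>k\<in>UNIV - {i} - {j}. 2::real) \<le> 2 ^ CARD('m)"
    by (simp add: power_increasing card_mono)
  then have "a * (a * (\<Prod>k\<in>UNIV - {i} - {j}. 2)) \<le> a * (a * 2 ^ CARD('m))"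
    using a0 by (intro mult_left_mono) auto
  finally show ?thesis by (simp add: abs_prod power2_eq_square mult.assoc)
qed

text \<open>
  In the Leibniz formula the identity contributes at least \<open>1 + a * trace B\<close>, since the diagonal of
  \<open>B\<close> is nonnegative, and each other permutation contributes a term of order \<open>a\<^sup>2\<close>.
\<close>

lemma det_perturbation_ge:
  fixes B :: "real^'m^'m"
  assumes diag: "\<And>i. 0 \<le> B $ i $ i" and bnd: "\<And>i j. \<bar>B $ i $ j\<bar> \<le> 1" and a: "0 \<le> a" "a \<le> 1"
  shows "1 + a * trace B - fact CARD('m) * 2 ^ CARD('m) * a\<^sup>2 \<le> det (mat 1 + a *\<^sub>R B)"
proof -
  define A where "A = mat 1 + a *\<^sub>R B"
  have Aij: "A $ i $ j = (if i = j then 1 else 0) + a * B $ i $ j" for i j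
    by (simp add: A_def mat_def)
  have ab: "\<bar>a * B $ i $ j\<bar> \<le> a" for i j
    using mult_left_mono[OF bnd[of i j] a(1)] a(1) by (simp add: abs_mult)
  have two: "\<bar>A $ i $ j\<bar> \<le> 2" for i j
    using ab[of i j] a(2) unfolding Aij by (auto split: if_splits)
  have off: "\<bar>A $ i $ j\<bar> \<le> a" if "i \<noteq> j" for i j
    using ab[of i j] that unfolding Aij by simp
  let ?P = "{p. p permutes (UNIV::'m set)}"
  have fin: "finite ?P" by (rule finite_permutations) simp
  have "det A = (\<Sum>p\<in>?P. of_int (sign p) * (\<Prod>i\<in>UNIV. A $ i $ p i))" by (simp add: det_def)
  also have "\<dots> = (\<Prod>i\<in>UNIV. A $ i $ i) + (\<Sum>p\<in>?P - {id}. of_int (sign p) * (\<Prod>i\<in>UNIV. A $ i $ p i))"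
    using fin by (subst sum.remove[of _ id]) (auto simp: permutes_id)
  finally have det: "det A = \<dots>" .
  have "1 + (\<Sum>i\<in>UNIV. a * B $ i $ i) \<le> (\<Prod>i\<in>UNIV. 1 + a * B $ i $ i)"
    using a diag by (intro prod_one_plus_ge) auto
  then have 1: "1 + a * trace B \<le> (\<Prod>i\<in>UNIV. A $ i $ i)"
    by (simp add: trace_def sum_distrib_left Aij)
  have "\<bar>\<Sum>p\<in>?P - {id}. of_int (sign p) * (\<Prod>i\<in>UNIV. A $ i $ p i)\<bar>
      \<le> (\<Sum>p\<in>?P - {id}. \<bar>of_int (sign p) * (\<Prod>i\<in>UNIV. A $ i $ p i)\<bar>)" by (rule sum_abs)
  also have "\<dots> \<le> (\<Sum>p\<in>?P - {id}. a\<^sup>2 * 2 ^ CARD('m))"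
  proof (rule sum_mono)
    fix p assume "p \<in> ?P - {id}"
    then show "\<bar>of_int (sign p) * (\<Prod>i\<in>UNIV. A $ i $ p i)\<bar> \<le> a\<^sup>2 * 2 ^ CARD('m)"
      using prod_perturbed_offdiag[of p "\<lambda>i j. A $ i $ j" a] two off
      by (simp add: abs_mult sign_def)
  qed
  also have "\<dots> \<le> (\<Sum>p\<in>?P. a\<^sup>2 * 2 ^ CARD('m))" by (rule sum_mono2) (use fin in auto)
  also have "\<dots> = fact CARD('m) * 2 ^ CARD('m) * a\<^sup>2"
    by (simp add: card_permutations)
  finally show ?thesis using 1 det unfolding A_def by linarith
qed

text \<open>
  The left integrals are over the completed measure because the determinant of the derivative is
  only known to be Lebesgue measurable.
\<close>

lemma integral_change_of_variables_bij:
  fixes F :: "real^'m::{finite,wellorder} \<Rightarrow> real" and S :: "real^'m::_ \<Rightarrow> real^'m::_"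
  assumes der: "\<And>x. (S has_derivative S' x) (at x)" and bij: "bij S" and F: "integrable lborel F"
  shows "integrable lebesgue (\<lambda>x. \<bar>det (matrix (S' x))\<bar> * F (S x))"
    and "(\<integral>x. \<bar>det (matrix (S' x))\<bar> * F (S x) \<partial>lebesgue) = (\<integral>y. F y \<partial>lborel)"
proof -
  let ?lift = "vec :: real \<Rightarrow> real^1"
  let ?q = "\<lambda>x. \<bar>det (matrix (S' x))\<bar> * F (S x)"
  have *: "(\<lambda>x. \<bar>det (matrix (S' x))\<bar> *\<^sub>R ?lift (F (S x))) absolutely_integrable_on UNIV \<and>
     integral UNIV (\<lambda>x. \<bar>det (matrix (S' x))\<bar> *\<^sub>R ?lift (F (S x))) = b
     \<longleftrightarrow> (\<lambda>y. ?lift (F y)) absolutely_integrable_on (S ` UNIV) \<and> integral (S ` UNIV) (\<lambda>y. ?lift (F y)) = b" for b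
    by (rule has_absolute_integral_change_of_variables) (use der bij in \<open>auto simp: bij_def\<close>)
  have range: "S ` UNIV = UNIV" using bij by (simp add: bij_def)
  have abs: "F absolutely_integrable_on UNIV"
    using F by (simp add: set_integrable_def integrable_completion borel_measurable_integrable)
  have Fint: "integral UNIV F = (\<integral>y. F y \<partial>lborel)"
    using integral_lborel[of F] F by (simp add: integral_lborel)
  have "(\<lambda>y. ?lift (F y)) absolutely_integrable_on UNIV"
    using abs by (simp add: absolutely_integrable_on_1_iff)
  then have "(\<lambda>x. \<bar>det (matrix (S' x))\<bar> *\<^sub>R ?lift (F (S x))) absolutely_integrable_on UNIV \<and>
     integral UNIV (\<lambda>x. \<bar>det (matrix (S' x))\<bar> *\<^sub>R ?lift (F (S x))) = integral UNIV (\<lambda>y. ?lift (F y))"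
    using * unfolding range by blast
  then have q: "?q absolutely_integrable_on UNIV" and qi: "integral UNIV ?q = integral UNIV F"
    using abs unfolding absolutely_integrable_on_1_iff
    by (auto simp: integral_on_1_eq set_lebesgue_integral_eq_integral)
  show i: "integrable lebesgue ?q" using q by (simp add: set_integrable_def)
  show "(\<integral>x. ?q x \<partial>lebesgue) = (\<integral>y. F y \<partial>lborel)"
    using set_lebesgue_integral_eq_integral(2)[OF q] qi Fint by (simp add: set_lebesgue_integral_def)
qed

section \<open>Mass and second moment of the heat flow\<close>

lemma nn_integral_heat_kernel:
  assumes "t > 0"
  shows "(\<integral>\<^sup>+u. ennreal (heat_kernel t (u::'a::euclidean_space)) \<partial>lborel) = 1"
proof -
  have eq: "heat_kernel t u = (\<Prod>b\<in>Basis. normal_density 0 (sqrt t) (u \<bullet> b))" for u :: 'a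
  proof -
    have "(\<Prod>b\<in>Basis. normal_density 0 (sqrt t) (u \<bullet> b))
       = (\<Prod>b\<in>(Basis::'a set). 1 / sqrt (2 * pi * t)) * exp (\<Sum>b\<in>Basis. - (u \<bullet> b)\<^sup>2 / (2 * t))"
      using assms by (simp add: normal_density_def prod.distrib exp_sum real_sqrt_pow2 prod_dividef power_one_over)
    also have "(\<Sum>b\<in>Basis. - (u \<bullet> b)\<^sup>2 / (2 * t)) = - (norm u)\<^sup>2 / (2 * t)"
      unfolding power2_norm_eq_inner euclidean_inner[of u u]
      by (simp add: sum_negf sum_divide_distrib power2_eq_square)
    finally show ?thesis by (simp add: heat_kernel_def power_one_over)
  qed
  have "(\<integral>\<^sup>+u. ennreal (heat_kernel t (u::'a)) \<partial>lborel)
     = (\<integral>\<^sup>+u. (\<Prod>b\<in>Basis. ennreal (normal_density 0 (sqrt t) (u \<bullet> b))) \<partial>(lborel::'a measure))"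
    unfolding eq by (simp add: prod_ennreal)
  also have "\<dots> = (\<Prod>b\<in>(Basis::'a set). (\<integral>\<^sup>+x. ennreal (normal_density 0 (sqrt t) x) \<partial>lborel))"
    by (rule nn_integral_lborel_prod) auto
  also have "(\<integral>\<^sup>+x. ennreal (normal_density 0 (sqrt t) x) \<partial>lborel) = 1"
    using assms by (subst nn_integral_eq_integral) (auto intro: integrable_normal_density)
  finally show ?thesis by simp
qed

lemma measurable_heat_flow [measurable]:
  fixes \<mu> :: "'a::euclidean_space measure"
  assumes "prob_space \<mu>" and s: "sets \<mu> = sets borel"
  shows "heat_flow \<mu> t \<in> borel_measurable borel"
proof -
  interpret prob_space \<mu> by fact
  have [measurable_cong]: "sets \<mu> = sets borel" by fact
  show ?thesis unfolding heat_flow_def[abs_def] by measurable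
qed

lemma nn_integral_heat_flow_mult:
  fixes \<mu> :: "'a::euclidean_space measure"
  assumes \<mu>: "prob_space \<mu>" "sets \<mu> = sets borel" and t: "t > 0"
    and [measurable]: "f \<in> borel_measurable borel"
  shows "(\<integral>\<^sup>+x. ennreal (heat_flow \<mu> t x) * f x \<partial>lborel)
    = (\<integral>\<^sup>+z. (\<integral>\<^sup>+u. ennreal (heat_kernel t u) * f (z + u) \<partial>lborel) \<partial>\<mu>)"
proof -
  interpret prob_space \<mu> by fact
  have [measurable_cong]: "sets \<mu> = sets borel" by fact
  interpret pair_sigma_finite \<mu> lborel ..
  have "(\<integral>\<^sup>+x. ennreal (heat_flow \<mu> t x) * f x \<partial>lborel)
     = (\<integral>\<^sup>+x. (\<integral>\<^sup>+z. ennreal (heat_kernel t (x - z)) * f x \<partial>\<mu>) \<partial>lborel)"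
  proof (rule nn_integral_cong)
    fix x
    have "ennreal (heat_flow \<mu> t x) = (\<integral>\<^sup>+z. ennreal (heat_kernel t (x - z)) \<partial>\<mu>)"
      unfolding heat_flow_def
      by (rule nn_integral_eq_integral[symmetric, OF integrable_heat_kernel[OF \<mu> t]])
         (simp add: heat_kernel_pos t less_imp_le)
    then show "ennreal (heat_flow \<mu> t x) * f x = (\<integral>\<^sup>+z. ennreal (heat_kernel t (x - z)) * f x \<partial>\<mu>)"
      by (simp add: nn_integral_multc)
  qed
  also have "\<dots> = (\<integral>\<^sup>+z. (\<integral>\<^sup>+x. ennreal (heat_kernel t (x - z)) * f x \<partial>lborel) \<partial>\<mu>)"
    by (rule Fubini') measurable
  also have "\<dots> = (\<integral>\<^sup>+z. (\<integral>\<^sup>+u. ennreal (heat_kernel t u) * f (z + u) \<partial>lborel) \<partial>\<mu>)"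
  proof (rule nn_integral_cong)
    fix z
    have "(\<integral>\<^sup>+x. ennreal (heat_kernel t (x - z)) * f x \<partial>lborel)
      = (\<integral>\<^sup>+x. ennreal (heat_kernel t (x - z)) * f x \<partial>distr lborel borel ((+) z))"
      by (simp add: lborel_distr_plus)
    also have "\<dots> = (\<integral>\<^sup>+u. ennreal (heat_kernel t u) * f (z + u) \<partial>lborel)"
      by (subst nn_integral_distr) auto
    finally show "(\<integral>\<^sup>+x. ennreal (heat_kernel t (x - z)) * f x \<partial>lborel)
      = (\<integral>\<^sup>+u. ennreal (heat_kernel t u) * f (z + u) \<partial>lborel)" .
  qed
  finally show ?thesis .
qed

lemma nn_integral_heat_flow:
  fixes \<mu> :: "'a::euclidean_space measure"
  assumes \<mu>: "prob_space \<mu>" "sets \<mu> = sets borel" and t: "t > 0"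
  shows "(\<integral>\<^sup>+x. ennreal (heat_flow \<mu> t x) \<partial>lborel) = 1"
  using nn_integral_heat_flow_mult[OF assms, of "\<lambda>_. 1"] prob_space.emeasure_space_1[OF \<mu>(1)]
  by (simp add: nn_integral_heat_kernel[OF t])

lemma has_bochner_integral_heat_flow:
  fixes \<mu> :: "'a::euclidean_space measure"
  assumes \<mu>: "prob_space \<mu>" "sets \<mu> = sets borel" and t: "t > 0"
  shows "integrable lborel (heat_flow \<mu> t)" "(\<integral>x. heat_flow \<mu> t x \<partial>lborel) = 1"
proof -
  have "has_bochner_integral lborel (heat_flow \<mu> t) 1"
    using nn_integral_heat_flow[OF assms] measurable_heat_flow[OF \<mu>, of t] less_imp_le[OF heat_flow_pos[OF assms]]
    by (intro has_bochner_integral_nn_integral) auto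
  then show "integrable lborel (heat_flow \<mu> t)" "(\<integral>x. heat_flow \<mu> t x \<partial>lborel) = 1"
    by (auto simp: has_bochner_integral_iff)
qed

lemma integrable_heat_flow_mult:
  fixes \<mu> :: "'a::euclidean_space measure" and f :: "'a \<Rightarrow> real"
  assumes \<mu>: "prob_space \<mu>" "sets \<mu> = sets borel" and t: "t > 0"
    and f: "f \<in> borel_measurable borel" "\<And>x. \<bar>f x\<bar> \<le> B"
  shows "integrable lborel (\<lambda>x. f x * heat_flow \<mu> t x)"
proof (rule Bochner_Integration.integrable_bound[of lborel "\<lambda>x. B * heat_flow \<mu> t x"])
  show "AE x in lborel. norm (f x * heat_flow \<mu> t x) \<le> norm (B * heat_flow \<mu> t x)"
  proof (rule AE_I2)
    fix x show "norm (f x * heat_flow \<mu> t x) \<le> norm (B * heat_flow \<mu> t x)"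
      using f(2)[of x] heat_flow_pos[OF \<mu> t, of x] by (auto simp: abs_mult intro!: mult_right_mono)
  qed
qed (use has_bochner_integral_heat_flow[OF \<mu> t] f(1) measurable_heat_flow[OF \<mu>, of t] in auto)

text \<open>
  A Gaussian of twice the variance dominates the second moment integrand. Its total mass is known,
  which bounds second moments by a multiple of \<open>t\<close> without computing them.
\<close>

lemma norm_sq_heat_kernel_le_wider:
  fixes u :: "'a::euclidean_space"
  assumes t: "t > 0"
  shows "(norm u)\<^sup>2 / t * heat_kernel t u \<le> 4 * sqrt 2 ^ DIM('a) * heat_kernel (2 * t) u"
proof -
  define s where "s = (norm u)\<^sup>2 / (4 * t)"
  have s: "(norm u)\<^sup>2 / t = 4 * s" "- (norm u)\<^sup>2 / (2 * t) = - s + - s" "- (norm u)\<^sup>2 / (2 * (2 * t)) = - s"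
    using t by (auto simp: s_def)
  have "s * exp (- s) \<le> 1"
    using exp_ge_add_one_self[of s] by (simp add: exp_minus field_simps del: exp_ge_add_one_self)
  then have le: "4 * s * (exp (- s) * exp (- s)) \<le> 4 * exp (- s)"
    using mult_right_mono[of "s * exp (- s)" 1 "exp (- s)"] by simp
  have sq: "sqrt (2 * pi * (2 * t)) = sqrt 2 * sqrt (2 * pi * t)" by (simp flip: real_sqrt_mult add: ac_simps)
  have pos: "sqrt (2 * pi * t) ^ DIM('a) > 0" using t by simp
  have "(norm u)\<^sup>2 / t * heat_kernel t u = 4 * s * (exp (- s) * exp (- s)) / sqrt (2 * pi * t) ^ DIM('a)"
    unfolding heat_kernel_def s exp_add by simp
  also have "\<dots> \<le> 4 * exp (- s) / sqrt (2 * pi * t) ^ DIM('a)"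
    using le pos by (intro divide_right_mono) auto
  also have "\<dots> = 4 * sqrt 2 ^ DIM('a) * heat_kernel (2 * t) u"
    unfolding heat_kernel_def s sq by (simp add: power_mult_distrib)
  finally show ?thesis .
qed

section \<open>One backward step\<close>

context log_concave_smoothing
begin

text \<open>
  The squared length of the drift is at most the conditional second moment of \<open>x - X\<close>, since their nonnegative
  difference is the trace of the covariance.
\<close>

lemma drift_energy:
  "p x * ((norm (drift x))\<^sup>2 / t) \<le> 4 * sqrt 2 ^ DIM('a) * heat_flow \<mu> (2 * t) x"
proof -
  have "(norm (drift x))\<^sup>2 \<le> (\<integral>z. (norm (x - z))\<^sup>2 \<partial>posterior x)"
    using sum_cov_Basis[of x] sum_nonneg[of Basis "\<lambda>b. cov x b b"] cov_nonneg[of x] by simp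
  then have "p x * ((norm (drift x))\<^sup>2 / t) \<le> p x * ((\<integral>z. (norm (x - z))\<^sup>2 \<partial>posterior x) / t)"
    using p_pos[of x] t_pos by (intro mult_left_mono divide_right_mono) auto
  also have "\<dots> = (\<integral>z. heat_kernel t (x - z) * (norm (x - z))\<^sup>2 \<partial>\<mu>) / t"
    using p_pos[of x] by (subst integral_posterior) auto
  also have "\<dots> = (\<integral>z. (norm (x - z))\<^sup>2 / t * heat_kernel t (x - z) \<partial>\<mu>)"
    by (subst integral_divide_zero[symmetric]) (simp add: mult.commute)
  also have "\<dots> \<le> (\<integral>z. 4 * sqrt 2 ^ DIM('a) * heat_kernel (2 * t) (x - z) \<partial>\<mu>)"
  proof (rule integral_mono)
    have "integrable \<mu> (\<lambda>z. heat_kernel t (x - z) *\<^sub>R (norm (x - z))\<^sup>2)"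
      using integrable_posterior_norm_sq[of x] by (subst (asm) integrable_posterior_iff) auto
    then have "integrable \<mu> (\<lambda>z. (1 / t) * (heat_kernel t (x - z) *\<^sub>R (norm (x - z))\<^sup>2))"
      by (rule integrable_mult_right)
    then show "integrable \<mu> (\<lambda>z. (norm (x - z))\<^sup>2 / t * heat_kernel t (x - z))"
      by (simp add: mult.commute)
    show "integrable \<mu> (\<lambda>z. 4 * sqrt 2 ^ DIM('a) * heat_kernel (2 * t) (x - z))"
      using t_pos by (intro integrable_mult_right integrable_heat_kernel[OF prob_space_\<mu> sets_\<mu>]) auto
  qed (rule norm_sq_heat_kernel_le_wider[OF t_pos])
  also have "\<dots> = 4 * sqrt 2 ^ DIM('a) * heat_flow \<mu> (2 * t) x"
    by (simp add: heat_flow_def)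
  finally show ?thesis .
qed

end

text \<open>
  The first order terms of \<open>exp (- A)\<close> and \<open>1 + A\<close> cancel. The bound also holds when \<open>1 + A - k\<close> is
  negative, so that the step size need not be small.
\<close>

lemma second_order_lower_bound:
  fixes A k r :: real
  assumes "0 \<le> A" "0 \<le> k" "0 \<le> r"
  shows "1 - A\<^sup>2 - k - r \<le> exp (- A - r) * (1 + A - k)"
proof -
  define X where "X = exp (- A) * (1 + A - k)"
  have "(1 - A) * (1 + A) \<le> exp (- A) * (1 + A)"
    using exp_ge_add_one_self[of "- A"] assms by (intro mult_right_mono) auto
  moreover have "exp (- A) * k \<le> k" using assms by (intro mult_left_le_one_le) auto
  ultimately have X1: "1 - A\<^sup>2 - k \<le> X" unfolding X_def by (simp add: algebra_simps power2_eq_square)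
  have "exp (- A) * (1 + A - k) \<le> exp (- A) * exp A"
    using exp_ge_add_one_self[of A] assms by (intro mult_left_mono) (linarith, simp)
  then have X2: "X \<le> 1" unfolding X_def by (simp flip: exp_add)
  have "X - r \<le> exp (- r) * X"
  proof (cases "X \<ge> 0")
    case True
    have "(1 - r) * X \<le> exp (- r) * X"
      using exp_ge_add_one_self[of "- r"] True by (intro mult_right_mono) auto
    moreover have "r * X \<le> r" using X2 assms True by (intro mult_right_le_one_le) auto
    ultimately show ?thesis by (simp add: algebra_simps)
  next
    case False
    have "exp (- r) * (- X) \<le> - X" using False assms by (intro mult_left_le_one_le) auto
    then show ?thesis using assms by simp
  qed
  moreover have "exp (- A - r) * (1 + A - k) = exp (- r) * X"
    unfolding X_def by (simp add: exp_diff exp_minus field_simps)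
  ultimately show ?thesis using X1 by linarith
qed

text \<open>
  The summands bound, in this order, the square of the first order term, the permutations other than
  the identity in the determinant, and the trace part of the second order term in
  \<open>heat_flow_spread_ge\<close>; the last summand 1 leaves room for the part of that term which contains the
  drift.
\<close>

definition step_error_pointwise :: "nat \<Rightarrow> real" where
  "step_error_pointwise n = (real n)\<^sup>2 / 4 + fact n * 2 ^ n / 4 + n / 2 + 1"

text \<open>
  The second factor is the integral of \<open>p x + 4 * sqrt 2 ^ n * heat_flow \<mu> (2 * t) x\<close>, which bounds
  the weight \<open>p x * (1 + (norm (drift x))\<^sup>2 / t)\<close> of the pointwise error.
\<close>

definition step_error :: "nat \<Rightarrow> real" where
  "step_error n = step_error_pointwise n * (1 + 4 * sqrt 2 ^ n)"

lemma Basis_eq_range_axis: "(Basis::(real^'m) set) = range (\<lambda>i. axis i 1)"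
  by (auto simp: Basis_vec_def)

lemma inj_axis_1: "inj (\<lambda>i. axis i 1 :: real^'m)"
  by (auto simp: inj_on_def axis_eq_axis)

lemma sum_Basis_axis: "(\<Sum>b\<in>(Basis::(real^'m) set). f b) = (\<Sum>i\<in>UNIV. f (axis i 1))"
  unfolding Basis_eq_range_axis by (subst sum.reindex[OF inj_axis_1]) (simp add: o_def)

lemma prod_Basis_axis: "(\<Prod>b\<in>(Basis::(real^'m) set). f b) = (\<Prod>i\<in>UNIV. f (axis i 1))"
  unfolding Basis_eq_range_axis by (subst prod.reindex[OF inj_axis_1]) (simp add: o_def)

text \<open>
  The Euclidean space is specialised to coordinate vectors, for which determinants are available.
\<close>

locale log_concave_smoothing_cart = log_concave_smoothing \<mu> t
  for \<mu> :: "(real^'m) measure" and t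
begin

text \<open>
  The matrix of the derivative is the identity plus \<open>\<delta> / 2\<close> times a matrix whose diagonal entries lie
  between 0 and 1 by \<open>cov_nonneg\<close> and \<open>cov_le\<close>; the Cauchy-Schwarz type bound \<open>abs_cov_le\<close> controls the
  other entries.
\<close>

lemma det_spread_ge:
  assumes \<delta>: "0 < \<delta>" "\<delta> \<le> 1"
  shows "1 + (\<delta> / 2) * (CARD('m) - normalised_trace x) - fact CARD('m) * 2 ^ CARD('m) * (\<delta> / 2)\<^sup>2
    \<le> det (matrix (spread_derivative \<delta> x))"
proof -
  define e :: "'m \<Rightarrow> real^'m" where "e i = axis i 1" for i
  define B :: "real^'m^'m" where "B = (\<chi> i j. e j \<bullet> e i - cov x (e j) (e i) / t)"
  have ee: "e j \<bullet> e i = (if i = j then 1 else 0)" for i j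
    by (simp add: e_def inner_axis_axis)
  have covd: "0 \<le> cov x (e i) (e i)" "cov x (e i) (e i) \<le> t" for i
    using cov_nonneg[of x "e i"] cov_le[of x "e i"] by (auto simp: ee)
  have mat: "matrix (spread_derivative \<delta> x) = mat 1 + (\<delta> / 2) *\<^sub>R B"
  proof -
    have "spread_derivative \<delta> x (e j) $ i = (if i = j then 1 else 0) + (\<delta> / 2) * B $ i $ j" for i j
    proof -
      have "spread_derivative \<delta> x (e j) $ i = spread_derivative \<delta> x (e j) \<bullet> e i" by (simp add: e_def inner_axis)
      also have "\<dots> = e j \<bullet> e i + (\<delta> / 2) * (e j \<bullet> e i - cov x (e j) (e i) / t)"
        unfolding spread_derivative_def inner_add_left inner_scaleR_left drift_derivative_inner by (rule refl)
      finally show ?thesis by (simp add: B_def ee)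
    qed
    then show ?thesis by (simp add: vec_eq_iff matrix_def mat_def e_def)
  qed
  have diag: "0 \<le> B $ i $ i" for i
    using covd[of i] t_pos by (simp add: B_def ee)
  have bnd: "\<bar>B $ i $ j\<bar> \<le> 1" for i j
  proof (cases "i = j")
    case True
    then show ?thesis using covd[of i] t_pos by (simp add: B_def ee)
  next
    case False
    have "(cov x (e j) (e j) + cov x (e i) (e i)) / 2 \<le> t" using covd(2)[of i] covd(2)[of j] by simp
    then have "\<bar>cov x (e j) (e i)\<bar> \<le> t" using abs_cov_le[of x "e j" "e i"] by (rule order_trans[rotated])
    then show ?thesis using False t_pos by (simp add: B_def ee)
  qed
  have "trace B = CARD('m) - normalised_trace x"
    unfolding trace_def normalised_trace_def sum_Basis_axis
    by (simp add: B_def ee sum_subtractf sum_divide_distrib e_def[symmetric])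
  then show ?thesis
    using det_perturbation_ge[of B "\<delta> / 2", OF diag bnd] \<delta> unfolding mat by simp
qed

text \<open>
  The right hand side is the density, at \<open>x\<close>, of the law that the inverse of \<open>spread \<delta>\<close> makes out of
  \<open>\<mu> * \<gamma>\<^bsub>t (1 + \<delta>)\<^esub>\<close>. Its deviation from \<open>p\<close> is of second order in \<open>\<delta>\<close>.
\<close>

lemma density_spread_ge:
  assumes \<delta>: "0 < \<delta>" "\<delta> \<le> 1"
  shows "p x - step_error_pointwise CARD('m) * \<delta>\<^sup>2 * (p x + 4 * sqrt 2 ^ CARD('m) * heat_flow \<mu> (2 * t) x)
     \<le> \<bar>det (matrix (spread_derivative \<delta> x))\<bar> * heat_flow \<mu> (t * (1 + \<delta>)) (spread \<delta> x)"
proof -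
  define n where "n = CARD('m)"
  define c where "c = normalised_trace x"
  define R where "R = (norm (drift x))\<^sup>2 / t"
  define A where "A = (\<delta> / 2) * (n - c)"
  define k where "k = fact n * 2 ^ n * (\<delta> / 2)\<^sup>2"
  define r where "r = \<delta>\<^sup>2 * (c / 2 + R / 8)"
  define C where "C = step_error_pointwise n"
  have c: "0 \<le> c" "c \<le> n" using normalised_trace_bounds[of x] by (auto simp: c_def n_def)
  have R: "0 \<le> R" using t_pos by (simp add: R_def)
  have A: "0 \<le> A" "A\<^sup>2 \<le> \<delta>\<^sup>2 * ((real n)\<^sup>2 / 4)"
  proof -
    show "0 \<le> A" using c \<delta> by (simp add: A_def)
    have "A \<le> (\<delta> / 2) * n" unfolding A_def using c \<delta> by (intro mult_left_mono) auto
    then have "A\<^sup>2 \<le> ((\<delta> / 2) * n)\<^sup>2" using \<open>0 \<le> A\<close> by (intro power_mono)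
    then show "A\<^sup>2 \<le> \<delta>\<^sup>2 * ((real n)\<^sup>2 / 4)" by (simp add: power_mult_distrib power_divide)
  qed
  have k: "0 \<le> k" "k = \<delta>\<^sup>2 * (fact n * 2 ^ n / 4)" by (simp_all add: k_def power_divide)
  have r: "0 \<le> r" "r \<le> \<delta>\<^sup>2 * (n / 2 + R / 8)"
    unfolding r_def using c R by (auto intro!: mult_left_mono)
  have "1 - C * \<delta>\<^sup>2 * (1 + R) \<le> 1 - A\<^sup>2 - k - r"
  proof -
    have "A\<^sup>2 + k + r \<le> \<delta>\<^sup>2 * ((real n)\<^sup>2 / 4 + fact n * 2 ^ n / 4 + n / 2 + R / 8)"
      using A k r by (simp add: distrib_left)
    also have "\<dots> \<le> \<delta>\<^sup>2 * (C * (1 + R))"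
    proof (rule mult_left_mono)
      have "C \<ge> 1" unfolding C_def step_error_pointwise_def by simp
      then have "R / 8 \<le> C * R" using R mult_right_mono[of 1 C R] by simp
      then show "(real n)\<^sup>2 / 4 + fact n * 2 ^ n / 4 + n / 2 + R / 8 \<le> C * (1 + R)"
        unfolding distrib_left by (simp add: C_def step_error_pointwise_def)
    qed simp
    finally show ?thesis by (simp add: algebra_simps)
  qed
  also have "\<dots> \<le> exp (- A - r) * (1 + A - k)" by (rule second_order_lower_bound[OF A(1) k(1) r(1)])
  also have "\<dots> \<le> exp (- A - r) * \<bar>det (matrix (spread_derivative \<delta> x))\<bar>"
    using det_spread_ge[OF \<delta>, of x] by (intro mult_left_mono) (auto simp: A_def k_def c_def n_def)
  finally have "p x * (1 - C * \<delta>\<^sup>2 * (1 + R)) \<le> p x * (exp (- A - r) * \<bar>det (matrix (spread_derivative \<delta> x))\<bar>)"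
    using p_pos[of x] by (intro mult_left_mono) auto
  also have "\<dots> = \<bar>det (matrix (spread_derivative \<delta> x))\<bar> * (p x * exp (- A - r))" by simp
  also have "\<dots> \<le> \<bar>det (matrix (spread_derivative \<delta> x))\<bar> * heat_flow \<mu> (t * (1 + \<delta>)) (spread \<delta> x)"
  proof (rule mult_left_mono)
    have "- (\<delta> / 2) * (DIM(real^'m) - normalised_trace x)
        - \<delta>\<^sup>2 * (normalised_trace x / 2 + (norm (drift x))\<^sup>2 / (8 * t)) = - A - r"
      unfolding A_def r_def R_def c_def n_def by (simp add: mult.commute)
    then show "p x * exp (- A - r) \<le> heat_flow \<mu> (t * (1 + \<delta>)) (spread \<delta> x)"
      using heat_flow_spread_ge[OF \<delta>(1), of x] by simp
  qed simp
  finally have "p x - C * \<delta>\<^sup>2 * (p x + p x * R) \<le> \<bar>det (matrix (spread_derivative \<delta> x))\<bar> * heat_flow \<mu> (t * (1 + \<delta>)) (spread \<delta> x)"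
    by (simp add: algebra_simps)
  moreover have "C * \<delta>\<^sup>2 * (p x + p x * R) \<le> C * \<delta>\<^sup>2 * (p x + 4 * sqrt 2 ^ n * heat_flow \<mu> (2 * t) x)"
    using drift_energy[of x]
    by (intro mult_left_mono add_left_mono) (auto simp: R_def n_def C_def step_error_pointwise_def)
  ultimately show ?thesis unfolding C_def n_def by linarith
qed

end

lemma contraction_imp_continuous: "contraction T \<Longrightarrow> continuous_on UNIV T"
  unfolding contraction_def continuous_on_iff dist_norm by (meson order_le_less_trans)

text \<open>
  Applied to \<open>f\<close> and to \<open>1 - f\<close>, this one-sided inequality says that \<open>T\<close> carries the law at time
  \<open>t (1 + \<delta>)\<close> to the law at time \<open>t\<close> up to \<open>O(\<delta>\<^sup>2)\<close> in total variation. It holds for all measurable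
  \<open>f\<close>, hence also for compositions with further maps, and this makes the steps composable.
\<close>

lemma reverse_heat_step:
  fixes \<mu> :: "(real^'m::{finite,wellorder}) measure"
  assumes lc: "log_concave_smoothing \<mu> t" and \<delta>: "0 < \<delta>" "\<delta> \<le> 1"
  shows "\<exists>T. contraction T \<and> (\<forall>f. f \<in> borel_measurable borel \<longrightarrow> (\<forall>x. 0 \<le> f x \<and> f x \<le> (1::real)) \<longrightarrow>
       (\<integral>x. f x * heat_flow \<mu> t x \<partial>lborel) - step_error CARD('m) * \<delta>\<^sup>2
         \<le> (\<integral>y. f (T y) * heat_flow \<mu> (t * (1 + \<delta>)) y \<partial>lborel))"
proof -
  interpret log_concave_smoothing \<mu> t by fact
  interpret log_concave_smoothing_cart \<mu> t ..
  define S where "S = spread \<delta>"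
  define T where "T = inv S"
  have bij: "bij S" using bij_spread[of \<delta>] \<delta> by (simp add: S_def)
  have ST: "S (T y) = y" for y unfolding T_def by (rule surj_f_inv_f) (use bij in \<open>simp add: bij_def\<close>)
  have TS: "T (S x) = x" for x unfolding T_def by (rule inv_f_f) (use bij in \<open>simp add: bij_def\<close>)
  have T: "contraction T"
    unfolding contraction_def
  proof (intro allI)
    fix x y show "norm (T x - T y) \<le> norm (x - y)"
      using spread_expands[of \<delta> "T x" "T y"] \<delta> ST unfolding S_def by simp
  qed
  have [measurable]: "T \<in> borel_measurable borel"
    by (intro borel_measurable_continuous_onI contraction_imp_continuous T)
  have der: "(S has_derivative spread_derivative \<delta> x) (at x)" for x
    unfolding S_def by (rule spread_has_derivative)
  have t': "t * (1 + \<delta>) > 0" and t2: "2 * t > 0" using t_pos \<delta> by auto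
  note hf = has_bochner_integral_heat_flow[OF prob_space_\<mu> sets_\<mu>]
  note [measurable] = measurable_heat_flow[OF prob_space_\<mu> sets_\<mu>]
  show ?thesis
  proof (intro exI[of _ T] conjI T allI impI)
    fix f :: "real^'m::_ \<Rightarrow> real" assume [measurable]: "f \<in> borel_measurable borel" and f_all: "\<forall>x. 0 \<le> f x \<and> f x \<le> 1"
    have f: "0 \<le> f x \<and> f x \<le> 1" for x using f_all by blast
    let ?F = "\<lambda>y. f (T y) * heat_flow \<mu> (t * (1 + \<delta>)) y"
    let ?E = "\<lambda>x. step_error_pointwise CARD('m) * \<delta>\<^sup>2 * (p x + 4 * sqrt 2 ^ CARD('m) * heat_flow \<mu> (2 * t) x)"
    let ?G = "\<lambda>x. f x * p x - ?E x"
    have F: "integrable lborel ?F"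
      using f by (intro integrable_heat_flow_mult[OF prob_space_\<mu> sets_\<mu> t', where B=1]) auto
    have E: "integrable lborel ?E"
      using hf(1)[OF t_pos] hf(1)[OF t2] by auto
    have fp: "integrable lborel (\<lambda>x. f x * p x)"
      using f by (intro integrable_heat_flow_mult[OF prob_space_\<mu> sets_\<mu> t_pos, where B=1]) auto
    have G: "integrable lborel ?G" using E fp by (rule Bochner_Integration.integrable_diff[rotated])
    have "(\<integral>x. f x * p x \<partial>lborel) - step_error CARD('m) * \<delta>\<^sup>2 = (\<integral>x. f x * p x \<partial>lborel) - (\<integral>x. ?E x \<partial>lborel)"
      using hf[OF t_pos] hf[OF t2] by (simp add: step_error_def)
    also have "\<dots> = (\<integral>x. ?G x \<partial>lborel)" by (rule Bochner_Integration.integral_diff[symmetric, OF fp E])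
    also have "\<dots> = (\<integral>x. ?G x \<partial>lebesgue)" by (rule integral_completion[symmetric]) measurable
    also have "\<dots> \<le> (\<integral>x. \<bar>det (matrix (spread_derivative \<delta> x))\<bar> * ?F (S x) \<partial>lebesgue)"
    proof (rule integral_mono)
      show "integrable lebesgue ?G" using G by (subst integrable_completion) auto
      show "integrable lebesgue (\<lambda>x. \<bar>det (matrix (spread_derivative \<delta> x))\<bar> * ?F (S x))"
        by (rule integral_change_of_variables_bij(1)[OF der bij F])
      fix x
      have E0: "0 \<le> ?E x"
        using heat_flow_pos[OF prob_space_\<mu> sets_\<mu> t2, of x] p_pos[of x]
        by (intro mult_nonneg_nonneg add_nonneg_nonneg) (auto simp: step_error_pointwise_def)
      \<comment> \<open>The factor \<open>f x\<close> is at most 1, so it may be dropped in front of the error.\<close>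
      have "f x * p x - ?E x \<le> f x * (p x - ?E x)"
        using mult_right_mono[of "f x" 1 "?E x"] f[of x] E0 by (simp only: right_diff_distrib) simp
      also have "\<dots> \<le> f x * (\<bar>det (matrix (spread_derivative \<delta> x))\<bar> * heat_flow \<mu> (t * (1 + \<delta>)) (S x))"
        unfolding S_def using f[of x] by (intro mult_left_mono density_spread_ge[OF \<delta>]) auto
      finally show "?G x \<le> \<bar>det (matrix (spread_derivative \<delta> x))\<bar> * ?F (S x)"
        by (simp add: TS ac_simps)
    qed
    also have "\<dots> = (\<integral>y. ?F y \<partial>lborel)" by (rule integral_change_of_variables_bij(2)[OF der bij F])
    finally show "(\<integral>x. f x * p x \<partial>lborel) - step_error CARD('m) * \<delta>\<^sup>2 \<le> (\<integral>y. ?F y \<partial>lborel)" .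
  qed
qed

section \<open>Iterated backward steps\<close>

lemma contraction_compose: "contraction S \<Longrightarrow> contraction T \<Longrightarrow> contraction (\<lambda>x. S (T x))"
  unfolding contraction_def by (meson order_trans)

lemma contraction_borel_measurable:
  fixes T :: "'a::euclidean_space \<Rightarrow> 'a"
  shows "contraction T \<Longrightarrow> T \<in> borel_measurable borel"
  by (intro borel_measurable_continuous_onI contraction_imp_continuous)

lemma log_concave_measure_smoothing:
  fixes \<mu> :: "'a::euclidean_space measure"
  assumes "prob_space \<mu>" "sets \<mu> = sets borel" "log_concave_measure \<mu>" "t > 0"
  shows "log_concave_smoothing \<mu> t"
proof -
  interpret prob_space \<mu> by fact
  interpret gaussian_smoothing \<mu> t by unfold_locales (use assms in auto)
  show ?thesis by unfold_locales (rule heat_flow_midpoint[OF assms(1-3) t_pos])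
qed

lemma reverse_heat_steps:
  fixes \<mu> :: "(real^'m::{finite,wellorder}) measure"
  assumes \<mu>: "prob_space \<mu>" "sets \<mu> = sets borel" "log_concave_measure \<mu>" and t: "t > 0"
    and \<delta>: "0 < \<delta>" "\<delta> \<le> 1"
  shows "\<exists>T. contraction T \<and> (\<forall>f. f \<in> borel_measurable borel \<longrightarrow> (\<forall>x. 0 \<le> f x \<and> f x \<le> (1::real)) \<longrightarrow>
       (\<integral>x. f x * heat_flow \<mu> t x \<partial>lborel) - N * (step_error CARD('m) * \<delta>\<^sup>2)
         \<le> (\<integral>y. f (T y) * heat_flow \<mu> (t * (1 + \<delta>) ^ N) y \<partial>lborel))"
proof (induction N)
  case 0
  show ?case by (intro exI[of _ "\<lambda>x. x"]) (auto simp: contraction_def)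
next
  case (Suc N)
  let ?s = "t * (1 + \<delta>) ^ N"
  obtain T where T: "contraction T"
    and TN: "\<And>f. f \<in> borel_measurable borel \<Longrightarrow> (\<And>x. 0 \<le> f x \<and> f x \<le> (1::real)) \<Longrightarrow>
       (\<integral>x. f x * heat_flow \<mu> t x \<partial>lborel) - N * (step_error CARD('m) * \<delta>\<^sup>2)
         \<le> (\<integral>y. f (T y) * heat_flow \<mu> ?s y \<partial>lborel)"
    using Suc.IH by blast
  have [measurable]: "T \<in> borel_measurable borel" by (rule contraction_borel_measurable[OF T])
  have "?s > 0" using t \<delta> by simp
  then have lcs: "log_concave_smoothing \<mu> ?s" by (rule log_concave_measure_smoothing[OF \<mu>])
  obtain T' where T': "contraction T'"
    and step: "\<And>f. f \<in> borel_measurable borel \<Longrightarrow> (\<And>x. 0 \<le> f x \<and> f x \<le> (1::real)) \<Longrightarrow>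
       (\<integral>x. f x * heat_flow \<mu> ?s x \<partial>lborel) - step_error CARD('m) * \<delta>\<^sup>2
         \<le> (\<integral>y. f (T' y) * heat_flow \<mu> (?s * (1 + \<delta>)) y \<partial>lborel)"
    using reverse_heat_step[OF lcs \<delta>] by blast
  show ?case
  proof (intro exI[of _ "\<lambda>x. T (T' x)"] conjI allI impI)
    show "contraction (\<lambda>x. T (T' x))" by (rule contraction_compose[OF T T'])
  next
    fix f :: "real^'m::_ \<Rightarrow> real" assume fm [measurable]: "f \<in> borel_measurable borel" and f: "\<forall>x. 0 \<le> f x \<and> f x \<le> 1"
    have "(\<integral>x. f x * heat_flow \<mu> t x \<partial>lborel) - N * (step_error CARD('m) * \<delta>\<^sup>2)
         \<le> (\<integral>y. f (T y) * heat_flow \<mu> ?s y \<partial>lborel)" using TN[OF fm] f by blast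
    moreover have "(\<integral>y. f (T y) * heat_flow \<mu> ?s y \<partial>lborel) - step_error CARD('m) * \<delta>\<^sup>2
         \<le> (\<integral>y. f (T (T' y)) * heat_flow \<mu> (?s * (1 + \<delta>)) y \<partial>lborel)"
    proof (rule step[of "\<lambda>y. f (T y)"])
      show "0 \<le> f (T y) \<and> f (T y) \<le> 1" for y using f by blast
    qed measurable
    moreover have "?s * (1 + \<delta>) = t * (1 + \<delta>) ^ Suc N" by simp
    ultimately show "(\<integral>x. f x * heat_flow \<mu> t x \<partial>lborel) - Suc N * (step_error CARD('m) * \<delta>\<^sup>2)
         \<le> (\<integral>y. f (T (T' y)) * heat_flow \<mu> (t * (1 + \<delta>) ^ Suc N) y \<partial>lborel)"
      by (simp only:) (simp add: algebra_simps)
  qed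
qed

section \<open>Lipschitz test functions\<close>

text \<open>
  The Gaussian noise displaces by \<open>O(sqrt t)\<close> in mean. The displacement is compared with the second
  moment by \<open>norm u \<le> sqrt t * (1/2 + (norm u)\<^sup>2 / (2 * t))\<close>.
\<close>

lemma integral_le_heat_flow:
  fixes \<mu> :: "'a::euclidean_space measure" and f :: "'a \<Rightarrow> real"
  assumes \<mu>: "prob_space \<mu>" "sets \<mu> = sets borel" and t: "t > 0"
    and f: "\<And>x. 0 \<le> f x \<and> f x \<le> 1" and L: "0 \<le> L" "\<And>x y. \<bar>f x - f y\<bar> \<le> L * norm (x - y)"
  shows "(\<integral>z. f z \<partial>\<mu>) \<le> (\<integral>x. f x * heat_flow \<mu> t x \<partial>lborel) + L * (1/2 + 2 * sqrt 2 ^ DIM('a)) * sqrt t"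
proof -
  interpret prob_space \<mu> by fact
  have [measurable_cong]: "sets \<mu> = sets borel" by fact
  have "continuous_on UNIV f"
    using L by (intro lipschitz_on_continuous_on[of L]) (auto simp: lipschitz_on_def dist_norm)
  then have [measurable]: "f \<in> borel_measurable borel" by (rule borel_measurable_continuous_onI)
  define c where "c = L * (1/2 + 2 * sqrt 2 ^ DIM('a)) * sqrt t"
  have c0: "0 \<le> c" using L t by (simp add: c_def)
  have s0: "0 < sqrt t" "sqrt t * sqrt t = t" using t by auto
  have hk0: "0 \<le> heat_kernel t u" "0 \<le> heat_kernel (2 * t) u" for u :: 'a
    using heat_kernel_pos[OF t, of u] heat_kernel_pos[of "2 * t" u] t by auto
  have nlin: "norm u \<le> sqrt t * (1/2 + (norm u)\<^sup>2 / (2 * t))" for u :: 'a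
  proof -
    define v where "v = norm u / sqrt t"
    have v: "norm u = sqrt t * v" "(norm u)\<^sup>2 / t = v\<^sup>2"
      using t by (auto simp: v_def power_divide)
    have "v \<le> 1/2 + v\<^sup>2 / 2" using zero_le_power2[of "v - 1"] by (simp add: power2_diff)
    then have "sqrt t * v \<le> sqrt t * (1/2 + v\<^sup>2 / 2)" using s0 by (intro mult_left_mono) auto
    moreover have "(norm u)\<^sup>2 / (2 * t) = v\<^sup>2 / 2" unfolding v(2)[symmetric] by simp
    ultimately show ?thesis by (simp only: v(1)[symmetric])
  qed
  have pt: "heat_kernel t u * f z \<le> heat_kernel t u * f (z + u)
      + L * sqrt t * (heat_kernel t u / 2 + 2 * sqrt 2 ^ DIM('a) * heat_kernel (2 * t) u)" for u z
  proof -
    have "f z \<le> f (z + u) + L * norm u" using L(2)[of z "z + u"] by simp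
    also have "\<dots> \<le> f (z + u) + L * (sqrt t * (1/2 + (norm u)\<^sup>2 / (2 * t)))"
      using L(1) by (intro add_left_mono mult_left_mono nlin)
    finally have "heat_kernel t u * f z \<le> heat_kernel t u * (f (z + u) + L * (sqrt t * (1/2 + (norm u)\<^sup>2 / (2 * t))))"
      by (intro mult_left_mono hk0)
    also have "\<dots> = heat_kernel t u * f (z + u) + L * sqrt t * (heat_kernel t u / 2 + (1/2) * ((norm u)\<^sup>2 / t * heat_kernel t u))"
      by (simp add: algebra_simps)
    also have "\<dots> \<le> heat_kernel t u * f (z + u) + L * sqrt t * (heat_kernel t u / 2 + (1/2) * (4 * sqrt 2 ^ DIM('a) * heat_kernel (2 * t) u))"
      using L(1) t by (intro add_left_mono mult_left_mono norm_sq_heat_kernel_le_wider) auto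
    finally show ?thesis by (simp add: ac_simps)
  qed
  define q s k where "q = (1/2 :: real)" and "s = 2 * sqrt 2 ^ DIM('a)" and "k = L * sqrt t"
  have qsk: "0 \<le> q" "0 \<le> s" "0 \<le> k" and c_eq: "c = k * (q + s)"
    using L(1) s0 by (auto simp: q_def s_def k_def c_def)
  have inner: "ennreal (f z) \<le> (\<integral>\<^sup>+u. ennreal (heat_kernel t u) * ennreal (f (z + u)) \<partial>lborel) + ennreal c" for z
  proof -
    have "ennreal (f z) = (\<integral>\<^sup>+u. ennreal (heat_kernel t u) * ennreal (f z) \<partial>(lborel::'a measure))"
      by (simp add: nn_integral_multc nn_integral_heat_kernel[OF t])
    also have "\<dots> \<le> (\<integral>\<^sup>+u. ennreal (heat_kernel t u) * ennreal (f (z + u))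
       + ennreal k * (ennreal q * ennreal (heat_kernel t u) + ennreal s * ennreal (heat_kernel (2 * t) u)) \<partial>(lborel::'a measure))"
    proof (rule nn_integral_mono)
      fix u :: 'a
      have "ennreal (heat_kernel t u * f z) \<le> ennreal (heat_kernel t u * f (z + u)
        + k * (q * heat_kernel t u + s * heat_kernel (2 * t) u))"
        using pt[of u z] by (intro ennreal_leI) (simp add: q_def s_def k_def)
      also have "\<dots> = ennreal (heat_kernel t u) * ennreal (f (z + u))
       + ennreal k * (ennreal q * ennreal (heat_kernel t u) + ennreal s * ennreal (heat_kernel (2 * t) u))"
        using hk0[of u] f[of "z + u"] qsk by (simp add: ennreal_mult)
      finally show "ennreal (heat_kernel t u) * ennreal (f z) \<le> \<dots>"
        using hk0[of u] f[of z] by (simp add: ennreal_mult)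
    qed
    also have "\<dots> = (\<integral>\<^sup>+u. ennreal (heat_kernel t u) * ennreal (f (z + u)) \<partial>lborel)
       + ennreal k * (ennreal q + ennreal s)"
      using t by (simp add: nn_integral_add nn_integral_cmult nn_integral_heat_kernel)
    also have "ennreal k * (ennreal q + ennreal s) = ennreal c"
      using qsk by (simp add: c_eq ennreal_mult)
    finally show ?thesis .
  qed
  have fh0: "0 \<le> f x * heat_flow \<mu> t x" for x
    using f[of x] heat_flow_pos[OF \<mu> t, of x] by simp
  have fhf: "integrable lborel (\<lambda>x. f x * heat_flow \<mu> t x)"
    by (rule integrable_heat_flow_mult[OF \<mu> t, where B=1]) (use f in auto)
  have fint: "integrable \<mu> f" by (rule integrable_const_bound[where B=1]) (use f in auto)
  have "ennreal (\<integral>z. f z \<partial>\<mu>) = (\<integral>\<^sup>+z. ennreal (f z) \<partial>\<mu>)"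
    by (rule nn_integral_eq_integral[symmetric]) (use f fint in auto)
  also have "\<dots> \<le> (\<integral>\<^sup>+z. (\<integral>\<^sup>+u. ennreal (heat_kernel t u) * ennreal (f (z + u)) \<partial>lborel) + ennreal c \<partial>\<mu>)"
    by (intro nn_integral_mono inner)
  also have "\<dots> = (\<integral>\<^sup>+x. ennreal (heat_flow \<mu> t x) * ennreal (f x) \<partial>lborel) + ennreal c"
    by (subst nn_integral_add) (auto simp: nn_integral_heat_flow_mult[OF \<mu> t] emeasure_space_1)
  also have "(\<integral>\<^sup>+x. ennreal (heat_flow \<mu> t x) * ennreal (f x) \<partial>lborel) = (\<integral>\<^sup>+x. ennreal (f x * heat_flow \<mu> t x) \<partial>lborel)"
    by (intro nn_integral_cong) (use f heat_flow_pos[OF \<mu> t] in \<open>simp add: ennreal_mult'' less_imp_le mult.commute\<close>)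
  also have "\<dots> = ennreal (\<integral>x. f x * heat_flow \<mu> t x \<partial>lborel)"
    by (rule nn_integral_eq_integral[OF fhf]) (simp add: fh0)
  finally have *: "ennreal (\<integral>z. f z \<partial>\<mu>) \<le> ennreal (\<integral>x. f x * heat_flow \<mu> t x \<partial>lborel) + ennreal c" .
  have I0: "0 \<le> (\<integral>x. f x * heat_flow \<mu> t x \<partial>lborel)"
    by (rule integral_nonneg_AE) (simp add: fh0)
  have "ennreal (\<integral>z. f z \<partial>\<mu>) \<le> ennreal ((\<integral>x. f x * heat_flow \<mu> t x \<partial>lborel) + c)"
    using * I0 c0 by simp
  then show ?thesis
    unfolding c_def[symmetric] using I0 c0 by (subst (asm) ennreal_le_iff) auto
qed

lemma infdist_cutoff_lipschitz:
  fixes C :: "'a::real_normed_vector set"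
  assumes "0 \<le> k" "C \<noteq> {}"
  shows "\<bar>max 0 (1 - k * infdist x C) - max 0 (1 - k * infdist y C)\<bar> \<le> k * norm (x - y)"
proof -
  have "\<bar>infdist x C - infdist y C\<bar> \<le> norm (x - y)"
    using infdist_triangle_abs[of x C y] by (simp add: dist_norm)
  then have "k * \<bar>infdist x C - infdist y C\<bar> \<le> k * norm (x - y)" using assms by (intro mult_left_mono)
  moreover have "k * \<bar>infdist x C - infdist y C\<bar> = \<bar>k * infdist x C - k * infdist y C\<bar>"
    using assms by (simp add: abs_mult flip: right_diff_distrib)
  ultimately show ?thesis by linarith
qed

text \<open>
  Indicators of closed sets are decreasing limits of Lipschitz functions with values between 0 and 1,
  and the closed sets are an intersection-stable generator of the Borel sets.
\<close>

lemma measure_eqI_lipschitz: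
  fixes M N :: "'a::euclidean_space measure"
  assumes M: "prob_space M" "sets M = sets borel" and N: "prob_space N" "sets N = sets borel"
    and eq: "\<And>f L. (\<And>x. 0 \<le> f x \<and> f x \<le> (1::real)) \<Longrightarrow> 0 \<le> L \<Longrightarrow>
       (\<And>x y. \<bar>f x - f y\<bar> \<le> L * norm (x - y)) \<Longrightarrow> (\<integral>x. f x \<partial>M) = (\<integral>x. f x \<partial>N)"
  shows "M = N"
proof -
  have closed_eq: "emeasure M C = emeasure N C" if C: "closed C" for C
  proof (cases "C = {}")
    case False
    define f where "f k x = max 0 (1 - real k * infdist x C)" for k x
    have mf: "f k \<in> borel_measurable borel" for k
      unfolding f_def by (intro borel_measurable_continuous_onI continuous_intros)
    have f01: "0 \<le> f k x \<and> f k x \<le> 1" for k x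
      unfolding f_def using infdist_nonneg[of x C] by simp
    have lim: "(\<lambda>k. f k x) \<longlonglongrightarrow> indicator C x" for x
    proof (cases "x \<in> C")
      case True
      then have "f k x = 1" for k by (simp add: f_def)
      then show ?thesis using True by simp
    next
      case False
      then have pos: "infdist x C > 0"
        using C \<open>C \<noteq> {}\<close> by (metis in_closed_iff_infdist_zero infdist_nonneg less_eq_real_def)
      obtain K :: nat where K: "1 / infdist x C < K" using reals_Archimedean2 by blast
      have "f k x = 0" if "k \<ge> K" for k
      proof -
        have "1 / infdist x C < k" using K that by (meson of_nat_le_iff order_less_le_trans)
        then have "1 < k * infdist x C" using pos by (simp add: field_simps)
        then show ?thesis by (simp add: f_def)
      qed
      then have "\<forall>\<^sub>F k in sequentially. f k x = 0" by (auto simp: eventually_sequentially)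
      then show ?thesis using False by (simp add: tendsto_eventually)
    qed
    have conv: "(\<lambda>k. \<integral>x. f k x \<partial>Q) \<longlonglongrightarrow> measure Q C" if Q: "prob_space Q" "sets Q = sets borel" for Q
    proof -
      interpret Q: prob_space Q by fact
      have [measurable_cong]: "sets Q = sets borel" by fact
      note [measurable] = mf
      have [measurable]: "C \<in> sets borel" using C by simp
      have "(\<lambda>k. \<integral>x. f k x \<partial>Q) \<longlonglongrightarrow> (\<integral>x. indicator C x \<partial>Q)"
        by (rule integral_dominated_convergence[where w="\<lambda>_. 1"]) (use f01 lim C in auto)
      moreover have "space Q = UNIV" using sets_eq_imp_space_eq[OF Q(2)] by simp
      ultimately show ?thesis by simp
    qed
    have "(\<integral>x. f k x \<partial>M) = (\<integral>x. f k x \<partial>N)" for k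
      unfolding f_def using f01[of k] False
      by (intro eq[of _ "real k"] infdist_cutoff_lipschitz) (auto simp: f_def)
    then have "measure M C = measure N C"
      using conv[OF M] conv[OF N] by (auto intro: LIMSEQ_unique)
    then show ?thesis
      using M(1) N(1) by (simp add: prob_space_def finite_measure.emeasure_eq_measure)
  qed simp
  show ?thesis
  proof (rule measure_eqI_generator_eq[where E="Collect closed" and \<Omega>=UNIV and A="\<lambda>_. UNIV"])
    show "Int_stable (Collect closed)" by (auto simp: Int_stable_def)
    have "sets (borel :: 'a measure) = sigma_sets UNIV (Collect closed)" by (simp add: borel_eq_closed)
    then show "sets M = sigma_sets UNIV (Collect closed)" "sets N = sigma_sets UNIV (Collect closed)"
      using M(2) N(2) by auto
    show "emeasure M UNIV \<noteq> \<infinity>"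
      using M(1) by (simp add: prob_space_def finite_measure.emeasure_finite)
  qed (use closed_eq in auto)
qed

lemma prob_space_large_ball:
  fixes Q :: "'a::euclidean_space measure"
  assumes Q: "prob_space Q" "sets Q = sets borel" and "b < 1"
  shows "\<exists>R. \<forall>r\<ge>R. measure Q (cball 0 r) > b"
proof -
  interpret prob_space Q by fact
  have sp: "space Q = UNIV" using sets_eq_imp_space_eq[OF Q(2)] by simp
  have "(\<lambda>n. measure Q (cball 0 (real n))) \<longlonglongrightarrow> measure Q (\<Union>n. cball 0 (real n))"
  proof (rule finite_Lim_measure_incseq)
    show "range (\<lambda>n. cball 0 (real n)) \<subseteq> events" by (simp add: Q(2) image_subset_iff)
    show "incseq (\<lambda>n. cball (0::'a) (real n))"
      unfolding incseq_def by (intro allI impI subset_cball) simp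
  qed
  moreover have "(\<Union>n. cball 0 (real n)) = (UNIV :: 'a set)"
    using real_arch_simple by auto
  ultimately have "(\<lambda>n. measure Q (cball 0 (real n))) \<longlonglongrightarrow> 1" using prob_space sp by simp
  then have "\<forall>\<^sub>F n in sequentially. measure Q (cball 0 (real n)) > b" using \<open>b < 1\<close> by (rule order_tendstoD)
  then obtain n :: nat where n: "measure Q (cball 0 (real n)) > b" by (auto simp: eventually_sequentially)
  have "measure Q (cball 0 r) > b" if "r \<ge> real n" for r
  proof -
    have "measure Q (cball 0 (real n)) \<le> measure Q (cball 0 r)"
      using that Q(2) by (intro finite_measure_mono) auto
    then show ?thesis using n by simp
  qed
  then show ?thesis by blast
qed

section \<open>Limits of contractions\<close>

text \<open>
  A diagonal sequence converges on a countable dense set, and equicontinuity extends the convergence to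
  all points.
\<close>

lemma contractions_convergent_subsequence:
  fixes T :: "nat \<Rightarrow> 'a::euclidean_space \<Rightarrow> 'a"
  assumes T: "\<And>n. contraction (T n)" and B: "\<And>n. norm (T n 0) \<le> B"
  shows "\<exists>k S. strict_mono k \<and> contraction S \<and> (\<forall>x. (\<lambda>n. T (k n) x) \<longlonglongrightarrow> S x)"
proof -
  have lip: "norm (T n x - T n y) \<le> norm (x - y)" for n x y using T unfolding contraction_def by blast
  have bnd: "norm (T n x) \<le> B + norm x" for n x
    using norm_triangle_ineq2[of "T n x" "T n 0"] lip[of n x 0] B[of n] by simp
  obtain D :: "'a set" where D: "countable D" "D \<subseteq> UNIV" "UNIV \<subseteq> closure D" using separable by blast
  then have "D \<noteq> {}" by auto
  define d where "d = from_nat_into D"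
  have rd: "range d = D" unfolding d_def using D(1) \<open>D \<noteq> {}\<close> by (simp add: range_from_nat_into)
  interpret subseqs "\<lambda>n s. convergent (\<lambda>j. T (s j) (d n))"
  proof
    fix n and s :: "nat \<Rightarrow> nat" assume "strict_mono s"
    have "bounded (range (\<lambda>j. T (s j) (d n)))"
      unfolding bounded_iff using bnd by blast
    then obtain l r where "strict_mono r" "((\<lambda>j. T (s j) (d n)) \<circ> r) \<longlonglongrightarrow> l"
      using bounded_imp_convergent_subsequence by blast
    then show "\<exists>r. strict_mono r \<and> convergent (\<lambda>j. T ((s \<circ> r) j) (d n))"
      by (intro exI[of _ r]) (auto simp: o_def convergent_def)
  qed
  define k where "k = diagseq"
  have k: "strict_mono k" unfolding k_def by (rule subseq_diagseq)
  have convd: "convergent (\<lambda>j. T (k j) (d n))" for n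
  proof -
    have "convergent (\<lambda>j. T ((diagseq \<circ> (+) (Suc n)) j) (d n))"
    proof (rule diagseq_holds)
      fix r s :: "nat \<Rightarrow> nat" and n assume "strict_mono r" "convergent (\<lambda>j. T (s j) (d n))"
      then show "convergent (\<lambda>j. T ((s \<circ> r) j) (d n))"
        using convergent_subseq_convergent[of "\<lambda>j. T (s j) (d n)" r] by (simp add: o_def)
    qed
    then have "convergent (\<lambda>j. T (k (j + Suc n)) (d n))" by (simp add: o_def k_def add.commute)
    then show ?thesis using convergent_ignore_initial_segment[of "\<lambda>j. T (k j) (d n)" "Suc n"] by simp
  qed
  have "Cauchy (\<lambda>j. T (k j) x)" for x
  proof (rule CauchyI)
    fix e :: real assume "e > 0"
    have "x \<in> closure D" using D(3) by auto
    then obtain y where "y \<in> D" "dist y x < e / 3"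
      using \<open>e > 0\<close> closure_approachable[of x D] by (metis zero_less_divide_iff zero_less_numeral)
    then obtain n where n: "norm (d n - x) < e / 3" using rd by (auto simp: dist_norm)
    have "Cauchy (\<lambda>j. T (k j) (d n))" using convd by (rule convergent_Cauchy)
    then obtain M where M: "\<And>i j. i \<ge> M \<Longrightarrow> j \<ge> M \<Longrightarrow> norm (T (k i) (d n) - T (k j) (d n)) < e / 3"
      using CauchyD[of "\<lambda>j. T (k j) (d n)" "e / 3"] \<open>e > 0\<close> by auto
    have "norm (T (k i) x - T (k j) x) < e" if "i \<ge> M" "j \<ge> M" for i j
    proof -
      have "norm ((T (k i) x - T (k i) (d n)) + (T (k i) (d n) - T (k j) (d n)) + (T (k j) (d n) - T (k j) x))
         \<le> norm (T (k i) x - T (k i) (d n)) + norm (T (k i) (d n) - T (k j) (d n))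
         + norm (T (k j) (d n) - T (k j) x)"
        by (intro order_trans[OF norm_triangle_ineq] add_right_mono norm_triangle_ineq)
      then have "norm (T (k i) x - T (k j) x) \<le> norm (T (k i) x - T (k i) (d n)) + norm (T (k i) (d n) - T (k j) (d n))
         + norm (T (k j) (d n) - T (k j) x)"
        by simp
      then show ?thesis
        using lip[of "k i" x "d n"] lip[of "k j" "d n" x] M[OF that] n by (simp add: norm_minus_commute)
    qed
    then show "\<exists>M. \<forall>i\<ge>M. \<forall>j\<ge>M. norm (T (k i) x - T (k j) x) < e" by blast
  qed
  then have "\<forall>x. \<exists>l. (\<lambda>j. T (k j) x) \<longlonglongrightarrow> l" using Cauchy_convergent convergent_def by blast
  then obtain S where S: "\<And>x. (\<lambda>j. T (k j) x) \<longlonglongrightarrow> S x" using choice by metis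
  have "norm (S x - S y) \<le> norm (x - y)" for x y
  proof (rule LIMSEQ_le_const2)
    show "(\<lambda>j. norm (T (k j) x - T (k j) y)) \<longlonglongrightarrow> norm (S x - S y)" by (intro tendsto_intros S)
    show "\<exists>N. \<forall>j\<ge>N. norm (T (k j) x - T (k j) y) \<le> norm (x - y)" using lip by blast
  qed
  then show ?thesis using k S unfolding contraction_def by blast
qed

text \<open>
  The lower bounds for \<open>f\<close> and \<open>1 - f\<close> together give convergence of the integrals. Tightness keeps the
  images of the origin bounded: otherwise the maps would carry most of the mass of \<open>\<nu>\<close> out of a ball
  that holds most of the mass of \<open>\<mu>\<close>. A convergent subsequence then has the required limit.
\<close>

lemma contraction_limit:
  fixes \<mu> \<nu> :: "'a::euclidean_space measure" and T :: "nat \<Rightarrow> 'a \<Rightarrow> 'a"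
  assumes \<mu>: "prob_space \<mu>" "sets \<mu> = sets borel" and \<nu>: "prob_space \<nu>" "sets \<nu> = sets borel"
    and T: "\<And>n. contraction (T n)"
    and low: "\<And>f L e. (\<And>x. 0 \<le> f x \<and> f x \<le> (1::real)) \<Longrightarrow> 0 \<le> L \<Longrightarrow> (\<And>x y. \<bar>f x - f y\<bar> \<le> L * norm (x - y)) \<Longrightarrow> e > 0
      \<Longrightarrow> \<exists>n0. \<forall>n\<ge>n0. (\<integral>z. f z \<partial>\<mu>) - e \<le> (\<integral>y. f (T n y) \<partial>\<nu>)"
  shows "\<exists>S. contraction S \<and> distr \<nu> borel S = \<mu>"
proof -
  interpret M: prob_space \<mu> by fact
  interpret N: prob_space \<nu> by fact
  have [measurable_cong]: "sets \<mu> = sets borel" "sets \<nu> = sets borel" by fact+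
  have spaces: "space \<mu> = UNIV" "space \<nu> = UNIV" using sets_eq_imp_space_eq[OF \<mu>(2)] sets_eq_imp_space_eq[OF \<nu>(2)] by auto
  have mT [measurable]: "T n \<in> borel_measurable borel" for n by (rule contraction_borel_measurable[OF T])
  have lip_meas: "f \<in> borel_measurable borel" if "0 \<le> L" "\<And>x y. \<bar>f x - f y\<bar> \<le> L * norm (x - y)" for f :: "'a \<Rightarrow> real" and L
    by (intro borel_measurable_continuous_onI lipschitz_on_continuous_on[of L])
       (use that in \<open>auto simp: lipschitz_on_def dist_norm\<close>)
  have lim: "(\<lambda>n. \<integral>y. f (T n y) \<partial>\<nu>) \<longlonglongrightarrow> (\<integral>z. f z \<partial>\<mu>)"
    if f: "\<And>x. 0 \<le> f x \<and> f x \<le> (1::real)" and L: "0 \<le> L" "\<And>x y. \<bar>f x - f y\<bar> \<le> L * norm (x - y)" for f L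
  proof (rule LIMSEQ_I)
    fix e :: real assume e: "e > 0"
    have [measurable]: "f \<in> borel_measurable borel" by (rule lip_meas[OF L])
    have i1: "integrable \<mu> f" by (rule M.integrable_const_bound[where B=1]) (use f in auto)
    have i2: "integrable \<nu> (\<lambda>y. f (T n y))" for n by (rule N.integrable_const_bound[where B=1]) (use f in auto)
    obtain n1 where n1: "\<And>n. n \<ge> n1 \<Longrightarrow> (\<integral>z. f z \<partial>\<mu>) - e / 2 \<le> (\<integral>y. f (T n y) \<partial>\<nu>)"
      using low[of f L "e / 2", OF f L] e by auto
    have "\<exists>n0. \<forall>n\<ge>n0. (\<integral>z. 1 - f z \<partial>\<mu>) - e / 2 \<le> (\<integral>y. 1 - f (T n y) \<partial>\<nu>)"
    proof (rule low[of "\<lambda>x. 1 - f x" L])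
      show "0 \<le> 1 - f x \<and> 1 - f x \<le> 1" for x using f[of x] by simp
      show "\<bar>1 - f x - (1 - f y)\<bar> \<le> L * norm (x - y)" for x y using L(2)[of x y] by simp
    qed (use L e in auto)
    then obtain n2 where n2: "\<And>n. n \<ge> n2 \<Longrightarrow> (\<integral>z. 1 - f z \<partial>\<mu>) - e / 2 \<le> (\<integral>y. 1 - f (T n y) \<partial>\<nu>)"
      by auto
    show "\<exists>n0. \<forall>n\<ge>n0. norm ((\<integral>y. f (T n y) \<partial>\<nu>) - (\<integral>z. f z \<partial>\<mu>)) < e"
    proof (intro exI allI impI)
      fix n assume n: "n \<ge> max n1 n2"
      have a: "(\<integral>z. f z \<partial>\<mu>) - e / 2 \<le> (\<integral>y. f (T n y) \<partial>\<nu>)" using n1 n by simp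
      have "(\<integral>z. 1 - f z \<partial>\<mu>) - e / 2 \<le> (\<integral>y. 1 - f (T n y) \<partial>\<nu>)" using n2 n by simp
      moreover have "(\<integral>z. 1 - f z \<partial>\<mu>) = 1 - (\<integral>z. f z \<partial>\<mu>)" using i1 by (simp add: M.prob_space)
      moreover have "(\<integral>y. 1 - f (T n y) \<partial>\<nu>) = 1 - (\<integral>y. f (T n y) \<partial>\<nu>)" using i2[of n] by (simp add: N.prob_space)
      ultimately show "norm ((\<integral>y. f (T n y) \<partial>\<nu>) - (\<integral>z. f z \<partial>\<mu>)) < e"
        using a e unfolding real_norm_def abs_less_iff by linarith
    qed
  qed
  obtain R1 where R1: "\<forall>r\<ge>R1. measure \<mu> (cball 0 r) > 2/3" using prob_space_large_ball[OF \<mu>, of "2/3"] by auto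
  obtain R2 where R2: "\<forall>r\<ge>R2. measure \<nu> (cball 0 r) > 2/3" using prob_space_large_ball[OF \<nu>, of "2/3"] by auto
  define r where "r = max 0 (max R1 R2)"
  have r: "0 \<le> r" "measure \<mu> (cball 0 r) > 2/3" "measure \<nu> (cball 0 r) > 2/3"
    using R1 R2 by (auto simp: r_def)
  \<comment> \<open>The cutoff is 1 on the ball of radius \<open>r\<close> and 0 outside the ball of radius \<open>r + 1\<close>.\<close>
  define g :: "'a \<Rightarrow> real" where "g x = max 0 (1 - 1 * infdist x (cball 0 r))" for x
  have g01: "0 \<le> g x \<and> g x \<le> 1" for x unfolding g_def using infdist_nonneg[of x "cball 0 r"] by simp
  have ne: "cball 0 r \<noteq> ({} :: 'a set)" using r by simp
  have [measurable]: "cball (0::'a) r \<in> sets borel" by simp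
  have glip: "\<bar>g x - g y\<bar> \<le> 1 * norm (x - y)" for x y
    unfolding g_def by (rule infdist_cutoff_lipschitz[OF _ ne]) simp
  have [measurable]: "g \<in> borel_measurable borel" by (rule lip_meas[OF _ glip]) simp
  have gin: "g x = 1" if "x \<in> cball 0 r" for x using that by (simp add: g_def)
  have gout: "g x = 0" if "norm x \<ge> r + 1" for x
  proof -
    have "1 \<le> infdist x (cball 0 r)"
    proof -
      have "1 \<le> dist x a" if "a \<in> cball 0 r" for a
        using that \<open>norm x \<ge> r + 1\<close> norm_triangle_ineq2[of x a] by (simp add: dist_norm)
      then show ?thesis unfolding infdist_def using ne by (auto intro!: cINF_greatest)
    qed
    then show ?thesis by (simp add: g_def)
  qed
  have "(\<integral>z. indicator (cball 0 r) z \<partial>\<mu>) \<le> (\<integral>z. g z \<partial>\<mu>)"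
  proof (rule integral_mono)
    show "integrable \<mu> g" by (rule M.integrable_const_bound[where B=1]) (use g01 in auto)
    show "integrable \<mu> (indicator (cball 0 r) :: 'a \<Rightarrow> real)"
      by (rule M.integrable_const_bound[where B=1]) auto
    show "indicator (cball 0 r) x \<le> g x" for x using gin[of x] g01[of x] by (auto simp: indicator_def)
  qed
  then have gbig: "(\<integral>z. g z \<partial>\<mu>) > 2/3" using r(2) spaces by simp
  have "(\<lambda>n. \<integral>y. g (T n y) \<partial>\<nu>) \<longlonglongrightarrow> (\<integral>z. g z \<partial>\<mu>)" by (rule lim[OF g01 _ glip]) simp
  then have "\<forall>\<^sub>F n in sequentially. (\<integral>y. g (T n y) \<partial>\<nu>) > 2/3" using gbig by (rule order_tendstoD)
  then obtain n0 where n0: "\<And>n. n \<ge> n0 \<Longrightarrow> (\<integral>y. g (T n y) \<partial>\<nu>) > 2/3" by (auto simp: eventually_sequentially)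
  have T0: "norm (T n 0) \<le> 2 * r + 1" if "n \<ge> n0" for n
  proof (rule ccontr)
    assume neg: "\<not> norm (T n 0) \<le> 2 * r + 1"
    have z: "g (T n y) = 0" if "y \<in> cball 0 r" for y
    proof (rule gout)
      have "norm (T n 0 - T n y) \<le> norm (0 - y)" using T[of n] unfolding contraction_def by blast
      then show "r + 1 \<le> norm (T n y)" using that neg norm_triangle_ineq2[of "T n 0" "T n y"] by simp
    qed
    have "(\<integral>y. g (T n y) \<partial>\<nu>) \<le> (\<integral>y. 1 - indicator (cball 0 r) y \<partial>\<nu>)"
    proof (rule integral_mono)
      show "integrable \<nu> (\<lambda>y. g (T n y))" by (rule N.integrable_const_bound[where B=1]) (use g01 in auto)
      show "integrable \<nu> (\<lambda>y. 1 - indicator (cball 0 r) y :: real)"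
        by (rule N.integrable_const_bound[where B=1]) (auto simp: indicator_def)
      show "g (T n y) \<le> 1 - indicator (cball 0 r) y" for y
        using z[of y] g01[of "T n y"] by (auto simp: indicator_def)
    qed
    also have "\<dots> = 1 - measure \<nu> (cball 0 r)"
    proof -
      have "integrable \<nu> (indicator (cball 0 r) :: 'a \<Rightarrow> real)"
        by (rule N.integrable_const_bound[where B=1]) auto
      then show ?thesis using N.prob_space by (simp add: spaces)
    qed
    finally show False using n0[OF that] r(3) by simp
  qed
  obtain k S where k: "strict_mono k" and S: "contraction S" and conv: "\<And>x. (\<lambda>n. T (n0 + k n) x) \<longlonglongrightarrow> S x"
    using contractions_convergent_subsequence[of "\<lambda>n. T (n0 + n)" "2 * r + 1"] T T0 by auto
  have [measurable]: "S \<in> borel_measurable borel" by (rule contraction_borel_measurable[OF S])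
  have "distr \<nu> borel S = \<mu>"
  proof (rule measure_eqI_lipschitz)
    show "prob_space (distr \<nu> borel S)" by (rule N.prob_space_distr) simp
    fix f :: "'a \<Rightarrow> real" and L assume f: "\<And>x. 0 \<le> f x \<and> f x \<le> 1" and L: "0 \<le> L" "\<And>x y. \<bar>f x - f y\<bar> \<le> L * norm (x - y)"
    have [measurable]: "f \<in> borel_measurable borel" by (rule lip_meas[OF L])
    have "continuous_on UNIV f"
      by (rule lipschitz_on_continuous_on[of L]) (use L in \<open>auto simp: lipschitz_on_def dist_norm\<close>)
    then have contf: "isCont f x" for x by (simp add: continuous_on_eq_continuous_at)
    have "(\<lambda>n. \<integral>y. f (T (n0 + k n) y) \<partial>\<nu>) \<longlonglongrightarrow> (\<integral>y. f (S y) \<partial>\<nu>)"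
    proof (rule integral_dominated_convergence[where w="\<lambda>_. 1"])
      show "AE y in \<nu>. (\<lambda>n. f (T (n0 + k n) y)) \<longlonglongrightarrow> f (S y)"
        by (intro AE_I2 isCont_tendsto_compose[OF contf] conv)
    qed (use f in auto)
    moreover have "(\<lambda>n. \<integral>y. f (T (n0 + k n) y) \<partial>\<nu>) \<longlonglongrightarrow> (\<integral>z. f z \<partial>\<mu>)"
    proof -
      have "strict_mono (\<lambda>n. n0 + k n)" using k by (simp add: strict_mono_def)
      from LIMSEQ_subseq_LIMSEQ[OF lim[OF f L] this] show ?thesis by (simp add: o_def)
    qed
    ultimately have "(\<integral>y. f (S y) \<partial>\<nu>) = (\<integral>z. f z \<partial>\<mu>)" by (rule LIMSEQ_unique)
    then show "(\<integral>x. f x \<partial>distr \<nu> borel S) = (\<integral>x. f x \<partial>\<mu>)" by (simp add: integral_distr)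
  qed (use \<mu> in auto)
  then show ?thesis using S by blast
qed

section \<open>Existence of the contraction for a well-ordered coordinate type\<close>

lemma std_gaussian_eq: "std_gaussian = density lborel (\<lambda>x. ennreal (heat_kernel 1 x))"
  by (simp add: std_gaussian_def heat_kernel_def)

lemma prob_space_std_gaussian: "prob_space (std_gaussian :: 'a::euclidean_space measure)"
  unfolding std_gaussian_eq
  by (rule prob_spaceI) (simp add: emeasure_density nn_integral_heat_kernel cong: nn_integral_cong)

lemma convolution_std_gaussian:
  fixes \<mu> :: "'a::ordered_euclidean_space measure"
  assumes \<mu>: "prob_space \<mu>" "sets \<mu> = sets borel"
  shows "\<mu> \<star> std_gaussian = density lborel (\<lambda>x. ennreal (heat_flow \<mu> 1 x))"
proof (rule measure_eqI)
  interpret prob_space \<mu> by fact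
  interpret G: prob_space "std_gaussian :: 'a measure" by (rule prob_space_std_gaussian)
  note [measurable] = measurable_heat_flow[OF \<mu>]
  fix A assume "A \<in> sets (\<mu> \<star> std_gaussian)"
  then have A [measurable]: "A \<in> sets borel" by simp
  have "emeasure (\<mu> \<star> std_gaussian) A = (\<integral>\<^sup>+x. indicator A x \<partial>(\<mu> \<star> std_gaussian))"
    by (rule nn_integral_indicator[symmetric]) simp
  also have "\<dots> = (\<integral>\<^sup>+x. \<integral>\<^sup>+y. indicator A (x + y) \<partial>std_gaussian \<partial>\<mu>)"
    by (rule nn_integral_convolution[OF finite_measure_axioms G.finite_measure_axioms])
      (auto simp: \<mu> std_gaussian_def)
  also have "\<dots> = (\<integral>\<^sup>+x. \<integral>\<^sup>+y. ennreal (heat_kernel 1 y) * indicator A (x + y) \<partial>lborel \<partial>\<mu>)"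
    unfolding std_gaussian_eq by (intro nn_integral_cong nn_integral_density) auto
  also have "\<dots> = (\<integral>\<^sup>+x. ennreal (heat_flow \<mu> 1 x) * indicator A x \<partial>lborel)"
    by (rule nn_integral_heat_flow_mult[OF \<mu>, symmetric]) auto
  also have "\<dots> = emeasure (density lborel (\<lambda>x. ennreal (heat_flow \<mu> 1 x))) A"
    by (rule emeasure_density[symmetric]) auto
  finally show "emeasure (\<mu> \<star> std_gaussian) A = \<dots>" .
qed simp

lemma contraction_exists_wellorder:
  fixes \<mu> :: "(real^'m::{finite,wellorder}) measure"
  assumes \<mu>: "prob_space \<mu>" "sets \<mu> = sets borel" and lc: "log_concave_measure \<mu>"
  shows "\<exists>T. contraction T \<and> distr (\<mu> \<star> std_gaussian) borel T = \<mu>"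
proof -
  define K where "K = step_error CARD('m)"
  define c where "c = 1/2 + 2 * sqrt 2 ^ CARD('m)"
  define \<nu> where "\<nu> = (\<mu> \<star> std_gaussian)"
  have \<nu>: "\<nu> = density lborel (\<lambda>x. ennreal (heat_flow \<mu> 1 x))"
    unfolding \<nu>_def by (rule convolution_std_gaussian[OF \<mu>])
  note [measurable] = measurable_heat_flow[OF \<mu>]
  have hpos: "0 \<le> heat_flow \<mu> 1 x" for x using heat_flow_pos[OF \<mu>, of 1 x] by simp
  have prob\<nu>: "prob_space \<nu>"
    unfolding \<nu> by (rule prob_spaceI) (simp add: emeasure_density nn_integral_heat_flow[OF \<mu>] cong: nn_integral_cong)
  have approx: "\<exists>T. contraction T \<and> (\<forall>f L. (\<forall>x. 0 \<le> f x \<and> f x \<le> (1::real)) \<longrightarrow> 0 \<le> L \<longrightarrow>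
       (\<forall>x y. \<bar>f x - f y\<bar> \<le> L * norm (x - y)) \<longrightarrow>
       (\<integral>z. f z \<partial>\<mu>) - (L * c * sqrt (1 / Suc M) + K / Suc M) \<le> (\<integral>y. f (T y) \<partial>\<nu>))" for M :: nat
  proof -
    define m where "m = real (Suc M)"
    \<comment> \<open>The total error \<open>N * \<delta>\<^sup>2\<close> tends to 0 while \<open>N * \<delta>\<close>, and with it \<open>(1 + \<delta>) ^ N\<close>, tends to infinity.\<close>
    define N where "N = Suc M ^ 3"
    define \<delta> where "\<delta> = 1 / m\<^sup>2"
    define t where "t = 1 / (1 + \<delta>) ^ N"
    have m: "1 \<le> m" by (simp add: m_def)
    have \<delta>: "0 < \<delta>" "\<delta> \<le> 1" using m by (auto simp: \<delta>_def divide_le_eq_1)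
    have rN: "real N = m ^ 3" by (simp only: N_def m_def of_nat_power)
    have N\<delta>: "real N * \<delta> = m" "real N * (K * \<delta>\<^sup>2) = K / m"
      unfolding rN \<delta>_def using m by (auto simp: power2_eq_square power3_eq_cube field_simps)
    have t: "0 < t" "t * (1 + \<delta>) ^ N = 1" using \<delta> by (auto simp: t_def)
    have "m \<le> (1 + \<delta>) ^ N"
      using Bernoulli_inequality[of \<delta> N] \<delta> N\<delta> by simp
    then have tm: "t \<le> 1 / m" unfolding t_def using m by (intro divide_left_mono) auto
    obtain T where T: "contraction T" and TN: "\<And>f. f \<in> borel_measurable borel \<Longrightarrow> (\<forall>x. 0 \<le> f x \<and> f x \<le> (1::real)) \<Longrightarrow>
       (\<integral>x. f x * heat_flow \<mu> t x \<partial>lborel) - K / m \<le> (\<integral>y. f (T y) * heat_flow \<mu> 1 y \<partial>lborel)"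
      using reverse_heat_steps[OF \<mu> lc t(1) \<delta>, of N] unfolding t(2) K_def[symmetric] N\<delta>(2) by blast
    have [measurable]: "T \<in> borel_measurable borel" by (rule contraction_borel_measurable[OF T])
    show ?thesis
    proof (intro exI[of _ T] conjI T allI impI)
      fix f :: "real^'m::_ \<Rightarrow> real" and L assume f: "\<forall>x. 0 \<le> f x \<and> f x \<le> 1" and L: "0 \<le> L" "\<forall>x y. \<bar>f x - f y\<bar> \<le> L * norm (x - y)"
      have [measurable]: "f \<in> borel_measurable borel"
        by (intro borel_measurable_continuous_onI lipschitz_on_continuous_on[of L])
           (use L in \<open>auto simp: lipschitz_on_def dist_norm\<close>)
      have "(\<integral>z. f z \<partial>\<mu>) \<le> (\<integral>x. f x * heat_flow \<mu> t x \<partial>lborel) + L * c * sqrt t"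
        using integral_le_heat_flow[OF \<mu> t(1), of f L] f L unfolding c_def by simp
      also have "\<dots> \<le> (\<integral>x. f x * heat_flow \<mu> t x \<partial>lborel) + L * c * sqrt (1 / m)"
        using tm L by (intro add_left_mono mult_left_mono) (auto simp: c_def)
      finally have "(\<integral>z. f z \<partial>\<mu>) - (L * c * sqrt (1 / m) + K / m) \<le> (\<integral>y. f (T y) * heat_flow \<mu> 1 y \<partial>lborel)"
        using TN[of f] f by simp
      also have "\<dots> = (\<integral>y. f (T y) \<partial>\<nu>)"
        unfolding \<nu> by (subst integral_real_density) (auto simp: hpos mult.commute)
      finally show "(\<integral>z. f z \<partial>\<mu>) - (L * c * sqrt (1 / Suc M) + K / Suc M) \<le> (\<integral>y. f (T y) \<partial>\<nu>)"
        by (simp add: m_def)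
    qed
  qed
  then obtain T where T: "\<And>M. contraction (T M)" and TM: "\<And>M f L. (\<forall>x. 0 \<le> f x \<and> f x \<le> (1::real)) \<Longrightarrow> 0 \<le> L \<Longrightarrow>
       (\<forall>x y. \<bar>f x - f y\<bar> \<le> L * norm (x - y)) \<Longrightarrow>
       (\<integral>z. f z \<partial>\<mu>) - (L * c * sqrt (1 / Suc M) + K / Suc M) \<le> (\<integral>y. f (T M y) \<partial>\<nu>)"
    by metis
  have "\<exists>S. contraction S \<and> distr \<nu> borel S = \<mu>"
  proof (rule contraction_limit[OF \<mu> prob\<nu> _ T])
    show "sets \<nu> = sets borel" by (simp add: \<nu>)
    fix f :: "real^'m::_ \<Rightarrow> real" and L e :: real
    assume f: "\<And>x. 0 \<le> f x \<and> f x \<le> 1" and L: "0 \<le> L" "\<And>x y. \<bar>f x - f y\<bar> \<le> L * norm (x - y)" and e: "e > 0"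
    have "(\<lambda>M. L * c * sqrt (1 / Suc M) + K * (1 / Suc M)) \<longlonglongrightarrow> L * c * sqrt 0 + K * 0"
      by (intro tendsto_intros LIMSEQ_Suc lim_1_over_n)
    then have "\<forall>\<^sub>F M in sequentially. L * c * sqrt (1 / Suc M) + K * (1 / Suc M) < e"
      using e by (intro order_tendstoD) auto
    then obtain n0 where n0: "\<And>M. M \<ge> n0 \<Longrightarrow> L * c * sqrt (1 / Suc M) + K / Suc M < e"
      by (auto simp: eventually_sequentially)
    have "(\<integral>z. f z \<partial>\<mu>) - e \<le> (\<integral>y. f (T n y) \<partial>\<nu>)" if "n \<ge> n0" for n
      using TM[of f L n] f L n0[OF that] by fastforce
    then show "\<exists>n0. \<forall>n\<ge>n0. (\<integral>z. f z \<partial>\<mu>) - e \<le> (\<integral>y. f (T n y) \<partial>\<nu>)" by blast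
  qed
  then show ?thesis by (simp add: \<nu>_def)
qed

section \<open>Arbitrary finite coordinate types\<close>

text \<open>
  The change of variables formula needs a well-order on the coordinate type. An initial segment of the
  natural numbers with as many elements as the given type provides one, and reindexing coordinates
  is an isometry that preserves every notion in the theorem.
\<close>

typedef ('n::finite) index = "{..<CARD('n)}"
  by (auto intro: exI[of _ 0])

instantiation index :: (finite) linorder
begin

definition less_eq_index :: "'a index \<Rightarrow> 'a index \<Rightarrow> bool" where
  "i \<le> j \<longleftrightarrow> Rep_index i \<le> Rep_index j"

definition less_index :: "'a index \<Rightarrow> 'a index \<Rightarrow> bool" where
  "i < j \<longleftrightarrow> Rep_index i < Rep_index j"

instance
  by intro_classes (auto simp: less_eq_index_def less_index_def Rep_index_inject)

end

instance index :: (finite) wellorder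
proof
  fix P :: "'a index \<Rightarrow> bool" and i
  assume step: "\<And>i. (\<And>j. j < i \<Longrightarrow> P j) \<Longrightarrow> P i"
  show "P i"
    by (induction i rule: measure_induct_rule[of Rep_index]) (auto intro: step simp: less_index_def)
qed

instance index :: (finite) finite
proof
  have "inj (Rep_index :: 'a index \<Rightarrow> nat)" by (simp add: inj_def Rep_index_inject)
  moreover have "range (Rep_index :: 'a index \<Rightarrow> nat) \<subseteq> {..<CARD('a)}" using Rep_index by blast
  ultimately show "finite (UNIV :: 'a index set)"
    by (meson finite_imageD finite_lessThan finite_subset)
qed

lemma CARD_index: "CARD('n index) = CARD('n::finite)"
  using type_definition.card[OF type_definition_index] by simp

definition reindex :: "('m \<Rightarrow> 'n) \<Rightarrow> real^'n \<Rightarrow> real^'m" where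
  "reindex e x = (\<chi> j. x $ e j)"

lemma linear_reindex: "linear (reindex e)"
  by (intro linearI) (auto simp: reindex_def vec_eq_iff)

lemma reindex_inv: "bij e \<Longrightarrow> reindex (inv e) (reindex e x) = x"
  by (auto simp: reindex_def vec_eq_iff bij_def surj_f_inv_f)

lemma norm_reindex: "bij e \<Longrightarrow> norm (reindex e x) = norm x"
  unfolding norm_vec_def L2_set_def reindex_def
  by (simp add: sum.reindex_bij_betw[of e UNIV UNIV "\<lambda>i. (x $ i)\<^sup>2"])

lemma reindex_measurable: "reindex e \<in> borel_measurable borel"
  by (intro borel_measurable_continuous_onI linear_continuous_on linear_conv_bounded_linear[THEN iffD1] linear_reindex)

lemma distr_lborel_reindex:
  fixes e :: "'m::finite \<Rightarrow> 'n::finite"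
  assumes e: "bij e"
  shows "distr lborel borel (reindex e) = lborel"
proof (rule lborel_eqI[symmetric])
  note [measurable] = reindex_measurable[of e]
  fix l u :: "real^'m" assume lu: "\<And>b. b \<in> Basis \<Longrightarrow> l \<bullet> b \<le> u \<bullet> b"
  have le: "l $ j \<le> u $ j" for j using lu[of "axis j 1"] by (simp add: inner_axis axis_in_Basis_iff)
  let ?l = "reindex (inv e) l" and ?u = "reindex (inv e) u"
  have "reindex e -` box l u = box ?l ?u"
  proof -
    have "(\<forall>j. l $ j < x $ e j \<and> x $ e j < u $ j) \<longleftrightarrow> (\<forall>i. l $ inv e i < x $ i \<and> x $ i < u $ inv e i)" for x :: "real^'n"
      using e by (metis bij_inv_eq_iff)
    then show ?thesis by (auto simp: mem_box_cart reindex_def)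
  qed
  then have "emeasure (distr lborel borel (reindex e)) (box l u) = emeasure lborel (box ?l ?u)"
    by (subst emeasure_distr) auto
  also have "\<dots> = ennreal (\<Prod>b\<in>Basis. (?u - ?l) \<bullet> b)"
  proof (rule emeasure_lborel_box)
    fix b :: "real^'n" assume "b \<in> Basis"
    then obtain i where "b = axis i 1" by (auto simp: Basis_vec_def)
    then show "?l \<bullet> b \<le> ?u \<bullet> b" using le by (simp add: inner_axis reindex_def)
  qed
  also have "(\<Prod>b\<in>Basis. (?u - ?l) \<bullet> b) = (\<Prod>i\<in>UNIV. u $ inv e i - l $ inv e i)"
    unfolding prod_Basis_axis by (simp add: inner_axis reindex_def)
  also have "\<dots> = (\<Prod>j\<in>UNIV. u $ j - l $ j)"
    using prod.reindex_bij_betw[OF bij_imp_bij_inv[OF e], of "\<lambda>j. u $ j - l $ j"] by simp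
  also have "\<dots> = (\<Prod>b\<in>Basis. (u - l) \<bullet> b)"
    unfolding prod_Basis_axis by (simp add: inner_axis)
  finally show "emeasure (distr lborel borel (reindex e)) (box l u) = ennreal (\<Prod>b\<in>Basis. (u - l) \<bullet> b)" .
qed simp

lemma bij_CARD_eq: "bij (e :: 'm::finite \<Rightarrow> 'n::finite) \<Longrightarrow> CARD('m) = CARD('n)"
  by (rule bij_betw_same_card)

lemma prob_space_distr_reindex:
  fixes \<mu> :: "(real^'n) measure"
  assumes "prob_space \<mu>" "sets \<mu> = sets borel"
  shows "prob_space (distr \<mu> borel (reindex e))"
  using reindex_measurable[of e] measurable_cong_sets[OF assms(2) refl]
  by (intro prob_space.prob_space_distr[OF assms(1)]) auto

lemma log_concave_measure_reindex:
  fixes \<mu> :: "(real^'n) measure" and e :: "'m::finite \<Rightarrow> 'n"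
  assumes lc: "log_concave_measure \<mu>" and e: "bij e"
  shows "log_concave_measure (distr \<mu> borel (reindex e))"
proof -
  obtain k \<nu> A where ac: "ac_log_concave_measure k \<nu>" and A: "affine_map_Rn k A" "inj_on A (Rn k)"
    and \<mu>_eq: "\<mu> = distr \<nu> borel A"
    using lc unfolding log_concave_measure_def by auto
  have "sets \<nu> = sets (lborel_Rn k)" using ac unfolding ac_log_concave_measure_def by auto
  then have mA: "A \<in> measurable \<nu> borel"
    using affine_map_Rn_measurable[OF A(1)] measurable_cong_sets by blast
  have "affine_map_Rn k (\<lambda>x. reindex e (A x))"
  proof -
    obtain b v where "\<And>x. x \<in> Rn k \<Longrightarrow> A x = b + (\<Sum>i<k. x i *\<^sub>R v i)"
      using A(1) unfolding affine_map_Rn_def by auto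
    then have "\<forall>x\<in>Rn k. reindex e (A x) = reindex e b + (\<Sum>i<k. x i *\<^sub>R reindex e (v i))"
      by (simp add: linear_add[OF linear_reindex] linear_sum[OF linear_reindex] linear_scale[OF linear_reindex])
    then have "\<exists>v'. \<forall>x\<in>Rn k. reindex e (A x) = reindex e b + (\<Sum>i<k. x i *\<^sub>R v' i)"
      by (rule exI[of _ "\<lambda>i. reindex e (v i)"])
    then show ?thesis unfolding affine_map_Rn_def by (rule exI)
  qed
  moreover have "inj_on (\<lambda>x. reindex e (A x)) (Rn k)"
    using A(2) reindex_inv[OF e] unfolding inj_on_def by metis
  moreover have "distr \<mu> borel (reindex e) = distr \<nu> borel (\<lambda>x. reindex e (A x))"
    unfolding \<mu>_eq by (subst distr_distr) (auto simp: reindex_measurable mA o_def)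
  ultimately show ?thesis using ac unfolding log_concave_measure_def by blast
qed

lemma convolution_std_gaussian_reindex:
  fixes \<mu> :: "(real^'n) measure" and e :: "'m::finite \<Rightarrow> 'n"
  assumes \<mu>: "prob_space \<mu>" "sets \<mu> = sets borel" and e: "bij e"
  shows "distr (\<mu> \<star> std_gaussian) borel (reindex e) = (distr \<mu> borel (reindex e) \<star> std_gaussian)"
proof -
  let ?\<mu> = "distr \<mu> borel (reindex e)"
  have \<mu>': "prob_space ?\<mu>" "sets ?\<mu> = sets borel"
    using prob_space_distr_reindex[OF \<mu>] by auto
  have [measurable_cong]: "sets \<mu> = sets borel" by fact
  note [measurable] = reindex_measurable[of e] measurable_heat_flow[OF \<mu>'] measurable_heat_flow[OF \<mu>]
  have hk: "heat_kernel 1 (reindex e x - reindex e z) = heat_kernel 1 (x - z)" for x z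
    unfolding heat_kernel_def linear_diff[OF linear_reindex, symmetric] norm_reindex[OF e]
    by (simp add: bij_CARD_eq[OF e])
  have hf: "heat_flow ?\<mu> 1 (reindex e x) = heat_flow \<mu> 1 x" for x
    unfolding heat_flow_def by (subst integral_distr) (auto simp: hk)
  have "?\<mu> \<star> std_gaussian = density lborel (\<lambda>x. ennreal (heat_flow ?\<mu> 1 x))"
    by (rule convolution_std_gaussian[OF \<mu>'])
  also have "\<dots> = density (distr lborel borel (reindex e)) (\<lambda>x. ennreal (heat_flow ?\<mu> 1 x))"
    by (simp add: distr_lborel_reindex[OF e])
  also have "\<dots> = distr (density lborel (\<lambda>x. ennreal (heat_flow ?\<mu> 1 (reindex e x)))) borel (reindex e)"
    by (rule density_distr) measurable
  also have "\<dots> = distr (\<mu> \<star> std_gaussian) borel (reindex e)"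
    unfolding hf convolution_std_gaussian[OF \<mu>] ..
  finally show ?thesis by simp
qed

theorem theorem1p2:
  fixes \<mu> :: "(real ^ 'n) measure"
  assumes "prob_space \<mu>" and "sets \<mu> = sets borel" and "log_concave_measure \<mu>"
  shows "\<exists>T :: real ^ 'n \<Rightarrow> real ^ 'n. contraction T \<and> distr (\<mu> \<star> std_gaussian) borel T = \<mu>"
proof -
  obtain e :: "'n index \<Rightarrow> 'n" where e: "bij e"
    using finite_same_card_bij[of "UNIV :: 'n index set" "UNIV :: 'n set"] CARD_index by auto
  define \<Phi> where "\<Phi> = reindex e"
  define \<Psi> where "\<Psi> = reindex (inv e)"
  have inv: "\<Psi> (\<Phi> x) = x" for x by (simp add: \<Phi>_def \<Psi>_def reindex_inv e)
  have [measurable]: "\<Phi> \<in> borel_measurable borel" "\<Psi> \<in> borel_measurable borel"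
    by (simp_all add: \<Phi>_def \<Psi>_def reindex_measurable)
  have [measurable_cong]: "sets \<mu> = sets borel" by fact
  have iso: "norm (\<Phi> x - \<Phi> y) = norm (x - y)" "norm (\<Psi> v - \<Psi> w) = norm (v - w)" for x y v w
    by (simp_all add: \<Phi>_def \<Psi>_def norm_reindex e bij_imp_bij_inv flip: linear_diff[OF linear_reindex])
  obtain T where T: "contraction T" and push: "distr (distr \<mu> borel \<Phi> \<star> std_gaussian) borel T = distr \<mu> borel \<Phi>"
    using contraction_exists_wellorder[of "distr \<mu> borel \<Phi>"] prob_space_distr_reindex[OF assms(1,2), of e]
      log_concave_measure_reindex[OF assms(3) e] unfolding \<Phi>_def by auto
  have [measurable]: "T \<in> borel_measurable borel" by (rule contraction_borel_measurable[OF T])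
  have "contraction (\<lambda>x. \<Psi> (T (\<Phi> x)))"
    unfolding contraction_def iso(2)
  proof (intro allI)
    show "norm (T (\<Phi> x) - T (\<Phi> y)) \<le> norm (x - y)" for x y
      using T iso(1)[of x y] unfolding contraction_def by metis
  qed
  moreover have "distr (\<mu> \<star> std_gaussian) borel (\<lambda>x. \<Psi> (T (\<Phi> x))) = \<mu>"
  proof -
    have "distr (\<mu> \<star> std_gaussian) borel (\<lambda>x. \<Psi> (T (\<Phi> x)))
       = distr (distr (distr (\<mu> \<star> std_gaussian) borel \<Phi>) borel T) borel \<Psi>"
      by (simp add: distr_distr o_def)
    also have "distr (\<mu> \<star> std_gaussian) borel \<Phi> = (distr \<mu> borel \<Phi> \<star> std_gaussian)"
      unfolding \<Phi>_def by (rule convolution_std_gaussian_reindex[OF assms(1,2) e])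
    also have "distr (distr (distr \<mu> borel \<Phi> \<star> std_gaussian) borel T) borel \<Psi> = distr \<mu> borel (\<lambda>x. \<Psi> (\<Phi> x))"
      unfolding push by (simp add: distr_distr o_def)
    also have "\<dots> = \<mu>" unfolding inv by (rule distr_id2) (simp add: assms)
    finally show ?thesis .
  qed
  ultimately show ?thesis by blast
qed

end
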